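(* Let $\beta\in(0,1)$, let $(S_t)_{t\ge0}$ be a $\beta$-stable subordinator and let $(S_t^{-1})_{t\ge0}$ be the corresponding inverse $\beta$-stable subordinator. Let $X$ be a Feller process on a locally compact separable metric space $(M,\rho)$, independent of $S$, with transition probability density of the form $$p(t,x,y)=\frac{C_1}{t^{n/\alpha}}F\left(C_2\frac{\rho(x,y)}{t^{1/\alpha}}\right),\qquad t>0,\ x,y\in M,$$ where $n,\alpha,C_1,C_2>0$ are constants and $F:[0,\infty)\to(0,\infty)$ is a non-increasing profile function of exponential or polynomial type. Let $p^{S^{-1}}(t,x,y)=\int_0^\infty p(s,x,y)\,\mathrm{d}_s\mathbb{P}(S_t^{-1}\le s)$ be the transition density of $X_{S_t^{-1}}$. (a) If $\int_1^\infty s^{n-\alpha-1}F(s)\,\mathrm{d}s<\infty$, then as $\rho(x,y)^{-\alpha/\beta}t\to\infty$, $$p^{S^{-1}}(t,x,y)\sim\begin{cases}\displaystyle C_1F(0+)\frac{\Gamma\left(1-\frac n\alpha\right)}{\Gamma\left(1-\frac{\beta n}{\alpha}\right)}\,t^{-\beta n/\alpha},&\text{if } n<\alpha,\\[12pt] \displaystyle C_1\frac{\beta}{\Gamma(1-\beta)}\,F(0+)\,t^{-\beta}\log\left[\rho(x,y)^{-\alpha/\beta}t\right],&\text{if } n=\alpha,\\[12pt] \displaystyle C_1\frac{C_2^{\alpha-n}\alpha}{\Gamma(1-\beta)}\int_0^\infty s^{n-\alpha-1}F(s)\,\mathrm{d}s\cdot\rho(x,y)^{\alpha-n}t^{-\beta},&\text{if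 } n>\alpha.\end{cases}$$ (b) If $F$ is of polynomial type, $F(r)=(1+r^2)^{-(n+\alpha)/2}$ with $\alpha>0$, then as $\rho(x,y)^{-\alpha/\beta}t\to0$, $$p^{S^{-1}}(t,x,y)\sim C_1\frac{C_2^{-n-\alpha}}{\beta\Gamma(\beta)}\,\rho(x,y)^{-n-\alpha}t^\beta.$$ (c) If $F$ is of exponential type, $F(r)=\exp[-r^{\alpha/(\alpha-1)}]$ with $\alpha\ge2$, then as $\rho(x,y)^{-\alpha/\beta}t\to0$, $$p^{S^{-1}}(t,x,y)\sim K_1\,\rho(x,y)^{-\frac{n(1-\beta)}{\alpha-\beta}}\,t^{-\frac{n(\alpha-1)\beta}{\alpha(\alpha-\beta)}}\exp\left[-K_2\,\rho(x,y)^{\frac{\alpha}{\alpha-\beta}}t^{-\frac{\beta}{\alpha-\beta}}\right]$$ with the constants $$K_1:=C_1C_2^{-\frac{n(1-\beta)}{\alpha-\beta}}\sqrt{\frac{\alpha-1}{(\alpha-\beta)\beta}}\;(\alpha-1)^{\frac{n(\alpha-1)(1-\beta)}{\alpha(\alpha-\beta)}}\,\beta^{\frac{n(\alpha-1)\beta}{\alpha(\alpha-\beta)}},$$ $$K_2:=C_2^{\frac{\alpha}{\alpha-\beta}}(\alpha-\beta)(\alpha-1)^{-\frac{\alpha-1}{\alpha-\beta}}\beta^{\frac{\beta}{\alpha-\beta}}.$$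
   Context: A $\beta$-stable subordinator ($0<\beta<1$) is a non-decreasing Lévy process $S=(S_t)_{t\ge0}$ on $[0,\infty)$ with $\mathbb{E}\,e^{-rS_t}=e^{-tr^\beta}$ for $r>0$, $t\ge0$. Its generalized right-continuous inverse is $S_t^{-1}=\inf\{s\ge0: S_s>t\}$, $t\ge0$. The notation $\mathrm{d}_s\mathbb{P}(S_t^{-1}\le s)$ means integration with respect to the law of $S_t^{-1}$. Profile functions: $F$ is of exponential type if $F(r)=\exp[-r^{\alpha/(\alpha-1)}]$ with $\alpha\ge2$, and of polynomial type if $F(r)=(1+r^2)^{-(n+\alpha)/2}$ with $\alpha>0$; here $n,\alpha$ are the same constants as in the formula for $p$. $F(0+)=\lim_{r\downarrow0}F(r)$. Asymptotics: "$f(t,x,y)\sim g(t,x,y)$ as $A(t,x,y)\to\ell$" means that the ratio $f/g$ tends to $1$ as the quantity $A(t,x,y)$, with $t>0$ and $x,y\in M$, $x\ne y$, tends to $\ell$ (so the convergence depends on $(t,x,y)$ only through $A$). *)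

theory Defs
  imports "HOL-Probability.Probability"
begin

definition levy_process :: "'w measure \<Rightarrow> (real \<Rightarrow> 'w \<Rightarrow> real) \<Rightarrow> bool" where
  "levy_process \<Omega> S \<longleftrightarrow>
     prob_space \<Omega> \<and>
     (\<forall>t\<ge>0. S t \<in> borel_measurable \<Omega>) \<and>
     (AE \<omega> in \<Omega>. S 0 \<omega> = 0) \<and>
     (\<forall>(\<tau> :: nat \<Rightarrow> real) N. 0 \<le> \<tau> 0 \<and> mono \<tau> \<longrightarrow>
        prob_space.indep_vars \<Omega> (\<lambda>_. borel) (\<lambda>i \<omega>. S (\<tau> (Suc i)) \<omega> - S (\<tau> i) \<omega>) {..<N}) \<and>
     (\<forall>s t. 0 \<le> s \<and> s \<le> t \<longrightarrow>
        distr \<Omega> borel (\<lambda>\<omega>. S t \<omega> - S s \<omega>) = distr \<Omega> borel (S (t - s))) \<and>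
     (AE \<omega> in \<Omega>. \<forall>t\<ge>0.
        ((\<lambda>s. S s \<omega>) \<longlongrightarrow> S t \<omega>) (at_right t) \<and>
        (0 < t \<longrightarrow> (\<exists>l. ((\<lambda>s. S s \<omega>) \<longlongrightarrow> l) (at_left t))))"

definition stable_subordinator :: "'w measure \<Rightarrow> real \<Rightarrow> (real \<Rightarrow> 'w \<Rightarrow> real) \<Rightarrow> bool" where
  "stable_subordinator \<Omega> \<beta> S \<longleftrightarrow>
     levy_process \<Omega> S \<and>
     (AE \<omega> in \<Omega>. mono_on {0..} (\<lambda>t. S t \<omega>) \<and> (\<forall>t\<ge>0. 0 \<le> S t \<omega>)) \<and>
     (\<forall>r>0. \<forall>t\<ge>0. (\<integral>\<omega>. exp (- r * S t \<omega>) \<partial>\<Omega>) = exp (- t * r powr \<beta>))"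

text \<open>The infimum is taken over a non-empty set outside the null set on which a path of the
  stable subordinator stays bounded; on that null set the value is irrelevant.\<close>

definition right_inverse :: "(real \<Rightarrow> 'w \<Rightarrow> real) \<Rightarrow> real \<Rightarrow> 'w \<Rightarrow> real" where
  "right_inverse S t \<omega> = Inf {s. 0 \<le> s \<and> t < S s \<omega>}"

text \<open>The path properties of a subordinator hold only almost surely, so the inverse is measurable
  in general only up to null sets, that is, with respect to the completed measure.  If it is
  measurable with respect to \<open>\<Omega>\<close> itself, then this is its ordinary law.\<close>

definition inverse_law :: "'w measure \<Rightarrow> (real \<Rightarrow> 'w \<Rightarrow> real) \<Rightarrow> real \<Rightarrow> real measure" where
  "inverse_law \<Omega> S t = distr (completion \<Omega>) borel (right_inverse S t)"

text \<open>The point \<open>s = 0\<close>, where \<open>p\<close> is not defined, is excluded from the integral;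
  for \<open>t > 0\<close> it is a null set of the law.\<close>

definition time_changed_density ::
  "'w measure \<Rightarrow> (real \<Rightarrow> 'w \<Rightarrow> real) \<Rightarrow> (real \<Rightarrow> 'm \<Rightarrow> 'm \<Rightarrow> real) \<Rightarrow> real \<Rightarrow> 'm \<Rightarrow> 'm \<Rightarrow> real"
where
  "time_changed_density \<Omega> S p t x y = (LINT s:{0<..}|inverse_law \<Omega> S t. p s x y)"

definition vanishes_at_infinity :: "('m::topological_space \<Rightarrow> real) \<Rightarrow> bool" where
  "vanishes_at_infinity f \<longleftrightarrow> (\<forall>\<epsilon>>0. \<exists>K. compact K \<and> (\<forall>x. x \<notin> K \<longrightarrow> \<bar>f x\<bar> < \<epsilon>))"

definition C0 :: "('m::topological_space \<Rightarrow> real) set" where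
  "C0 = {f. continuous_on UNIV f \<and> vanishes_at_infinity f}"

definition feller_transition_function ::
  "(real \<Rightarrow> 'm::topological_space \<Rightarrow> 'm measure) \<Rightarrow> bool" where
  "feller_transition_function P \<longleftrightarrow>
     (\<forall>t\<ge>0. P t \<in> borel \<rightarrow>\<^sub>M prob_algebra borel) \<and>
     (\<forall>x. P 0 x = return borel x) \<and>
     (\<forall>s\<ge>0. \<forall>t\<ge>0. \<forall>x. P (s + t) x = P s x \<bind> P t) \<and>
     (\<forall>f\<in>C0. \<forall>t\<ge>0. (\<lambda>x. \<integral>y. f y \<partial>P t x) \<in> C0) \<and>
     (\<forall>f\<in>C0. uniform_limit UNIV (\<lambda>t x. \<integral>y. f y \<partial>P t x) f (at_right 0))"

definition generated_sigma ::
  "'w measure \<Rightarrow> (real \<Rightarrow> 'w \<Rightarrow> 'a::topological_space) \<Rightarrow> real set \<Rightarrow> 'w measure" where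
  "generated_sigma \<Omega> X T = sigma (space \<Omega>) {X r -` B \<inter> space \<Omega> | r B. r \<in> T \<and> B \<in> sets borel}"

definition natural_filtration ::
  "'w measure \<Rightarrow> (real \<Rightarrow> 'w \<Rightarrow> 'a::topological_space) \<Rightarrow> real \<Rightarrow> 'w measure" where
  "natural_filtration \<Omega> X t = generated_sigma \<Omega> X {0..t}"

definition feller_process ::
  "'w measure \<Rightarrow> (real \<Rightarrow> 'm::topological_space \<Rightarrow> 'm measure) \<Rightarrow> (real \<Rightarrow> 'w \<Rightarrow> 'm) \<Rightarrow> bool" where
  "feller_process \<Omega> P X \<longleftrightarrow>
     prob_space \<Omega> \<and>
     feller_transition_function P \<and>
     (\<forall>t\<ge>0. X t \<in> \<Omega> \<rightarrow>\<^sub>M borel) \<and>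
     (\<forall>s\<ge>0. \<forall>t\<ge>0. \<forall>B\<in>sets borel. AE \<omega> in \<Omega>.
        real_cond_exp \<Omega> (natural_filtration \<Omega> X s) (\<lambda>\<omega>'. indicator B (X (s + t) \<omega>')) \<omega>
          = measure (P t (X s \<omega>)) B)"

definition transition_density ::
  "'m::topological_space measure \<Rightarrow> (real \<Rightarrow> 'm \<Rightarrow> 'm measure) \<Rightarrow> (real \<Rightarrow> 'm \<Rightarrow> 'm \<Rightarrow> real) \<Rightarrow> bool"
where
  "transition_density \<mu> P p \<longleftrightarrow>
     sets \<mu> = sets borel \<and> (\<forall>t>0. \<forall>x. P t x = density \<mu> (\<lambda>y. ennreal (p t x y)))"

definition independent_processes ::
  "'w measure \<Rightarrow> (real \<Rightarrow> 'w \<Rightarrow> 'a::topological_space) \<Rightarrow> (real \<Rightarrow> 'w \<Rightarrow> 'b::topological_space) \<Rightarrow> bool"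
where
  "independent_processes \<Omega> X Y \<longleftrightarrow>
     prob_space.indep_set \<Omega> (sets (generated_sigma \<Omega> X {0..})) (sets (generated_sigma \<Omega> Y {0..}))"

definition exponential_type :: "real \<Rightarrow> (real \<Rightarrow> real) \<Rightarrow> bool" where
  "exponential_type \<alpha> F \<longleftrightarrow> 2 \<le> \<alpha> \<and> (\<forall>r\<ge>0. F r = exp (- (r powr (\<alpha> / (\<alpha> - 1)))))"

definition polynomial_type :: "real \<Rightarrow> real \<Rightarrow> (real \<Rightarrow> real) \<Rightarrow> bool" where
  "polynomial_type n \<alpha> F \<longleftrightarrow> 0 < \<alpha> \<and> (\<forall>r\<ge>0. F r = (1 + r\<^sup>2) powr (- (n + \<alpha>) / 2))"

text \<open>The limit is taken along the filter of all \<open>(t, x, y)\<close> with \<open>t > 0\<close> and \<open>x \<noteq> y\<close> generated by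
  \<open>A (t, x, y) \<rightarrow> \<ell>\<close>, where \<open>L\<close> is the filter of the real line for the limit \<open>\<ell>\<close>;
  thus the convergence is uniform over all \<open>(t, x, y)\<close> with the same value of \<open>A\<close>.\<close>

definition asymptotically_equal ::
  "(real \<Rightarrow> 'm \<Rightarrow> 'm \<Rightarrow> real) \<Rightarrow> real filter \<Rightarrow>
   (real \<Rightarrow> 'm \<Rightarrow> 'm \<Rightarrow> real) \<Rightarrow> (real \<Rightarrow> 'm \<Rightarrow> 'm \<Rightarrow> real) \<Rightarrow> bool" where
  "asymptotically_equal A L f g \<longleftrightarrow>
     ((\<lambda>(t, x, y). f t x y / g t x y) \<longlongrightarrow> 1)
       (inf (filtercomap (\<lambda>(t, x, y). A t x y) L) (principal {(t, x, y). 0 < t \<and> x \<noteq> y}))"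

end

theory Submission
  imports Defs "HOL-Real_Asymp.Real_Asymp"
begin

text \<open>
  Write \<open>\<beta> n / \<alpha> = q\<close> and \<open>G u = F (u powr (\<beta> / \<alpha>))\<close>.  By self-similarity the inverse \<open>S\<^sup>-\<^sup>1\<close> at time \<open>t\<close> has
  the law of \<open>t powr \<beta> * S\<^sub>1 powr (- \<beta>)\<close>, so the time-changed density is \<open>C1 * t powr (- q)\<close> times the
  expectation of \<open>S\<^sub>1 powr q * G (S\<^sub>1 / x)\<close>, where \<open>x\<close> is a constant multiple of \<open>\<rho> powr (- \<alpha> / \<beta>) * t\<close>.
  Everything is thereby reduced to the behaviour of this expectation for large and for small \<open>x\<close>.

  For large \<open>x\<close> the decisive fact is that the law of \<open>S\<^sub>1 / x\<close>, multiplied by \<open>x powr \<beta>\<close>, converges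
  to the Levy measure away from the origin; this yields the limit for \<open>n > \<alpha>\<close>, the logarithm for
  \<open>n = \<alpha>\<close>, while for \<open>n < \<alpha>\<close> a finite moment of \<open>S\<^sub>1\<close> remains.  For small \<open>x\<close> a polynomial
  profile leads to a negative moment of \<open>S\<^sub>1\<close>.  For an exponential profile, tilting the law of \<open>S\<^sub>1\<close> by a large
  negative power turns \<open>ln S\<^sub>1\<close> into an asymptotically Gaussian variable, because its moments are
  quotients of Gamma functions; centred at the saddle point, the integrand stays bounded and converges to
  a Gaussian function.
\<close>

section \<open>Weak convergence and moments of stable laws\<close>

text \<open>The stable law is accessible only through its Laplace transform exp (- r^\<beta>), so
  both tools are drawn from that transform alone. In the variable exp (- s / x) its values at the
  integers are moments on the unit interval, where moments determine weak limits; this produces the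
  Levy measure. Read as the tail of W / s with an independent standard exponential W, it gives the
  expectation of s^(-z) for complex z. On a vertical line the latter is, up to a phase, the
  characteristic function of ln s under a tilted law, so the Gaussian limit needs only a
  second-order Taylor expansion of \<open>ln_Gamma\<close> with a uniform remainder. The three cases
  for large arguments are the positions of q relative to \<beta>, the order from which on the
  moments of S_1 are infinite. Uniformity over the points comes for free: the quotient of the
  density and its claimed equivalent is eventually a function of \<rho>^(-\<alpha>/\<beta>) t
  alone.\<close>

lemma weak_conv_m_of_moments:
  fixes M :: "nat \<Rightarrow> real measure"
  assumes M: "\<And>k. real_distribution (M k)" and M': "real_distribution M'"
    and supp: "\<And>k. AE x in M k. x \<in> {0..1}" "AE x in M'. x \<in> {0..1}"
    and moments: "\<And>j::nat. (\<lambda>k. LINT x|M k. x ^ j) \<longlonglongrightarrow> (LINT x|M'. x ^ j)"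
  shows "weak_conv_m M M'"
proof (rule integral_bdd_continuous_conv_imp_weak_conv[OF M M'])
  fix f :: "real \<Rightarrow> real"
  assume cont: "\<And>x. isCont f x" and bdd: "\<And>x. \<bar>f x\<bar> \<le> 1"
  have f_meas [measurable]: "f \<in> borel_measurable borel"
    using cont by (intro borel_measurable_continuous_onI continuous_at_imp_continuous_on) auto
  have approx: "\<bar>(LINT x|N. f x) - (LINT x|N. g x)\<bar> \<le> e"
    if N: "real_distribution N" "AE x in N. x \<in> {0..1}"
      and g: "continuous_on UNIV g" "\<And>x. x \<in> {0..1} \<Longrightarrow> \<bar>f x - g x\<bar> < e"
    for N :: "real measure" and g :: "real \<Rightarrow> real" and e
  proof -
    interpret N: real_distribution N by (fact N(1))
    have [measurable]: "g \<in> borel_measurable borel"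
      using g(1) by (rule borel_measurable_continuous_onI)
    have int_f: "integrable N f"
      using bdd by (intro N.integrable_const_bound[where B=1]) auto
    have less: "AE x in N. \<bar>f x - g x\<bar> \<le> e"
      using N(2) by eventually_elim (use g(2) in \<open>auto intro: less_imp_le\<close>)
    have int_d: "integrable N (\<lambda>x. f x - g x)"
      using less by (intro N.integrable_const_bound[where B=e]) auto
    have "integrable N (\<lambda>x. f x - (f x - g x))"
      by (intro Bochner_Integration.integrable_diff int_f int_d)
    then have "(LINT x|N. f x) - (LINT x|N. g x) = (LINT x|N. f x - g x)"
      using int_f by simp
    also have "\<bar>\<dots>\<bar> \<le> (LINT x|N. \<bar>f x - g x\<bar>)"
      using integral_norm_bound[of N "\<lambda>x. f x - g x"] by simp
    also have "\<dots> \<le> (LINT x|N. e)"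
      using less int_d by (intro integral_mono_AE) auto
    finally show ?thesis using N.prob_space by simp
  qed
  show "(\<lambda>n. integral\<^sup>L (M n) f) \<longlonglongrightarrow> integral\<^sup>L M' f"
  proof (rule LIMSEQ_I)
    fix e :: real assume "0 < e"
    \<comment> \<open>Weierstrass approximation on the unit interval is enough because all the
      measures live there. Two approximation errors and the error of the moments make at most 3 e /
      4, which leaves room for the non-strict inequality in \<open>approx\<close>.\<close>
    obtain g where g: "real_polynomial_function g" "\<And>x. x \<in> {0..1} \<Longrightarrow> \<bar>f x - g x\<bar> < e / 4"
      using Stone_Weierstrass_real_polynomial_function[of "{0..1::real}" f "e / 4"] cont \<open>0 < e\<close>
      by (auto intro: continuous_at_imp_continuous_on)
    obtain a d where g_eq: "g = (\<lambda>x. \<Sum>i\<le>d. a i * x ^ i)"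
      using g(1) by (auto simp: real_polynomial_function_iff_sum)
    have cont_g: "continuous_on UNIV g"
      unfolding g_eq by (intro continuous_intros)
    have int: "integrable N (\<lambda>x. x ^ i)"
      if "real_distribution N" "AE x in N. x \<in> {0..1}" for N :: "real measure" and i :: nat
    proof -
      interpret N: real_distribution N by (fact that)
      have "AE x in N. norm (x ^ i) \<le> 1"
        using that(2) by eventually_elim (auto simp: power_le_one)
      then show ?thesis
        by (intro N.integrable_const_bound[where B=1]) auto
    qed
    have "(\<lambda>k. \<Sum>i\<le>d. a i * (LINT x|M k. x ^ i)) \<longlonglongrightarrow> (\<Sum>i\<le>d. a i * (LINT x|M'. x ^ i))"
      by (intro tendsto_intros moments)
    also have "(\<Sum>i\<le>d. a i * (LINT x|M'. x ^ i)) = (LINT x|M'. g x)"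
      unfolding g_eq using int[OF M' supp(2)] by simp
    also have "(\<lambda>k. \<Sum>i\<le>d. a i * (LINT x|M k. x ^ i)) = (\<lambda>k. LINT x|M k. g x)"
      unfolding g_eq using int[OF M supp(1)] by simp
    finally have "eventually (\<lambda>k. \<bar>(LINT x|M k. g x) - (LINT x|M'. g x)\<bar> < e / 4) sequentially"
      using \<open>0 < e\<close> by (auto dest!: tendstoD[where e="e/4"] simp: dist_real_def)
    then obtain n0 where n0: "\<And>k. k \<ge> n0 \<Longrightarrow> \<bar>(LINT x|M k. g x) - (LINT x|M'. g x)\<bar> < e / 4"
      by (auto simp: eventually_sequentially)
    show "\<exists>n0. \<forall>n\<ge>n0. norm (integral\<^sup>L (M n) f - integral\<^sup>L M' f) < e"
    proof (intro exI allI impI)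
      fix k assume "n0 \<le> k"
      show "norm (integral\<^sup>L (M k) f - integral\<^sup>L M' f) < e"
        using n0[OF \<open>n0 \<le> k\<close>] approx[OF M supp(1) cont_g g(2), of k] approx[OF M' supp(2) cont_g g(2)] \<open>0 < e\<close>
        by (simp add: abs_if split: if_splits)
    qed
  qed
qed

text \<open>Skorohod's theorem and Levy's continuity theorem work along sequences, while the
  parameters here are real. Restricting to sequences above 1 costs nothing at infinity and provides
  \<open>1 \<le> z\<close> at every index, which the uniform bound
  \<open>exp_minus_quadratic\<close> needs.\<close>

lemma tendsto_at_topI_sequentially_ge_1:
  fixes f :: "real \<Rightarrow> real"
  assumes "\<And>X. filterlim X at_top sequentially \<Longrightarrow> (\<And>n. 1 \<le> X n) \<Longrightarrow> (\<lambda>n. f (X n)) \<longlonglongrightarrow> l"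
  shows "(f \<longlongrightarrow> l) at_top"
proof (rule tendsto_at_topI_sequentially)
  fix X :: "nat \<Rightarrow> real" assume X: "filterlim X at_top sequentially"
  have ev: "eventually (\<lambda>n. max 1 (X n) = X n) sequentially"
    using filterlim_at_top[THEN iffD1, OF X, rule_format, of 1] by eventually_elim simp
  have "filterlim (\<lambda>n. max 1 (X n)) at_top sequentially"
    using X by (rule filterlim_cong[THEN iffD1, OF refl refl, rotated]) (use ev in eventually_elim, simp)
  then have "(\<lambda>n. f (max 1 (X n))) \<longlonglongrightarrow> l"
    by (rule assms) simp
  then show "(\<lambda>n. f (X n)) \<longlonglongrightarrow> l"
    by (rule Lim_transform_eventually) (use ev in eventually_elim, simp)
qed

section \<open>Stable laws given by their Laplace transform\<close>

locale stable_law = real_distribution D for D :: "real measure" +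
  fixes \<beta> :: real
  assumes \<beta>: "0 < \<beta>" "\<beta> < 1"
    and nonneg: "AE x in D. 0 \<le> x"
    and laplace: "\<And>r. 0 < r \<Longrightarrow> (LINT x|D. exp (- r * x)) = exp (- (r powr \<beta>))"
begin

lemma integrable_laplace: "0 \<le> r \<Longrightarrow> integrable D (\<lambda>x. exp (- r * x))"
  using nonneg by (intro integrable_const_bound[where B=1]) (auto elim!: eventually_mono)

text \<open>The mass at 0 is below every value of the Laplace transform, and these tend to 0.
  Positivity is what allows powers and logarithms of s to be manipulated freely later on.\<close>

lemma pos: "AE x in D. 0 < x"
proof -
  have le: "prob {0} \<le> exp (- (r powr \<beta>))" if "0 < r" for r
  proof -
    have "prob {0} = (LINT x|D. indicator {0} x)"
      by simp
    also have "\<dots> \<le> (LINT x|D. exp (- r * x))"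
      using that integrable_laplace[of r]
      by (intro integral_mono_AE integrable_real_indicator) (auto simp: less_top[symmetric] split: split_indicator)
    finally show ?thesis using laplace[OF that] by simp
  qed
  have "((\<lambda>r. exp (- (r powr \<beta>))) \<longlongrightarrow> 0) at_top"
    using \<beta> by real_asymp
  then have "prob {0} \<le> 0"
    by (rule tendsto_lowerbound) (use le in \<open>auto intro!: eventually_at_top_linorderI[of 1]\<close>)
  then have "prob {0} = 0" by (simp add: measure_le_0_iff)
  then have "AE x in D. x \<notin> {0}"
    by (subst AE_iff_measurable[OF _ refl]) (auto simp: emeasure_eq_measure)
  with nonneg show ?thesis by eventually_elim auto
qed

end

section \<open>Complex moments through an exponential mixing variable\<close>

abbreviation std_exp :: "real measure" where
  "std_exp \<equiv> density lborel (\<lambda>x. ennreal (exponential_density 1 x))"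

lemma real_distribution_std_exp: "real_distribution std_exp"
proof -
  interpret prob_space std_exp by (rule prob_space_exponential_density) simp
  show ?thesis by unfold_locales auto
qed

lemma AE_std_exp_pos: "AE x in std_exp. 0 < x"
proof -
  have "AE x in lborel. x \<noteq> (0::real)" by (rule AE_lborel_singleton)
  then show ?thesis
    by (subst AE_density) (auto elim!: eventually_mono simp: exponential_density_def ennreal_eq_0_iff)
qed

lemma measure_std_exp_greaterThan: "0 \<le> a \<Longrightarrow> measure std_exp {a<..} = exp (- a)"
proof -
  interpret real_distribution std_exp by (rule real_distribution_std_exp)
  assume "0 \<le> a"
  moreover have "distributed std_exp lborel (\<lambda>x. x) (exponential_density 1)"
    by (simp add: distributed_def distr_id2)
  ultimately have "measure std_exp {x \<in> space std_exp. a < x} = exp (- a * 1)"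
    by (intro exponential_distributedD_gt) auto
  also have "{x \<in> space std_exp. a < x} = {a<..}" by auto
  finally show ?thesis by simp
qed

text \<open>This is Euler's integral. The power is written through the logarithm so that one formula
  serves real moments and characteristic functions of ln x alike.\<close>

lemma std_exp_moment:
  fixes z :: complex
  assumes "-1 < Re z"
  shows "complex_integrable std_exp (\<lambda>x. exp (z * of_real (ln x)))"
    and "(CLINT x|std_exp. exp (z * of_real (ln x))) = Gamma (1 + z)"
proof -
  define h :: "real \<Rightarrow> complex" where "h x = indicator {0<..} x *\<^sub>R (exp (z * of_real (ln x)) * of_real (exp (- x)))" for x
  have [measurable]: "h \<in> borel_measurable borel"
    unfolding h_def by measurable
  have eq: "indicator {0<..} x *\<^sub>R (complex_of_real x powr (1 + z - 1) / of_real (exp x)) = h x" for x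
    by (auto simp: h_def powr_def exp_minus field_simps Ln_of_real exp_of_real split: split_indicator)
  have 1: "integrable lborel h"
  proof -
    have "(\<lambda>t. complex_of_real t powr (1 + z - 1) / of_real (exp t)) absolutely_integrable_on {0<..}"
      using assms by (intro absolutely_integrable_Gamma_integral') auto
    then have "integrable lebesgue h"
      unfolding set_integrable_def eq .
    then show ?thesis by (subst (asm) integrable_completion) auto
  qed
  have "((\<lambda>t. of_real t powr (1 + z - 1) / of_real (exp t)) has_integral Gamma (1 + z)) {0<..}"
    using assms by (intro Gamma_integral_complex') auto
  moreover have "((\<lambda>t. of_real t powr (1 + z - 1) / of_real (exp t)) has_integral
      (CLINT t:{0<..}|lebesgue. complex_of_real t powr (1 + z - 1) / of_real (exp t))) {0<..}"
    using assms by (intro has_integral_set_lebesgue absolutely_integrable_Gamma_integral') auto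
  ultimately have "Gamma (1 + z) = (CLINT t:{0<..}|lebesgue. complex_of_real t powr (1 + z - 1) / of_real (exp t))"
    by (rule has_integral_unique)
  also have "\<dots> = (CLINT t|lborel. h t)"
    unfolding set_lebesgue_integral_def eq by (rule integral_completion) simp
  finally have 2: "(CLINT t|lborel. h t) = Gamma (1 + z)" by simp
  have ae: "AE x in lborel. exponential_density 1 x *\<^sub>R exp (z * of_real (ln x)) = h x"
    using AE_lborel_singleton[of 0]
    by eventually_elim (auto simp: h_def exponential_density_def scaleR_conv_of_real split: split_indicator)
  show "complex_integrable std_exp (\<lambda>x. exp (z * of_real (ln x)))"
    by (subst integrable_density) (use 1 ae in \<open>auto simp: exponential_density_nonneg intro: integrable_cong_AE_imp\<close>)
  show "(CLINT x|std_exp. exp (z * of_real (ln x))) = Gamma (1 + z)"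
    using ae 2[symmetric] by (subst integral_density) (auto simp: exponential_density_nonneg intro!: integral_cong_AE)
qed

context stable_law
begin

text \<open>Division by a stable variable turns the Laplace transform into a tail probability, which yields all
  moments at once: those of \<open>std_exp\<close> are values of the Gamma function.\<close>

lemma exp_quotient_law:
  "distr (std_exp \<Otimes>\<^sub>M D) borel (\<lambda>(w, s). w / s) = distr std_exp borel (\<lambda>w. w powr (1 / \<beta>))"
proof -
  interpret E: real_distribution std_exp by (rule real_distribution_std_exp)
  interpret P: pair_prob_space std_exp D ..
  let ?Q = "distr (std_exp \<Otimes>\<^sub>M D) borel (\<lambda>(w, s). w / s)"
  let ?W = "distr std_exp borel (\<lambda>w. w powr (1 / \<beta>))"
  interpret Q: real_distribution ?Q by (rule P.real_distribution_distr) measurable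
  interpret W: real_distribution ?W by (rule E.real_distribution_distr) measurable
  have Q_tail: "Q.prob {r<..} = exp (- (r powr \<beta>))" if "0 \<le> r" for r
  proof -
    define A where "A = {p :: real \<times> real. r < fst p / snd p}"
    have A [measurable]: "A \<in> sets (std_exp \<Otimes>\<^sub>M D)"
    proof -
      have "Measurable.pred (std_exp \<Otimes>\<^sub>M D) (\<lambda>p. r < fst p / snd p)"
        by measurable
      then show ?thesis
        by (simp add: A_def pred_def space_pair_measure)
    qed
    have "emeasure ?Q {r<..} = emeasure (std_exp \<Otimes>\<^sub>M D) A"
      by (subst emeasure_distr) (auto simp: A_def space_pair_measure split: prod.splits intro!: arg_cong[where f="emeasure _"])
    also have "\<dots> = (\<integral>\<^sup>+s. emeasure std_exp ((\<lambda>w. (w, s)) -` A) \<partial>D)"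
      by (rule P.emeasure_pair_measure_alt2) (rule A)
    also have "\<dots> = (\<integral>\<^sup>+s. ennreal (exp (- r * s)) \<partial>D)"
    proof (rule nn_integral_cong_AE)
      show "AE s in D. emeasure std_exp ((\<lambda>w. (w, s)) -` A) = ennreal (exp (- r * s))"
        using pos
      proof eventually_elim
        case (elim s)
        then have "(\<lambda>w. (w, s)) -` A = {r * s<..}"
          by (auto simp: A_def field_simps)
        then show ?case
          using elim that measure_std_exp_greaterThan[of "r * s"] by (simp add: E.emeasure_eq_measure)
      qed
    qed
    also have "\<dots> = ennreal (LINT s|D. exp (- r * s))"
      using that by (intro nn_integral_eq_integral integrable_laplace) auto
    also have "(LINT s|D. exp (- r * s)) = exp (- (r powr \<beta>))"
      using that laplace[of r] prob_space by (cases "r = 0") auto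
    finally show ?thesis by (simp add: Q.emeasure_eq_measure)
  qed
  have W_tail: "W.prob {r<..} = exp (- (r powr \<beta>))" if "0 \<le> r" for r
  proof -
    have "W.prob {r<..} = E.prob {w. r < w powr (1 / \<beta>)}"
      by (subst measure_distr) (auto intro!: arg_cong[where f="measure _"])
    also have "\<dots> = E.prob {r powr \<beta><..}"
    proof (rule E.finite_measure_eq_AE)
      show "AE w in std_exp. w \<in> {w. r < w powr (1 / \<beta>)} \<longleftrightarrow> w \<in> {r powr \<beta><..}"
        using AE_std_exp_pos
      proof eventually_elim
        case (elim w)
        have "r < w powr (1 / \<beta>) \<longleftrightarrow> r powr \<beta> < (w powr (1 / \<beta>)) powr \<beta>"
          using powr_less_mono2[of \<beta> r "w powr (1 / \<beta>)"] powr_mono2[of \<beta> "w powr (1 / \<beta>)" r] \<beta> that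
          by (meson less_imp_le not_le powr_ge_zero)
        then show ?case using elim \<beta> by (simp add: powr_powr)
      qed
    qed auto
    finally show ?thesis by (simp add: measure_std_exp_greaterThan)
  qed
  have prob_compl: "measure N {..r} = 1 - measure N {r<..}" if "real_distribution N" for N and r :: real
  proof -
    interpret N: real_distribution N by fact
    have "{..r} = space N - {r<..}" by auto
    then show ?thesis using N.prob_compl[of "{r<..}"] by simp
  qed
  show ?thesis
  proof (rule cdf_unique)
    show "cdf ?Q = cdf ?W"
    proof
      fix r
      have "Q.prob {r<..} = W.prob {r<..}"
      proof (cases "0 \<le> r")
        case True
        then show ?thesis using Q_tail W_tail by simp
      next
        case False
        \<comment> \<open>At 0 both tails are already 1, and tails grow as the threshold moves left;
          hence both are 1 for every negative threshold.\<close>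
        then have "Q.prob {0<..} \<le> Q.prob {r<..}" "W.prob {0<..} \<le> W.prob {r<..}"
          by (auto intro!: Q.finite_measure_mono W.finite_measure_mono)
        then show ?thesis
          using Q_tail[of 0] W_tail[of 0] Q.prob_le_1[of "{r<..}"] W.prob_le_1[of "{r<..}"] by (simp del: Q.prob_le_1 W.prob_le_1)
      qed
      then show "cdf ?Q r = cdf ?W r"
        using prob_compl[of ?Q r] prob_compl[of ?W r] Q.real_distribution_axioms W.real_distribution_axioms
        by (simp add: cdf_def)
    qed
  qed unfold_locales
qed

text \<open>The expectation of (W / s)^z is computed in two ways. By \<open>exp_quotient_law\<close>
  it is the moment of W of order z / \<beta>; by independence it is Gamma (1 + z) times the wanted
  moment. The condition on Re z is exactly convergence of Euler's integral for Gamma (1 + z /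
  \<beta>).\<close>

lemma complex_moment:
  fixes z :: complex
  assumes z: "- \<beta> < Re z"
  shows "complex_integrable D (\<lambda>s. exp (- z * of_real (ln s)))"
    and "(CLINT s|D. exp (- z * of_real (ln s))) = Gamma (1 + z / of_real \<beta>) / Gamma (1 + z)"
proof -
  interpret E: real_distribution std_exp by (rule real_distribution_std_exp)
  interpret P: pair_prob_space std_exp D ..
  have Re: "- 1 < Re z" "- 1 < Re (z / of_real \<beta>)"
    using z \<beta> by (auto simp: field_simps)
  define f where "f w s = exp (z * complex_of_real (ln w)) * exp (- z * of_real (ln s))" for w s
  have f_meas [measurable]: "case_prod f \<in> borel_measurable (std_exp \<Otimes>\<^sub>M D)"
    unfolding f_def by measurable
  have AE_f: "AE p in std_exp \<Otimes>\<^sub>M D. exp (z * of_real (ln (case p of (w, s) \<Rightarrow> w / s))) = case_prod f p"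
  proof (rule P.AE_pair_measure)
    show "AE x in std_exp. AE y in D. exp (z * of_real (ln (case (x, y) of (w, s) \<Rightarrow> w / s))) = case_prod f (x, y)"
      using AE_std_exp_pos
    proof eventually_elim
      case (elim w)
      show ?case using pos
        by eventually_elim (use elim in \<open>simp add: f_def ln_div exp_add[symmetric] algebra_simps\<close>)
    qed
  qed measurable
  have AE_W: "AE w in std_exp. exp (z * of_real (ln (w powr (1 / \<beta>)))) = exp ((z / of_real \<beta>) * complex_of_real (ln w))"
    using AE_std_exp_pos by eventually_elim (simp add: ln_powr)
  have intQ: "complex_integrable (distr (std_exp \<Otimes>\<^sub>M D) borel (\<lambda>(w, s). w / s)) (\<lambda>x. exp (z * of_real (ln x)))"
    unfolding exp_quotient_law
    using std_exp_moment(1)[OF Re(2)] AE_W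
    by (subst integrable_distr_eq) (auto intro: integrable_cong_AE_imp elim!: eventually_mono)
  then have int_f: "complex_integrable (std_exp \<Otimes>\<^sub>M D) (case_prod f)"
    by (subst (asm) integrable_distr_eq) (use AE_f in \<open>auto intro: integrable_cong_AE_imp elim!: eventually_mono\<close>)
  \<comment> \<open>\<open>Gamma\<close> takes the value 0 at its poles and nowhere else, and Re z >
    - 1 keeps 1 + z away from them.\<close>
  have Gz: "Gamma (1 + z) \<noteq> 0"
  proof
    assume "Gamma (1 + z) = 0"
    then obtain n where "1 + z = - of_nat n"
      by (auto simp: Gamma_eq_zero_iff elim!: nonpos_Ints_cases')
    then have "Re (1 + z) = - real n" by simp
    with Re show False by simp
  qed
  have "AE w in std_exp. complex_integrable D (\<lambda>s. f w s)"
    using P.AE_integrable_fst[OF int_f] .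
  \<comment> \<open>Fubini gives integrability in s for almost every w. A single w suffices, since
    its factor in \<open>f\<close> never vanishes and can be divided out.\<close>
  then obtain w where w: "complex_integrable D (\<lambda>s. f w s)"
    using E.AE_False by (metis (no_types, lifting) eventually_mono)
  then have "complex_integrable D (\<lambda>s. exp (- (z * complex_of_real (ln w))) * f w s)"
    by (rule integrable_mult_right)
  then show int: "complex_integrable D (\<lambda>s. exp (- z * of_real (ln s)))"
    by (simp add: f_def mult.assoc[symmetric] exp_minus)
  have "Gamma (1 + z / of_real \<beta>) = (CLINT w|std_exp. exp ((z / of_real \<beta>) * of_real (ln w)))"
    using std_exp_moment(2)[OF Re(2)] by simp
  also have "\<dots> = (CLINT x|distr std_exp borel (\<lambda>w. w powr (1 / \<beta>)). exp (z * of_real (ln x)))"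
    using AE_W by (subst integral_distr) (auto intro!: integral_cong_AE elim!: eventually_mono)
  also have "\<dots> = (CLINT p|std_exp \<Otimes>\<^sub>M D. case_prod f p)"
    unfolding exp_quotient_law[symmetric]
    using AE_f by (subst integral_distr) (auto intro!: integral_cong_AE elim!: eventually_mono)
  also have "\<dots> = (CLINT w|std_exp. CLINT s|D. f w s)"
    using P.integral_fst'[OF int_f] by simp
  also have "\<dots> = (CLINT w|std_exp. exp (z * of_real (ln w)) * (CLINT s|D. exp (- z * of_real (ln s))))"
    unfolding f_def by simp
  also have "\<dots> = Gamma (1 + z) * (CLINT s|D. exp (- z * of_real (ln s)))"
    using std_exp_moment(2)[OF Re(1)] by simp
  finally show "(CLINT s|D. exp (- z * of_real (ln s))) = Gamma (1 + z / of_real \<beta>) / Gamma (1 + z)"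
    using Gz by (simp add: field_simps)
qed

lemma moment:
  assumes "- \<beta> < a"
  shows "integrable D (\<lambda>s. s powr (- a))"
    and "(LINT s|D. s powr (- a)) = Gamma (1 + a / \<beta>) / Gamma (1 + a)"
proof -
  have ae: "AE s in D. exp (- of_real a * of_real (ln s)) = complex_of_real (s powr (- a))"
    using pos
  proof eventually_elim
    case (elim s)
    have "complex_of_real (s powr (- a)) = complex_of_real (exp (- a * ln s))"
      using elim by (simp add: powr_def)
    also have "\<dots> = exp (of_real (- a * ln s))"
      by (rule exp_of_real[symmetric])
    also have "complex_of_real (- a * ln s) = - of_real a * of_real (ln s)"
      by (simp only: of_real_mult of_real_minus)
    finally show ?case by (rule sym)
  qed
  have 1: "complex_integrable D (\<lambda>s. complex_of_real (s powr (- a)))"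
    using complex_moment(1)[of "of_real a"] assms ae by (auto intro: integrable_cong_AE_imp elim!: eventually_mono)
  then show "integrable D (\<lambda>s. s powr (- a))"
    by (simp add: complex_of_real_integrable_eq)
  have "complex_of_real (LINT s|D. s powr (- a)) = (CLINT s|D. exp (- of_real a * of_real (ln s)))"
    unfolding integral_complex_of_real[symmetric] using ae
    by (intro integral_cong_AE) (auto elim!: eventually_mono)
  also have "\<dots> = of_real (Gamma (1 + a / \<beta>) / Gamma (1 + a))"
    using complex_moment(2)[of "of_real a"] assms by (simp add: Gamma_complex_of_real[symmetric])
  finally show "(LINT s|D. s powr (- a)) = Gamma (1 + a / \<beta>) / Gamma (1 + a)"
    by (simp only: of_real_eq_iff)
qed

end

section \<open>Asymptotics of the Gamma function\<close>

text \<open>The series of 1 / (x + k)^2 is compared term by term with a telescoping series. The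
  potential \<open>a\<close> consists of the first two terms of the asymptotic expansion, chosen so
  that the difference of the terms is the small nonnegative quantity 1 / (2 y^2 (y + 1)^2) with y =
  x + k.\<close>

lemma Polygamma_1_real_bounds:
  fixes x :: real
  assumes x: "0 < x"
  shows "1 / x + 1 / (2 * x\<^sup>2) \<le> Polygamma 1 x"
    and "Polygamma 1 x \<le> 1 / x + 1 / (2 * x\<^sup>2) + 1 / (2 * x ^ 3)"
proof -
  define a where "a k = 1 / (x + real k) + 1 / (2 * (x + real k)\<^sup>2)" for k
  define b where "b k = inverse ((x + real k)\<^sup>2)" for k
  \<comment> \<open>One factor 1 / (2 y (y + 1)) of that difference is bounded by 1 / (2 x^2); the
    remaining 1 / (y (y + 1)) telescopes. The sum of \<open>c\<close> is the extra term 1 / (2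
    x^3).\<close>
  define c where "c k = 1 / (2 * x\<^sup>2) * (1 / (x + real k) - 1 / (x + real (Suc k)))" for k
  have "a \<longlonglongrightarrow> 0"
    unfolding a_def by real_asymp
  then have a: "(\<lambda>k. a k - a (Suc k)) sums (a 0 - 0)"
    by (rule telescope_sums')
  have b: "b sums Polygamma 1 x"
    using Polygamma_converges'[of x 2] x unfolding b_def Polygamma_def
    by (auto simp: numeral_2_eq_2 intro!: summable_sums)
  have "(\<lambda>k. 1 / (x + real k)) \<longlonglongrightarrow> 0"
    by real_asymp
  then have c: "c sums (1 / (2 * x\<^sup>2) * (1 / (x + real 0) - 0))"
    unfolding c_def by (intro sums_mult telescope_sums')
  have diff: "b k - (a k - a (Suc k)) = 1 / (2 * (x + k)\<^sup>2 * (x + k + 1)\<^sup>2)" for k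
  proof -
    define y where "y = x + real k"
    have y: "0 < y" using x by (simp add: y_def)
    have "inverse (y\<^sup>2) - (1 / y + 1 / (2 * y\<^sup>2) - (1 / (y + 1) + 1 / (2 * (y + 1)\<^sup>2)))
      = 1 / (2 * y\<^sup>2 * (y + 1)\<^sup>2)"
      using y by (simp add: divide_simps) (simp add: algebra_simps power2_eq_square)
    then show ?thesis by (simp add: a_def b_def y_def add_ac)
  qed
  have "a k - a (Suc k) \<le> b k" for k
    using diff[of k] x by (smt (verit) divide_nonneg_nonneg zero_le_power2 mult_nonneg_nonneg)
  from sums_le[OF this a b] show "1 / x + 1 / (2 * x\<^sup>2) \<le> Polygamma 1 x"
    by (simp add: a_def)
  have "b k \<le> a k - a (Suc k) + c k" for k
  proof -
    define y where "y = x + real k"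
    have y: "x \<le> y" "0 < y" using x by (auto simp: y_def)
    have "1 / (2 * y\<^sup>2 * (y + 1)\<^sup>2) = 1 / (2 * (y * (y + 1))) * (1 / (y * (y + 1)))"
      by (simp add: power2_eq_square)
    also have "\<dots> \<le> 1 / (2 * x\<^sup>2) * (1 / (y * (y + 1)))"
      using x y by (intro mult_right_mono divide_left_mono) (auto simp: power2_eq_square intro!: mult_mono)
    also have "1 / (y * (y + 1)) = 1 / y - 1 / (y + 1)"
      using y by (simp add: field_simps)
    finally show ?thesis
      using diff[of k] by (simp add: c_def y_def add_ac)
  qed
  from sums_le[OF this b sums_add[OF a c]]
  show "Polygamma 1 x \<le> 1 / x + 1 / (2 * x\<^sup>2) + 1 / (2 * x ^ 3)"
    by (simp add: a_def power2_eq_square power3_eq_cube)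
qed

text \<open>In the half-plane the modulus of z + k is at least x + k. One factor 1 / (x + k) of each
  term is bounded by 1 / x, and what remains is \<open>Polygamma 1 x\<close>, at most 2 / x because
  x \<ge> 1. The bound is uniform on the half-plane, as a Taylor remainder along vertical lines
  requires.\<close>

lemma norm_Polygamma_2_le:
  fixes z :: complex
  assumes x: "1 \<le> x" "x \<le> Re z"
  shows "norm (Polygamma 2 z) \<le> 4 / x\<^sup>2"
proof -
  have z: "z \<noteq> 0" using x by auto
  have b: "summable (\<lambda>k. inverse ((x + real k)\<^sup>2))"
    using Polygamma_converges'[of x 2] x by simp
  have le: "norm (inverse ((z + of_nat k) ^ 3)) \<le> 1 / x * inverse ((x + real k)\<^sup>2)" for k
  proof -
    have xk: "x + real k \<le> norm (z + of_nat k)"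
      using complex_Re_le_cmod[of "z + of_nat k"] x by simp
    have "norm (inverse ((z + of_nat k) ^ 3)) = inverse (norm (z + of_nat k) ^ 3)"
      by (simp add: norm_inverse norm_power)
    also have "\<dots> \<le> inverse ((x + real k) ^ 3)"
      using x xk by (intro le_imp_inverse_le power_mono zero_less_power) auto
    also have "\<dots> = inverse (x + real k) * inverse ((x + real k)\<^sup>2)"
      by (simp add: power3_eq_cube power2_eq_square)
    also have "\<dots> \<le> 1 / x * inverse ((x + real k)\<^sup>2)"
      using x by (intro mult_right_mono) (auto simp: inverse_eq_divide intro!: divide_left_mono)
    finally show ?thesis .
  qed
  have "norm (Polygamma 2 z) = 2 * norm (\<Sum>k. inverse ((z + of_nat k) ^ 3))"
    by (simp add: Polygamma_def norm_mult numeral_3_eq_3 numeral_2_eq_2)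
  also have "norm (\<Sum>k. inverse ((z + of_nat k) ^ 3)) \<le> (\<Sum>k. 1 / x * inverse ((x + real k)\<^sup>2))"
    using b le by (intro norm_suminf_le summable_mult)
  also have "\<dots> = 1 / x * Polygamma 1 x"
    using b by (subst suminf_mult) (auto simp: Polygamma_def numeral_2_eq_2)
  also have "\<dots> \<le> 1 / x * (1 / x + 1 / (2 * x\<^sup>2) + 1 / (2 * x ^ 3))"
    using x Polygamma_1_real_bounds(2)[of x] by (intro mult_left_mono) auto
  also have "\<dots> \<le> 1 / x * (1 / x + 1 / (2 * x) + 1 / (2 * x))"
    using x by (intro mult_left_mono add_mono divide_left_mono)
      (auto simp: power2_eq_square power3_eq_cube mult_le_cancel_left1 mult_ge1_I)
  also have "\<dots> = 2 / x\<^sup>2"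
    using x by (simp add: field_simps power2_eq_square)
  finally show ?thesis by simp
qed

section \<open>Digamma, Stirling's formula and quotients of Gamma values\<close>

definition Digamma_err :: "real \<Rightarrow> real" where
  "Digamma_err x = Digamma x - ln x + 1 / (2 * x)"

text \<open>The two bounds on \<open>Polygamma 1\<close> say that the error increases and that the
  error plus 1 / (4 x^2) decreases. Both tend to 0 along the integers, by the definition of the
  Euler-Mascheroni constant, and monotonicity then fixes their signs.\<close>

lemma Digamma_err_bounds:
  assumes x: "0 < x"
  shows "Digamma_err x \<le> 0" and "- (1 / (4 * x\<^sup>2)) \<le> Digamma_err x"
proof -
  have deriv: "(Digamma_err has_real_derivative Polygamma 1 y - 1 / y - 1 / (2 * y\<^sup>2)) (at y)" if "0 < y" for y
    unfolding Digamma_err_def[abs_def] using that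
    by (auto intro!: derivative_eq_intros simp: field_simps power2_eq_square elim!: nonpos_Ints_cases)
  have deriv': "((\<lambda>y. Digamma_err y + 1 / (4 * y\<^sup>2)) has_real_derivative
      Polygamma 1 y - 1 / y - 1 / (2 * y\<^sup>2) - 1 / (2 * y ^ 3)) (at y)" if "0 < y" for y
    using that by (auto intro!: derivative_eq_intros deriv simp: field_simps power2_eq_square power3_eq_cube)
  have mono: "Digamma_err a \<le> Digamma_err b" if "0 < a" "a \<le> b" for a b
  proof (rule DERIV_nonneg_imp_nondecreasing[OF \<open>a \<le> b\<close>])
    fix t assume "a \<le> t" "t \<le> b"
    then have "0 < t" using that by simp
    then show "\<exists>d. (Digamma_err has_real_derivative d) (at t) \<and> 0 \<le> d"
      using deriv[of t] Polygamma_1_real_bounds(1)[of t]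
      by (intro exI[of _ "Polygamma 1 t - 1 / t - 1 / (2 * t\<^sup>2)"]) auto
  qed
  have antimono: "Digamma_err b + 1 / (4 * b\<^sup>2) \<le> Digamma_err a + 1 / (4 * a\<^sup>2)" if "0 < a" "a \<le> b" for a b
  proof (rule DERIV_nonpos_imp_nonincreasing[OF \<open>a \<le> b\<close>])
    fix t assume "a \<le> t" "t \<le> b"
    then have "0 < t" using that by simp
    then show "\<exists>d. ((\<lambda>y. Digamma_err y + 1 / (4 * y\<^sup>2)) has_real_derivative d) (at t) \<and> d \<le> 0"
      using deriv'[of t] Polygamma_1_real_bounds(2)[of t]
      by (intro exI[of _ "Polygamma 1 t - 1 / t - 1 / (2 * t\<^sup>2) - 1 / (2 * t ^ 3)"]) auto
  qed
  have lim: "(\<lambda>n. Digamma_err (real (Suc n))) \<longlonglongrightarrow> 0"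
  proof -
    have "(\<lambda>n. (harm n - ln (real n)) - euler_mascheroni + (ln (real n) - ln (real (Suc n)) + 1 / (2 * real (Suc n)))) \<longlonglongrightarrow>
        euler_mascheroni - euler_mascheroni + (0::real)"
      by (intro tendsto_add tendsto_diff tendsto_const euler_mascheroni_LIMSEQ) real_asymp
    also have "(\<lambda>n. (harm n - ln (real n)) - euler_mascheroni + (ln (real n) - ln (real (Suc n)) + 1 / (2 * real (Suc n))))
        = (\<lambda>n. Digamma_err (real (Suc n)))"
      by (rule ext) (simp add: Digamma_err_def Digamma_of_nat del: of_nat_Suc)
    finally show ?thesis by simp
  qed
  have ev: "eventually (\<lambda>n. x \<le> real (Suc n)) sequentially"
    by real_asymp
  show "Digamma_err x \<le> 0"
    by (rule tendsto_lowerbound[OF lim]) (use ev mono x in \<open>auto elim!: eventually_mono\<close>)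
  have "(\<lambda>n. Digamma_err (real (Suc n)) + 1 / (4 * (real (Suc n))\<^sup>2)) \<longlonglongrightarrow> 0 + 0"
    by (intro tendsto_add lim) real_asymp
  then have "0 + 0 \<le> Digamma_err x + 1 / (4 * x\<^sup>2)"
    by (rule tendsto_upperbound) (use ev antimono x in \<open>auto elim!: eventually_mono\<close>)
  then show "- (1 / (4 * x\<^sup>2)) \<le> Digamma_err x" by simp
qed

text \<open>The weight sqrt x is the size of the frequencies in the central limit argument, where
  this difference is the first-order error.\<close>

lemma Digamma_minus_ln_asymp: "((\<lambda>x::real. sqrt x * (Digamma x - ln x)) \<longlongrightarrow> 0) at_top"
proof (rule tendsto_sandwich)
  show "eventually (\<lambda>x::real. - (sqrt x * (1 / (4 * x\<^sup>2) + 1 / (2 * x))) \<le> sqrt x * (Digamma x - ln x)) at_top"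
    using eventually_gt_at_top[of "0::real"]
  proof eventually_elim
    case (elim x)
    then have "sqrt x * (- (1 / (4 * x\<^sup>2)) - 1 / (2 * x)) \<le> sqrt x * (Digamma x - ln x)"
      using Digamma_err_bounds(2)[of x] by (intro mult_left_mono) (auto simp: Digamma_err_def)
    then show ?case by (simp add: algebra_simps)
  qed
  show "eventually (\<lambda>x::real. sqrt x * (Digamma x - ln x) \<le> 0) at_top"
    using eventually_gt_at_top[of "0::real"]
  proof eventually_elim
    case (elim x)
    then have "0 < 1 / (2 * x)" by simp
    then have "Digamma x - ln x \<le> 0"
      using Digamma_err_bounds(1)[OF elim] unfolding Digamma_err_def by linarith
    then show ?case using elim by (simp add: mult_nonneg_nonpos)
  qed
  show "((\<lambda>x::real. - (sqrt x * (1 / (4 * x\<^sup>2) + 1 / (2 * x)))) \<longlongrightarrow> 0) at_top"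
    by real_asymp
qed simp

lemma Polygamma_1_asymp: "((\<lambda>x::real. x * Polygamma 1 x) \<longlongrightarrow> 1) at_top"
proof (rule tendsto_sandwich)
  show "eventually (\<lambda>x::real. x * (1 / x + 1 / (2 * x\<^sup>2)) \<le> x * Polygamma 1 x) at_top"
    using eventually_gt_at_top[of "0::real"]
    by eventually_elim (intro mult_left_mono Polygamma_1_real_bounds(1), auto)
  show "eventually (\<lambda>x::real. x * Polygamma 1 x \<le> x * (1 / x + 1 / (2 * x\<^sup>2) + 1 / (2 * x ^ 3))) at_top"
    using eventually_gt_at_top[of "0::real"]
    by eventually_elim (intro mult_left_mono Polygamma_1_real_bounds(2), auto)
  show "((\<lambda>x::real. x * (1 / x + 1 / (2 * x\<^sup>2))) \<longlongrightarrow> 1) at_top"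
    by real_asymp
  show "((\<lambda>x::real. x * (1 / x + 1 / (2 * x\<^sup>2) + 1 / (2 * x ^ 3))) \<longlongrightarrow> 1) at_top"
    by real_asymp
qed

text \<open>The constant ln (2 \<pi>) / 2 is left inside the remainder, since only differences of
  remainders occur.\<close>

definition Stirling_rem :: "real \<Rightarrow> real" where
  "Stirling_rem x = ln_Gamma x - ((x - 1 / 2) * ln x - x)"

text \<open>The derivative of the remainder is \<open>Digamma_err\<close>, which lies between - 1 /
  (4 t^2) and 0; integrating from x to y costs at most 1 / (4 x).\<close>

lemma Stirling_rem_diff:
  assumes "0 < x" "x \<le> y"
  shows "\<bar>Stirling_rem x - Stirling_rem y\<bar> \<le> 1 / (4 * x)"
proof -
  have deriv: "(Stirling_rem has_real_derivative Digamma_err t) (at t)" if "0 < t" for t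
    unfolding Stirling_rem_def[abs_def] Digamma_err_def using that
    by (auto intro!: derivative_eq_intros simp: field_simps)
  have deriv': "((\<lambda>t. Stirling_rem t - 1 / (4 * t)) has_real_derivative Digamma_err t + 1 / (4 * t\<^sup>2)) (at t)"
    if "0 < t" for t
    using that by (auto intro!: derivative_eq_intros deriv simp: field_simps power2_eq_square)
  have "Stirling_rem y \<le> Stirling_rem x"
  proof (rule DERIV_nonpos_imp_nonincreasing[OF \<open>x \<le> y\<close>])
    fix t assume "x \<le> t" "t \<le> y"
    then have "0 < t" using assms by simp
    then show "\<exists>d. (Stirling_rem has_real_derivative d) (at t) \<and> d \<le> 0"
      using deriv[of t] Digamma_err_bounds(1)[of t] by blast
  qed
  moreover have "Stirling_rem x - 1 / (4 * x) \<le> Stirling_rem y - 1 / (4 * y)"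
  proof (rule DERIV_nonneg_imp_nondecreasing[OF \<open>x \<le> y\<close>])
    fix t assume "x \<le> t" "t \<le> y"
    then have "0 < t" using assms by simp
    then show "\<exists>d. ((\<lambda>t. Stirling_rem t - 1 / (4 * t)) has_real_derivative d) (at t) \<and> 0 \<le> d"
      using deriv'[of t] Digamma_err_bounds(2)[of t] by (intro exI[of _ "Digamma_err t + 1 / (4 * t\<^sup>2)"]) auto
  qed
  moreover have "0 < 1 / (4 * y)" using assms by simp
  ultimately show ?thesis by linarith
qed

text \<open>The constant of Stirling's formula cancels in the quotient.\<close>

lemma Gamma_quotient_asymp:
  fixes \<beta> :: real
  assumes \<beta>: "0 < \<beta>" "\<beta> < 1"
  shows "((\<lambda>z. Gamma z / (\<beta> * Gamma (\<beta> * z)) * exp ((1 - \<beta>) * z - z * ((1 - \<beta>) * ln z - \<beta> * ln \<beta>)))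
     \<longlongrightarrow> 1 / sqrt \<beta>) at_top"
proof -
  have "((\<lambda>z. Stirling_rem (\<beta> * z) - Stirling_rem z) \<longlongrightarrow> 0) at_top"
  proof (rule Lim_null_comparison)
    show "eventually (\<lambda>z. norm (Stirling_rem (\<beta> * z) - Stirling_rem z) \<le> 1 / (4 * (\<beta> * z))) at_top"
      using eventually_gt_at_top[of 0]
      by eventually_elim (use Stirling_rem_diff \<beta> in auto)
    show "((\<lambda>z. 1 / (4 * (\<beta> * z))) \<longlongrightarrow> 0) at_top"
      using \<beta> by real_asymp
  qed
  then have "((\<lambda>z. exp (- (Stirling_rem (\<beta> * z) - Stirling_rem z)) * (1 / sqrt \<beta>)) \<longlongrightarrow> exp (- 0) * (1 / sqrt \<beta>)) at_top"
    by (intro tendsto_intros)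
  moreover have "eventually (\<lambda>z. exp (- (Stirling_rem (\<beta> * z) - Stirling_rem z)) * (1 / sqrt \<beta>) =
      Gamma z / (\<beta> * Gamma (\<beta> * z)) * exp ((1 - \<beta>) * z - z * ((1 - \<beta>) * ln z - \<beta> * ln \<beta>))) at_top"
    using eventually_gt_at_top[of 0]
  proof eventually_elim
    case (elim z)
    \<comment> \<open>The half powers of z in Stirling's formula cancel between numerator and
      denominator and leave \<beta>^(1/2); together with the prefactor 1 / \<beta> this is 1 / sqrt
      \<beta>.\<close>
    have s: "1 / sqrt \<beta> = exp (- ln \<beta> / 2)"
      using \<beta> by (simp add: powr_half_sqrt[symmetric] powr_def exp_minus field_simps)
    have b: "1 / \<beta> = exp (- ln \<beta>)"
      using \<beta> by (simp add: exp_minus field_simps)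
    have "Gamma z / (\<beta> * Gamma (\<beta> * z)) = exp (ln_Gamma z) / exp (ln_Gamma (\<beta> * z)) * (1 / \<beta>)"
      using elim \<beta> by (simp add: Gamma_real_pos_exp)
    also have "\<dots> = exp (ln_Gamma z - ln_Gamma (\<beta> * z) - ln \<beta>)"
      unfolding b by (simp only: exp_diff exp_minus divide_inverse)
    finally have G: "Gamma z / (\<beta> * Gamma (\<beta> * z)) = exp (ln_Gamma z - ln_Gamma (\<beta> * z) - ln \<beta>)" .
    have "ln (\<beta> * z) = ln \<beta> + ln z"
      using elim \<beta> by (simp add: ln_mult)
    then show ?case
      unfolding s G exp_add[symmetric] Stirling_rem_def
      by (intro arg_cong[where f = exp]) (simp add: algebra_simps)
  qed
  ultimately show ?thesis by (simp add: Lim_transform_eventually)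
qed

text \<open>The half-plane Re z \<ge> x is convex, contains the vertical line through x and carries
  the uniform bound 4 / x^2 for the third derivative. Along the line the first-order term is a pure
  phase and the second-order term is real, the future Gaussian exponent. For u of order sqrt x the
  remainder is of order 1 / sqrt x.\<close>

lemma ln_Gamma_Taylor:
  assumes x: "1 \<le> x"
  shows "norm (ln_Gamma (Complex x u) - (of_real (ln_Gamma x) + \<i> * of_real (u * Digamma x) - of_real (u\<^sup>2 / 2 * Polygamma 1 x)))
    \<le> 2 * \<bar>u\<bar> ^ 3 / x\<^sup>2"
proof -
  define f :: "nat \<Rightarrow> complex \<Rightarrow> complex" where "f i = (case i of 0 \<Rightarrow> ln_Gamma | Suc j \<Rightarrow> Polygamma j)" for i
  let ?S = "{z. x \<le> Re z}"
  have S: "z \<notin> \<real>\<^sub>\<le>\<^sub>0" if "z \<in> ?S" for z :: complex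
    using that x by (auto simp: complex_nonpos_Reals_iff)
  have S': "z \<notin> \<int>\<^sub>\<le>\<^sub>0" if "z \<in> ?S" for z :: complex
    using S[OF that] nonpos_Ints_subset_nonpos_Reals by blast
  have taylor: "norm (f 0 (Complex x u) - (\<Sum>i\<le>2. f i (of_real x) * (Complex x u - of_real x) ^ i / fact i))
      \<le> 4 / x\<^sup>2 * norm (Complex x u - of_real x) ^ Suc 2 / fact 2"
  proof (rule complex_Taylor[where S = ?S])
    show "convex ?S" by (rule convex_halfspace_Re_ge)
    show "(f i has_field_derivative f (Suc i) z) (at z within ?S)" if "z \<in> ?S" "i \<le> 2" for i z
      using S[OF that(1)] S'[OF that(1)] by (cases i) (auto simp: f_def intro!: derivative_eq_intros)
    show "norm (f (Suc 2) z) \<le> 4 / x\<^sup>2" if "z \<in> ?S" for z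
      using norm_Polygamma_2_le[OF x] that by (simp add: f_def numeral_2_eq_2)
  qed auto
  have d: "Complex x u - of_real x = \<i> * of_real u"
    by (simp add: complex_eq_iff)
  have sum: "(\<Sum>i\<le>2. f i (of_real x) * (\<i> * of_real u) ^ i / fact i) =
      of_real (ln_Gamma x) + \<i> * of_real (u * Digamma x) - of_real (u\<^sup>2 / 2 * Polygamma 1 x)"
  proof -
    have ii: "(\<i> * complex_of_real u) * (\<i> * of_real u) = - (of_real u * of_real u)"
      by (simp add: complex_eq_iff)
    show ?thesis
      using x by (simp add: f_def numeral_2_eq_2 ln_Gamma_complex_of_real Polygamma_of_real power2_eq_square ii)
  qed
  have f0: "f 0 = ln_Gamma" by (simp add: f_def)
  have bound: "4 / x\<^sup>2 * norm (\<i> * complex_of_real u) ^ Suc 2 / fact 2 = 2 * \<bar>u\<bar> ^ 3 / x\<^sup>2"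
    by (simp add: norm_mult numeral_2_eq_2 numeral_3_eq_3)
  show ?thesis
    using taylor unfolding d sum bound f0 .
qed

lemma Gamma_eq_exp_ln_Gamma: "0 < Re z \<Longrightarrow> Gamma z = exp (ln_Gamma z)"
  by (auto simp: Gamma_complex_altdef elim!: nonpos_Ints_cases)

text \<open>The left side is a characteristic function, see \<open>char_tilted\<close>. In the
  difference of the two Taylor expansions the remainders vanish in the limit, the phases
  \<open>m\<close> vanish after centring, and the second-order terms \<open>q\<close> converge
  because \<theta>^2 z / 2 times 1 / z - \<beta>^2 / (\<beta> z) is \<theta>^2 (1 - \<beta>) /
  2.\<close>

lemma Gamma_quotient_char_asymp:
  fixes \<beta> \<theta> :: real
  assumes \<beta>: "0 < \<beta>" "\<beta> < 1"
  shows "((\<lambda>z. Gamma (Complex z (\<theta> * sqrt z)) / Gamma (Complex (\<beta> * z) (\<beta> * (\<theta> * sqrt z))) *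
      of_real (Gamma (\<beta> * z) / Gamma z) * exp (- \<i> * of_real (\<theta> * sqrt z * ((1 - \<beta>) * ln z - \<beta> * ln \<beta>))))
      \<longlongrightarrow> exp (- of_real (\<theta>\<^sup>2 * (1 - \<beta>) / 2))) at_top"
proof -
  define T where "T x u = complex_of_real (ln_Gamma x) + \<i> * of_real (u * Digamma x) - of_real (u\<^sup>2 / 2 * Polygamma 1 x)" for x u
  define R where "R x u = ln_Gamma (Complex x u) - T x u" for x u
  have R: "norm (R x u) \<le> 2 * \<bar>u\<bar> ^ 3 / x\<^sup>2" if "1 \<le> x" for x u
    unfolding R_def T_def by (rule ln_Gamma_Taylor[OF that])
  \<comment> \<open>If \<open>Digamma\<close> is replaced by \<open>ln\<close>, the first-order
    terms are the frequency times ln z - \<beta> ln (\<beta> z), and this is \<open>v z\<close>.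
    Only the error of the replacement remains in \<open>m\<close>.\<close>
  define v where "v z = (1 - \<beta>) * ln z - \<beta> * ln \<beta>" for z
  define m where "m z = \<theta> * (sqrt z * (Digamma z - ln z) - sqrt \<beta> * (sqrt (\<beta> * z) * (Digamma (\<beta> * z) - ln (\<beta> * z))))" for z
  define q where "q z = \<theta>\<^sup>2 / 2 * (z * Polygamma 1 z - \<beta> * (\<beta> * z * Polygamma 1 (\<beta> * z)))" for z
  have \<beta>_top: "filterlim (\<lambda>z. \<beta> * z) at_top at_top"
    using \<beta> by real_asymp
  have m: "(m \<longlongrightarrow> \<theta> * (0 - sqrt \<beta> * 0)) at_top"
    unfolding m_def by (intro tendsto_intros Digamma_minus_ln_asymp filterlim_compose[OF Digamma_minus_ln_asymp \<beta>_top])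
  have q: "(q \<longlongrightarrow> \<theta>\<^sup>2 / 2 * (1 - \<beta> * 1)) at_top"
    unfolding q_def by (intro tendsto_intros Polygamma_1_asymp filterlim_compose[OF Polygamma_1_asymp \<beta>_top])
  have R1: "((\<lambda>z. R z (\<theta> * sqrt z)) \<longlongrightarrow> 0) at_top"
  proof (rule Lim_null_comparison)
    show "eventually (\<lambda>z. norm (R z (\<theta> * sqrt z)) \<le> 2 * \<bar>\<theta>\<bar> ^ 3 * (sqrt z ^ 3 / z\<^sup>2)) at_top"
      using eventually_ge_at_top[of 1]
      by eventually_elim (rule order_trans[OF R], auto simp: abs_mult power_mult_distrib)
    show "((\<lambda>z. 2 * \<bar>\<theta>\<bar> ^ 3 * (sqrt z ^ 3 / z\<^sup>2)) \<longlongrightarrow> 0) at_top"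
      by real_asymp
  qed
  have R2: "((\<lambda>z. R (\<beta> * z) (\<beta> * (\<theta> * sqrt z))) \<longlongrightarrow> 0) at_top"
  proof (rule Lim_null_comparison)
    show "eventually (\<lambda>z. norm (R (\<beta> * z) (\<beta> * (\<theta> * sqrt z))) \<le> 2 * (\<bar>\<beta>\<bar> * \<bar>\<theta>\<bar>) ^ 3 * (sqrt z ^ 3 / (\<beta> * z)\<^sup>2)) at_top"
      using eventually_ge_at_top[of "1 / \<beta>"] eventually_ge_at_top[of 0]
      by eventually_elim (rule order_trans[OF R], insert \<beta>, auto simp: abs_mult power_mult_distrib field_simps)
    show "((\<lambda>z. 2 * (\<bar>\<beta>\<bar> * \<bar>\<theta>\<bar>) ^ 3 * (sqrt z ^ 3 / (\<beta> * z)\<^sup>2)) \<longlongrightarrow> 0) at_top"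
      using \<beta> by real_asymp
  qed
  have "((\<lambda>z. exp (R z (\<theta> * sqrt z) - R (\<beta> * z) (\<beta> * (\<theta> * sqrt z)) + \<i> * of_real (m z) - of_real (q z)))
      \<longlongrightarrow> exp (0 - 0 + \<i> * of_real (\<theta> * (0 - sqrt \<beta> * 0)) - of_real (\<theta>\<^sup>2 / 2 * (1 - \<beta> * 1)))) at_top"
    by (intro tendsto_intros R1 R2 m q)
  moreover have "eventually (\<lambda>z. exp (R z (\<theta> * sqrt z) - R (\<beta> * z) (\<beta> * (\<theta> * sqrt z)) + \<i> * of_real (m z) - of_real (q z)) =
      Gamma (Complex z (\<theta> * sqrt z)) / Gamma (Complex (\<beta> * z) (\<beta> * (\<theta> * sqrt z))) *
      of_real (Gamma (\<beta> * z) / Gamma z) * exp (- \<i> * of_real (\<theta> * sqrt z * v z))) at_top"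
    using eventually_gt_at_top[of 0]
  proof eventually_elim
    case (elim z)
    define u where "u = \<theta> * sqrt z"
    have u2: "u\<^sup>2 = \<theta>\<^sup>2 * z"
      using elim by (simp add: u_def power_mult_distrib)
    have m': "m z = u * Digamma z - \<beta> * u * Digamma (\<beta> * z) - u * v z"
    proof -
      have "sqrt \<beta> * sqrt (\<beta> * z) = \<beta> * sqrt z"
        using \<beta> by (simp add: real_sqrt_mult)
      then have "m z = \<theta> * (sqrt z * (Digamma z - ln z) - \<beta> * sqrt z * (Digamma (\<beta> * z) - ln (\<beta> * z)))"
        unfolding m_def mult.assoc[of "sqrt \<beta>", symmetric] by simp
      also have "ln (\<beta> * z) = ln \<beta> + ln z"
        using elim \<beta> by (simp add: ln_mult)
      finally show ?thesis by (simp add: v_def u_def algebra_simps)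
    qed
    have q': "q z = u\<^sup>2 / 2 * Polygamma 1 z - (\<beta> * u)\<^sup>2 / 2 * Polygamma 1 (\<beta> * z)"
      unfolding q_def u2 power_mult_distrib by (simp add: algebra_simps power2_eq_square)
    have "R z u - R (\<beta> * z) (\<beta> * u) + \<i> * of_real (m z) - of_real (q z)
      = ln_Gamma (Complex z u) - ln_Gamma (Complex (\<beta> * z) (\<beta> * u)) + (of_real (ln_Gamma (\<beta> * z)) - of_real (ln_Gamma z)) + (- \<i> * of_real (u * v z))"
      unfolding R_def T_def m' q' by (simp add: algebra_simps)
    also have "exp \<dots> = Gamma (Complex z u) / Gamma (Complex (\<beta> * z) (\<beta> * u)) * of_real (Gamma (\<beta> * z) / Gamma z) * exp (- \<i> * of_real (u * v z))"
      using elim \<beta> by (simp only: exp_add exp_diff exp_of_real) (simp add: Gamma_eq_exp_ln_Gamma Gamma_real_pos_exp)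
    finally show ?case by (simp add: u_def)
  qed
  ultimately have "((\<lambda>z. Gamma (Complex z (\<theta> * sqrt z)) / Gamma (Complex (\<beta> * z) (\<beta> * (\<theta> * sqrt z))) *
      of_real (Gamma (\<beta> * z) / Gamma z) * exp (- \<i> * of_real (\<theta> * sqrt z * v z)))
      \<longlongrightarrow> exp (0 - 0 + \<i> * of_real (\<theta> * (0 - sqrt \<beta> * 0)) - of_real (\<theta>\<^sup>2 / 2 * (1 - \<beta> * 1)))) at_top"
    by (rule Lim_transform_eventually)
  then show ?thesis by (simp add: v_def)
qed

section \<open>Saddle point asymptotics for stable laws\<close>

text \<open>With t = - b y the expression is a t / b - (z / b) (exp t - 1 - t). For t \<ge> 0 the
  bracket is at least t^2 / 2, and completing the square gives the bound; for t < 0 both summands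
  are nonpositive. The bound depends on neither y nor z, so it dominates the saddle point
  integrands.\<close>

lemma exp_minus_quadratic:
  fixes y a b z :: real
  assumes "0 \<le> a" "0 < b" "1 \<le> z"
  shows "- a * y - z * y - z / b * (exp (- b * y) - 1) \<le> a\<^sup>2 / (2 * b)"
proof -
  define t where "t = - b * y"
  have y: "y = - t / b" using assms by (simp add: t_def)
  have eq: "- a * y - z * y - z / b * (exp (- b * y) - 1) = a * t / b - z / b * (exp t - 1 - t)"
    using assms by (simp add: y field_simps)
  show ?thesis
  proof (cases "0 \<le> t")
    case True
    have "t\<^sup>2 / 2 \<le> exp t - 1 - t"
      using exp_lower_Taylor_quadratic[OF True] by simp
    moreover have "1 / b \<le> z / b"
      using assms by (simp add: divide_right_mono)
    ultimately have "1 / b * (t\<^sup>2 / 2) \<le> z / b * (exp t - 1 - t)"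
      using assms by (intro mult_mono) auto
    moreover have "a * t / b - 1 / b * (t\<^sup>2 / 2) \<le> a\<^sup>2 / (2 * b)"
    proof -
      have "0 \<le> (a - t)\<^sup>2 / (2 * b)" using assms by simp
      moreover have "a\<^sup>2 / (2 * b) - (a * t / b - 1 / b * (t\<^sup>2 / 2)) = (a - t)\<^sup>2 / (2 * b)"
        using assms by (simp add: field_simps power2_eq_square)
      ultimately show ?thesis by linarith
    qed
    ultimately show ?thesis unfolding eq by linarith
  next
    case False
    have "0 \<le> exp t - 1 - t"
      using exp_ge_add_one_self[of t] by linarith
    then have "0 \<le> z / b * (exp t - 1 - t)"
      using assms by (intro mult_nonneg_nonneg) auto
    moreover have "a * t / b \<le> 0"
      using assms False by (simp add: divide_nonpos_pos mult_nonneg_nonpos)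
    moreover have "0 \<le> a\<^sup>2 / (2 * b)" using assms by simp
    ultimately show ?thesis unfolding eq by linarith
  qed
qed

text \<open>This is the exponent of the saddle point integrand on the Gaussian scale 1 / sqrt z. Its
  linear terms of order z cancel, and the quadratic term of the exponential survives.\<close>

lemma exp_remainder_tendsto:
  fixes Y z :: "nat \<Rightarrow> real" and a b c y :: real
  assumes z: "filterlim z at_top sequentially" "\<And>n. 0 < z n" and Y: "Y \<longlonglongrightarrow> y" and b: "0 < b"
  defines "x \<equiv> (\<lambda>n. c * Y n / sqrt (z n))"
  shows "(\<lambda>n. - a * x n - z n * x n - z n / b * (exp (- b * x n) - 1)) \<longlonglongrightarrow> - (b * c\<^sup>2 * y\<^sup>2 / 2)"
proof -
  \<comment> \<open>The quotient (exp t - 1 - t) / t^2 is extended continuously by 1 / 2, because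
    \<open>Y n\<close> may be 0.\<close>
  define r where "r t = (if t = 0 then 1 / 2 else (exp t - 1 - t) / t\<^sup>2)" for t :: real
  have "((\<lambda>t::real. (exp t - 1 - t) / t\<^sup>2) \<longlongrightarrow> 1 / 2) (at 0)"
    by real_asymp
  then have "(r \<longlongrightarrow> 1 / 2) (at 0)"
    by (rule Lim_transform_eventually) (auto simp: r_def eventually_at_filter)
  then have "isCont r 0" by (simp add: isCont_def r_def)
  have r: "exp t - 1 - t = t\<^sup>2 * r t" for t :: real
    by (simp add: r_def)
  have "(\<lambda>n. 1 / sqrt (z n)) \<longlonglongrightarrow> 0"
    by (rule filterlim_compose[OF _ z(1)]) real_asymp
  then have "(\<lambda>n. c * Y n * (1 / sqrt (z n))) \<longlonglongrightarrow> c * y * 0"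
    by (intro tendsto_intros Y)
  then have x: "x \<longlonglongrightarrow> 0" by (simp add: x_def)
  have "(\<lambda>n. - b * x n) \<longlonglongrightarrow> - b * 0"
    by (intro tendsto_intros x)
  then have "(\<lambda>n. r (- b * x n)) \<longlonglongrightarrow> r 0"
    using isCont_tendsto_compose[OF \<open>isCont r 0\<close>] by simp
  then have "(\<lambda>n. - a * x n - b * c\<^sup>2 * (Y n)\<^sup>2 * r (- b * x n)) \<longlonglongrightarrow> - a * 0 - b * c\<^sup>2 * y\<^sup>2 * r 0"
    by (intro tendsto_intros x Y)
  moreover have "- a * x n - b * c\<^sup>2 * (Y n)\<^sup>2 * r (- b * x n) = - a * x n - z n * x n - z n / b * (exp (- b * x n) - 1)" for n
  proof -
    have "z n * (x n)\<^sup>2 = c\<^sup>2 * (Y n)\<^sup>2"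
      using z(2)[of n] by (simp add: x_def power_divide power_mult_distrib)
    then have "b * c\<^sup>2 * (Y n)\<^sup>2 * r (- b * x n) = z n / b * ((- b * x n)\<^sup>2 * r (- b * x n))"
      using b by (simp add: power_mult_distrib field_simps power2_eq_square)
    also have "\<dots> = z n * x n + z n / b * (exp (- b * x n) - 1)"
      unfolding r[symmetric] using b by (simp add: field_simps)
    finally show ?thesis by simp
  qed
  moreover have "- a * 0 - b * c\<^sup>2 * y\<^sup>2 * r 0 = - (b * c\<^sup>2 * y\<^sup>2 / 2)"
    by (simp add: r_def)
  ultimately show ?thesis by (simp only:)
qed

lemma std_normal_exp_square:
  fixes c :: real
  assumes "0 \<le> c"
  shows "(LINT x|std_normal_distribution. exp (- (c * x\<^sup>2 / 2))) = 1 / sqrt (1 + c)"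
proof -
  define s where "s = 1 / sqrt (1 + c)"
  have s: "0 < s" "s\<^sup>2 = 1 / (1 + c)"
    using assms by (auto simp: s_def power_divide)
  have "(LINT x|std_normal_distribution. exp (- (c * x\<^sup>2 / 2))) = (LINT x|lborel. std_normal_density x * exp (- (c * x\<^sup>2 / 2)))"
    by (subst integral_density) auto
  also have "\<dots> = (LINT x|lborel. s * normal_density 0 s x)"
  proof (rule Bochner_Integration.integral_cong[OF refl])
    fix x :: real
    have "sqrt (2 * pi * s\<^sup>2) = sqrt (2 * pi) * s"
      using s(1) by (simp add: real_sqrt_mult)
    moreover have "- (x - 0)\<^sup>2 / (2 * s\<^sup>2) = - (x\<^sup>2 / 2) + - (c * x\<^sup>2 / 2)"
      using assms by (simp add: s field_simps)
    ultimately show "std_normal_density x * exp (- (c * x\<^sup>2 / 2)) = s * normal_density 0 s x"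
      using s(1) by (simp only: normal_density_def exp_add) simp
  qed
  also have "\<dots> = s" using s by simp
  finally show ?thesis by (simp add: s_def)
qed


section \<open>Tilted stable laws in the logarithmic scale\<close>

context stable_law
begin

text \<open>This is the moment of s of order - \<beta> z, that is Gamma (1 + z) / Gamma (1 + \<beta>
  z), after the functional equation has cancelled a factor z.\<close>

definition neg_moment :: "real \<Rightarrow> real" where
  "neg_moment z = Gamma z / (\<beta> * Gamma (\<beta> * z))"

text \<open>This equals ln z - \<beta> ln (\<beta> z), the leading part of the derivative of ln
  (\<open>neg_moment z\<close>), hence of the mean of - \<beta> ln s under the tilted law.\<close>

definition log_center :: "real \<Rightarrow> real" where
  "log_center z = (1 - \<beta>) * ln z - \<beta> * ln \<beta>"

definition tilted :: "real \<Rightarrow> real measure" where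
  "tilted z = density D (\<lambda>s. ennreal (s powr (- (\<beta> * z)) / neg_moment z))"

text \<open>The normalisation comes from the second derivative of ln (\<open>neg_moment z\<close>),
  which is asymptotic to (1 - \<beta>) / z, the variance of - \<beta> ln s under the tilted
  law.\<close>

definition tilt_coord :: "real \<Rightarrow> real \<Rightarrow> real" where
  "tilt_coord z s = sqrt (z / (1 - \<beta>)) * (- \<beta> * ln s - log_center z)"

lemma neg_moment_pos: "0 < z \<Longrightarrow> 0 < neg_moment z"
  using \<beta> by (simp add: neg_moment_def)

lemma neg_moment:
  assumes "0 < z"
  shows "integrable D (\<lambda>s. s powr (- (\<beta> * z)))" "(LINT s|D. s powr (- (\<beta> * z))) = neg_moment z"
proof -
  have z: "- \<beta> < \<beta> * z"
    using assms \<beta> by (smt (verit) mult_pos_pos)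
  show "integrable D (\<lambda>s. s powr (- (\<beta> * z)))"
    by (rule moment(1)[OF z])
  have "z \<notin> \<int>\<^sub>\<le>\<^sub>0" "\<beta> * z \<notin> \<int>\<^sub>\<le>\<^sub>0"
    using assms mult_pos_pos[OF \<beta>(1) assms] by (auto elim!: nonpos_Ints_cases)
  then have "Gamma (1 + \<beta> * z / \<beta>) / Gamma (1 + \<beta> * z) = neg_moment z"
    using \<beta> assms Gamma_plus1[of z] Gamma_plus1[of "\<beta> * z"] by (simp add: neg_moment_def add.commute)
  then show "(LINT s|D. s powr (- (\<beta> * z))) = neg_moment z"
    using moment(2)[OF z] by simp
qed

lemma tilted_density_nonneg: "0 < z \<Longrightarrow> 0 \<le> s powr (- (\<beta> * z)) / neg_moment z"
  by (simp add: less_imp_le neg_moment_pos)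

lemma real_distribution_tilted:
  assumes "0 < z"
  shows "real_distribution (distr (tilted z) borel (tilt_coord z))"
proof -
  have "(\<integral>\<^sup>+s. ennreal (s powr (- (\<beta> * z)) / neg_moment z) \<partial>D) = ennreal (LINT s|D. s powr (- (\<beta> * z)) / neg_moment z)"
    using neg_moment(1)[OF assms] tilted_density_nonneg[OF assms] by (intro nn_integral_eq_integral) auto
  also have "(LINT s|D. s powr (- (\<beta> * z)) / neg_moment z) = 1"
    using neg_moment(2)[OF assms] neg_moment_pos[OF assms] by simp
  finally have "emeasure (tilted z) (space (tilted z)) = 1"
    by (simp add: tilted_def emeasure_density)
  then interpret T: prob_space "tilted z"
    by (rule prob_spaceI)
  show ?thesis
    by (rule T.real_distribution_distr) (simp add: tilt_coord_def[abs_def] tilted_def)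
qed

lemma integral_tilted:
  fixes f :: "real \<Rightarrow> 'b::{banach, second_countable_topology}"
  assumes "0 < z" and [measurable]: "f \<in> borel_measurable borel"
  shows "integral\<^sup>L (distr (tilted z) borel (tilt_coord z)) f =
    (LINT s|D. (s powr (- (\<beta> * z)) / neg_moment z) *\<^sub>R f (tilt_coord z s))"
  using tilted_density_nonneg[OF assms(1)]
  by (subst integral_distr, simp_all add: tilted_def tilt_coord_def[abs_def])
     (subst integral_density, auto)

text \<open>Multiplying s^(- \<beta> z) by exp (- i u \<beta> ln s) gives the complex power s^(-
  \<beta> (z + i u)). The characteristic function is therefore a quotient of two moments times the
  phase of the centring. \<open>\<theta>\<close> absorbs the factor 1 / sqrt (1 - \<beta>) of the
  coordinate, so that the frequency is u = \<theta> sqrt z.\<close>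

lemma char_tilted:
  fixes t :: real
  assumes z: "0 < z"
  defines "\<theta> \<equiv> t / sqrt (1 - \<beta>)"
  shows "char (distr (tilted z) borel (tilt_coord z)) t =
    Gamma (Complex z (\<theta> * sqrt z)) / Gamma (Complex (\<beta> * z) (\<beta> * (\<theta> * sqrt z))) *
      of_real (Gamma (\<beta> * z) / Gamma z) * exp (- \<i> * of_real (\<theta> * sqrt z * log_center z))"
proof -
  define u where "u = \<theta> * sqrt z"
  define w where "w = of_real \<beta> * Complex z u"
  have w: "Complex (\<beta> * z) (\<beta> * u) = w"
    by (simp add: w_def complex_eq_iff)
  have Re_w: "- \<beta> < Re w"
    using z \<beta> by (simp add: w_def) (smt (verit) mult_pos_pos)
  have nonpos: "q \<notin> \<int>\<^sub>\<le>\<^sub>0" if "0 < Re q" for q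
    using that by (auto elim!: nonpos_Ints_cases)
  have coord: "t * tilt_coord z s = u * (- \<beta> * ln s - log_center z)" for s
    using z \<beta> by (simp add: tilt_coord_def u_def \<theta>_def real_sqrt_divide)
  have "char (distr (tilted z) borel (tilt_coord z)) t =
      (CLINT s|D. (s powr (- (\<beta> * z)) / neg_moment z) *\<^sub>R iexp (t * tilt_coord z s))"
    unfolding char_def by (rule integral_tilted[OF z]) measurable
  also have "\<dots> = (CLINT s|D. exp (- \<i> * of_real (u * log_center z)) / neg_moment z * exp (- w * of_real (ln s)))"
  proof (rule integral_cong_AE)
    show "AE s in D. (s powr (- (\<beta> * z)) / neg_moment z) *\<^sub>R iexp (t * tilt_coord z s) =
        exp (- \<i> * of_real (u * log_center z)) / neg_moment z * exp (- w * of_real (ln s))"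
      using pos
    proof eventually_elim
      case (elim s)
      have "complex_of_real (s powr (- (\<beta> * z))) = complex_of_real (exp (- (\<beta> * z) * ln s))"
        using elim by (simp add: powr_def)
      also have "\<dots> = exp (of_real (- (\<beta> * z) * ln s))"
        by (rule exp_of_real[symmetric])
      finally have "complex_of_real (s powr (- (\<beta> * z))) * iexp (t * tilt_coord z s)
          = exp (of_real (- (\<beta> * z) * ln s) + \<i> * of_real (t * tilt_coord z s))"
        by (simp only: exp_add)
      also have "of_real (- (\<beta> * z) * ln s) + \<i> * of_real (t * tilt_coord z s) = - \<i> * of_real (u * log_center z) + - w * of_real (ln s)"
        unfolding coord w_def by (simp add: complex_eq_iff algebra_simps)
      finally have "complex_of_real (s powr (- (\<beta> * z))) * iexp (t * tilt_coord z s)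
          = exp (- \<i> * of_real (u * log_center z)) * exp (- w * of_real (ln s))"
        by (simp only: exp_add)
      then show ?case
        by (simp add: scaleR_conv_of_real)
    qed
  qed (simp_all add: tilt_coord_def)
  also have "\<dots> = exp (- \<i> * of_real (u * log_center z)) / neg_moment z * (Gamma (1 + w / of_real \<beta>) / Gamma (1 + w))"
    using complex_moment[OF Re_w] by simp
  also have "w / of_real \<beta> = Complex z u"
    using \<beta> by (simp add: w_def)
  \<comment> \<open>The functional equation lowers both arguments by one. The factors z + i u
    cancel, and the remaining \<beta> cancels the one in \<open>neg_moment\<close>.\<close>
  also have "Gamma (1 + Complex z u) = Complex z u * Gamma (Complex z u)"
    unfolding add.commute[of 1] using z by (intro Gamma_plus1 nonpos) simp
  also have "Gamma (1 + w) = w * Gamma w"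
    unfolding add.commute[of 1] using z \<beta> by (intro Gamma_plus1 nonpos) (simp add: w_def)
  also have "\<dots> = of_real \<beta> * Complex z u * Gamma w"
    by (simp add: w_def)
  also have "Complex z u * Gamma (Complex z u) / (of_real \<beta> * Complex z u * Gamma w) = Gamma (Complex z u) / (of_real \<beta> * Gamma w)"
    using z by (simp add: complex_eq_iff)
  finally show ?thesis
    unfolding neg_moment_def u_def[symmetric] w using \<beta> by (simp add: field_simps)
qed

lemma weak_conv_tilted:
  assumes X: "filterlim X at_top sequentially" "\<And>n. 0 < X n"
  shows "weak_conv_m (\<lambda>n. distr (tilted (X n)) borel (tilt_coord (X n))) std_normal_distribution"
proof (rule levy_continuity)
  show "real_distribution (distr (tilted (X n)) borel (tilt_coord (X n)))" for n
    by (rule real_distribution_tilted[OF X(2)])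
  show "real_distribution std_normal_distribution"
    by (rule real_dist_normal_dist)
  show "(\<lambda>n. char (distr (tilted (X n)) borel (tilt_coord (X n))) t) \<longlonglongrightarrow> char std_normal_distribution t" for t
  proof -
    define \<theta> where "\<theta> = t / sqrt (1 - \<beta>)"
    have "\<theta>\<^sup>2 * (1 - \<beta>) = t\<^sup>2"
      using \<beta> by (simp add: \<theta>_def power_divide)
    moreover have "exp (- complex_of_real (t\<^sup>2 / 2)) = of_real (exp (- t\<^sup>2 / 2))"
      by (simp flip: exp_of_real)
    ultimately show ?thesis
      unfolding char_tilted[OF X(2)] char_std_normal_distribution
      using filterlim_compose[OF Gamma_quotient_char_asymp[OF \<beta>, of \<theta>] X(1)]
      by (simp only: \<theta>_def[symmetric] log_center_def)
  qed
qed

text \<open>Tilting the law by \<open>s powr (- (\<beta> * z))\<close> moves its bulk to the saddle point of the integrand,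
  which then is a bounded function of the asymptotically Gaussian coordinate.\<close>

lemma Laplace_asymp:
  fixes a b :: real
  assumes a: "0 \<le> a" and b: "0 < b"
  shows "((\<lambda>z. (LINT s|D. s powr (\<beta> * a) * exp (- (z / b * exp (b * log_center z)) * s powr (\<beta> * b))) / neg_moment z
      * exp ((a + z) * log_center z + z / b)) \<longlongrightarrow> 1 / sqrt (1 + b * (1 - \<beta>))) at_top"
    (is "(?I \<longlongrightarrow> _) at_top")
proof (rule tendsto_at_topI_sequentially_ge_1)
  fix X :: "nat \<Rightarrow> real"
  assume X: "filterlim X at_top sequentially" and X1: "\<And>n. 1 \<le> X n"
  have Xpos: "0 < X n" for n
    using X1[of n] by simp
  define c where "c = sqrt (1 - \<beta>)"
  define y where "y z Y = c * Y / sqrt z" for z Y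
  \<comment> \<open>This is the integrand in the centred variable y = - \<beta> ln s -
    \<open>log_center z\<close>. The coefficient (z / b) exp (b \<open>log_center z\<close>) turns
    the exponential into exp (- (z / b) exp (- b y)), whose linear term z y balances the factor exp
    (- z y) from undoing the tilt; so the saddle point sits at y = 0 up to the bounded effect of
    a.\<close>
  define f where "f z Y = exp (- a * y z Y - z * y z Y - z / b * (exp (- b * y z Y) - 1))" for z Y
  have f_meas [measurable]: "f z \<in> borel_measurable borel" for z
    unfolding f_def y_def by measurable
  let ?N = "\<lambda>n. distr (tilted (X n)) borel (tilt_coord (X n))"
  have eq: "?I (X n) = integral\<^sup>L (?N n) (f (X n))" for n
  proof -
    let ?z = "X n"
    have "integral\<^sup>L (?N n) (f ?z) = (LINT s|D. s powr (\<beta> * a) * exp (- (?z / b * exp (b * log_center ?z)) * s powr (\<beta> * b))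
        / neg_moment ?z * exp ((a + ?z) * log_center ?z + ?z / b))"
      unfolding integral_tilted[OF Xpos f_meas]
    proof (rule integral_cong_AE)
      show "AE s in D. (s powr (- (\<beta> * ?z)) / neg_moment ?z) *\<^sub>R f ?z (tilt_coord ?z s) =
        s powr (\<beta> * a) * exp (- (?z / b * exp (b * log_center ?z)) * s powr (\<beta> * b))
        / neg_moment ?z * exp ((a + ?z) * log_center ?z + ?z / b)"
        using pos
      proof eventually_elim
        case (elim s)
        have y: "y ?z (tilt_coord ?z s) = - \<beta> * ln s - log_center ?z"
          using \<beta> Xpos[of n] by (simp add: y_def c_def tilt_coord_def real_sqrt_divide)
        have e: "exp (- b * (- \<beta> * ln s - log_center ?z)) = exp (b * log_center ?z) * s powr (\<beta> * b)"
          using elim by (simp add: powr_def exp_add[symmetric] algebra_simps)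
        have "s powr (- (\<beta> * ?z)) * f ?z (tilt_coord ?z s) =
          exp (- (\<beta> * ?z) * ln s + (- a * (- \<beta> * ln s - log_center ?z) - ?z * (- \<beta> * ln s - log_center ?z)
            - ?z / b * (exp (b * log_center ?z) * s powr (\<beta> * b) - 1)))"
          unfolding f_def y e exp_add using elim by (simp add: powr_def)
        also have "\<dots> = exp ((\<beta> * a) * ln s + - (?z / b * exp (b * log_center ?z)) * s powr (\<beta> * b) + ((a + ?z) * log_center ?z + ?z / b))"
          by (intro arg_cong[where f = exp]) (simp add: algebra_simps)
        also have "\<dots> = s powr (\<beta> * a) * exp (- (?z / b * exp (b * log_center ?z)) * s powr (\<beta> * b)) * exp ((a + ?z) * log_center ?z + ?z / b)"
          using elim by (simp only: exp_add) (simp add: powr_def)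
        finally show ?case by (simp add: field_simps)
      qed
    qed (simp_all add: tilt_coord_def)
    then show ?thesis by simp
  qed
  have bound: "norm (f (X n) Y) \<le> exp (a\<^sup>2 / (2 * b))" for n Y
    using exp_minus_quadratic[OF a b X1] by (simp add: f_def)
  \<comment> \<open>The integrand varies with n, so weak convergence tested on one fixed function is
    not enough. Skorohod's representation makes the convergence pointwise, and dominated convergence
    with a constant bound applies.\<close>
  obtain W :: "real measure" and Yn :: "nat \<Rightarrow> real \<Rightarrow> real" and Y :: "real \<Rightarrow> real"
    where W: "prob_space W" and Yn [measurable]: "\<And>n. Yn n \<in> borel_measurable W"
    and Yn_law: "\<And>n. distr W borel (Yn n) = ?N n" and Y_meas: "Y \<in> measurable W lborel"
    and Y_law: "distr W borel Y = std_normal_distribution" and Y_lim: "\<And>\<omega>. \<omega> \<in> space W \<Longrightarrow> (\<lambda>n. Yn n \<omega>) \<longlonglongrightarrow> Y \<omega>"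
    using Skorohod[OF real_distribution_tilted[OF Xpos] real_dist_normal_dist weak_conv_tilted[OF X Xpos]] by blast
  have [measurable]: "Y \<in> borel_measurable W" using Y_meas by simp
  interpret W: prob_space W by fact
  have "(\<lambda>n. LINT \<omega>|W. f (X n) (Yn n \<omega>)) \<longlonglongrightarrow> (LINT \<omega>|W. exp (- (b * c\<^sup>2 * (Y \<omega>)\<^sup>2 / 2)))"
  proof (rule integral_dominated_convergence[where w = "\<lambda>_. exp (a\<^sup>2 / (2 * b))"])
    show "AE \<omega> in W. (\<lambda>n. f (X n) (Yn n \<omega>)) \<longlonglongrightarrow> exp (- (b * c\<^sup>2 * (Y \<omega>)\<^sup>2 / 2))"
      using Y_lim exp_remainder_tendsto[OF X Xpos _ b] unfolding f_def y_def
      by (intro AE_I2 tendsto_exp) blast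
  qed (use bound in auto)
  also have "(\<lambda>n. LINT \<omega>|W. f (X n) (Yn n \<omega>)) = (\<lambda>n. ?I (X n))"
    unfolding eq Yn_law[symmetric] by (subst integral_distr) auto
  also have "(LINT \<omega>|W. exp (- (b * c\<^sup>2 * (Y \<omega>)\<^sup>2 / 2))) = (LINT x|std_normal_distribution. exp (- (b * c\<^sup>2 * x\<^sup>2 / 2)))"
    unfolding Y_law[symmetric] by (subst integral_distr) auto
  also have "\<dots> = 1 / sqrt (1 + b * c\<^sup>2)"
    using b by (intro std_normal_exp_square) auto
  also have "c\<^sup>2 = 1 - \<beta>" using \<beta> by (simp add: c_def)
  finally show "(\<lambda>n. ?I (X n)) \<longlonglongrightarrow> 1 / sqrt (1 + b * (1 - \<beta>))" .
qed

end

section \<open>Tail of a stable law\<close>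

lemma has_bochner_integral_of_has_integral:
  fixes f :: "real \<Rightarrow> real"
  assumes [measurable]: "f \<in> borel_measurable borel" "S \<in> sets borel"
    and nonneg: "\<And>x. x \<in> S \<Longrightarrow> 0 \<le> f x" and int: "(f has_integral r) S"
  shows "has_bochner_integral lborel (\<lambda>x. indicator S x * f x) r"
proof (rule has_bochner_integral_nn_integral)
  show "(\<integral>\<^sup>+x. ennreal (indicator S x * f x) \<partial>lborel) = ennreal r"
    using nonneg int by (rule nn_integral_has_integral_lebesgue)
  show "0 \<le> r"
    using int nonneg by (rule has_integral_nonneg)
qed (use nonneg in \<open>auto split: split_indicator\<close>)

text \<open>Tonelli's theorem in the form used for layer cake formulas, with the inner integrals of
  both orders given. The equality also covers an infinite common value, where both Bochner integrals
  are 0.\<close>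

lemma (in pair_sigma_finite) integral_swap_nonneg:
  fixes f :: "'a \<Rightarrow> 'b \<Rightarrow> real"
  assumes [measurable]: "case_prod f \<in> borel_measurable (M1 \<Otimes>\<^sub>M M2)" "g \<in> borel_measurable M1" "h \<in> borel_measurable M2"
    and nonneg: "\<And>x y. 0 \<le> f x y"
    and g: "AE x in M1. has_bochner_integral M2 (f x) (g x)"
    and h: "AE y in M2. has_bochner_integral M1 (\<lambda>x. f x y) (h y)"
  shows "integrable M1 g \<Longrightarrow> integrable M2 h" and "integral\<^sup>L M2 h = integral\<^sup>L M1 g"
proof -
  have g': "AE x in M1. (\<integral>\<^sup>+y. ennreal (f x y) \<partial>M2) = ennreal (g x) \<and> 0 \<le> g x"
    using g
  proof eventually_elim
    case (elim x)
    have "0 \<le> integral\<^sup>L M2 (f x)" using nonneg by (intro Bochner_Integration.integral_nonneg) auto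
    with elim have "0 \<le> g x" by (simp add: has_bochner_integral_iff)
    with elim show ?case
      using nonneg by (auto simp: has_bochner_integral_iff nn_integral_eq_integral)
  qed
  have h': "AE y in M2. (\<integral>\<^sup>+x. ennreal (f x y) \<partial>M1) = ennreal (h y) \<and> 0 \<le> h y"
    using h
  proof eventually_elim
    case (elim y)
    have "0 \<le> (LINT x|M1. f x y)" using nonneg by (intro Bochner_Integration.integral_nonneg) auto
    with elim have "0 \<le> h y" by (simp add: has_bochner_integral_iff)
    with elim show ?case
      using nonneg by (auto simp: has_bochner_integral_iff nn_integral_eq_integral)
  qed
  have "(\<integral>\<^sup>+y. ennreal (h y) \<partial>M2) = (\<integral>\<^sup>+y. (\<integral>\<^sup>+x. ennreal (f x y) \<partial>M1) \<partial>M2)"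
    using h' by (intro nn_integral_cong_AE) (auto elim!: eventually_mono)
  also have "\<dots> = (\<integral>\<^sup>+x. (\<integral>\<^sup>+y. ennreal (f x y) \<partial>M2) \<partial>M1)"
    by (rule Fubini') measurable
  also have "\<dots> = (\<integral>\<^sup>+x. ennreal (g x) \<partial>M1)"
    using g' by (intro nn_integral_cong_AE) (auto elim!: eventually_mono)
  finally have eq: "(\<integral>\<^sup>+y. ennreal (h y) \<partial>M2) = (\<integral>\<^sup>+x. ennreal (g x) \<partial>M1)" .
  have gh: "AE x in M1. 0 \<le> g x" "AE y in M2. 0 \<le> h y"
    using g' h' by (auto elim!: eventually_mono)
  show "integral\<^sup>L M2 h = integral\<^sup>L M1 g"
    using gh eq by (simp add: integral_eq_nn_integral)
  show "integrable M2 h" if "integrable M1 g"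
  proof (rule integrableI_nn_integral_finite)
    show "(\<integral>\<^sup>+y. ennreal (h y) \<partial>M2) = ennreal (integral\<^sup>L M1 g)"
      unfolding eq using that gh(1) by (rule nn_integral_eq_integral)
  qed (use gh in auto)
qed

text \<open>This is the density of the Levy measure of the subordinator, normalised so that the
  integral of 1 - exp (- r u) against it is r^\<beta>.\<close>

definition levy_density :: "real \<Rightarrow> real \<Rightarrow> real" where
  "levy_density \<beta> u = \<beta> / Gamma (1 - \<beta>) * (indicator {0<..} u * u powr (- \<beta> - 1))"

lemma levy_density_measurable [measurable]: "levy_density \<beta> \<in> borel_measurable borel"
  unfolding levy_density_def by measurable

lemma levy_density_nonneg: "0 < \<beta> \<Longrightarrow> \<beta> < 1 \<Longrightarrow> 0 \<le> levy_density \<beta> u"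
  by (auto simp: levy_density_def less_imp_le intro!: mult_nonneg_nonneg divide_nonneg_nonneg)

lemma Gamma_scaled_integral:
  fixes a s :: real
  assumes "0 < a" "0 < s"
  shows "has_bochner_integral lborel (\<lambda>u. indicator {0..} u * (u powr (a - 1) * exp (- s * u))) (Gamma a * s powr (- a))"
proof -
  have "has_bochner_integral lborel (\<lambda>t. indicator {0..} t * (t powr (a - 1) / exp t)) (Gamma a)"
    using Gamma_integral_real[OF assms(1)] by (intro has_bochner_integral_of_has_integral) auto
  then have "has_bochner_integral lborel (\<lambda>u. indicator {0..} (0 + s * u) * ((0 + s * u) powr (a - 1) / exp (0 + s * u))) (Gamma a /\<^sub>R \<bar>s\<bar>)"
    using assms by (subst (asm) lborel_has_bochner_integral_real_affine_iff[where c = s and t = 0]) auto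
  then have "has_bochner_integral lborel (\<lambda>u. s powr (1 - a) * (indicator {0..} (0 + s * u) * ((0 + s * u) powr (a - 1) / exp (0 + s * u))))
      (s powr (1 - a) * (Gamma a /\<^sub>R \<bar>s\<bar>))"
    by (rule has_bochner_integral_mult_right) 
  also have "(\<lambda>u. s powr (1 - a) * (indicator {0..} (0 + s * u) * ((0 + s * u) powr (a - 1) / exp (0 + s * u)))) =
      (\<lambda>u. indicator {0..} u * (u powr (a - 1) * exp (- s * u)))"
  proof
    fix u
    have "s powr (1 - a) * s powr (a - 1) = 1"
      using assms by (simp flip: powr_add)
    then show "s powr (1 - a) * (indicator {0..} (0 + s * u) * ((0 + s * u) powr (a - 1) / exp (0 + s * u))) =
      indicator {0..} u * (u powr (a - 1) * exp (- s * u))"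
      using assms by (auto simp: zero_le_mult_iff powr_mult exp_minus field_simps split: split_indicator)
  qed
  also have "s powr (1 - a) * (Gamma a /\<^sub>R \<bar>s\<bar>) = Gamma a * s powr (- a)"
    using assms by (simp add: powr_diff powr_minus field_simps)
  finally show ?thesis .
qed

text \<open>The difference of exponentials divided by u is the integral of exp (- s u) over s from r
  to r + 1. After exchanging integrals, the u-integral is a Gamma integral and leaves \<beta>
  s^(\<beta> - 1), the derivative of s^\<beta>. A difference is taken because the Levy measure has
  infinite mass near 0.\<close>

lemma levy_density_exp_integral:
  fixes \<beta> r :: real
  assumes \<beta>: "0 < \<beta>" "\<beta> < 1" and r: "0 \<le> r"
  shows "has_bochner_integral lborel (\<lambda>u. levy_density \<beta> u * (exp (- r * u) - exp (- (r + 1) * u))) ((r + 1) powr \<beta> - r powr \<beta>)"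
proof -
  define c where "c = \<beta> / Gamma (1 - \<beta>)"
  have c: "0 < c" using \<beta> by (simp add: c_def)
  have G0: "Gamma (1 - \<beta>) \<noteq> 0"
    using Gamma_real_pos[of "1 - \<beta>"] \<beta> by linarith
  define f where "f s u = c * (indicator {r..r+1} s * (indicator {0..} u * (u powr (- \<beta>) * exp (- s * u))))" for s u :: real
  define g where "g s = indicator {r..r+1} s * (\<beta> * s powr (\<beta> - 1))" for s :: real
  define h where "h u = levy_density \<beta> u * (exp (- r * u) - exp (- (r + 1) * u))" for u
  have "((\<lambda>s. \<beta> * s powr (\<beta> - 1)) has_integral ((r + 1) powr \<beta> - r powr \<beta>)) {r..r + 1}"
    using \<beta> r by (intro fundamental_theorem_of_calculus_interior)
      (auto intro!: continuous_on_powr' continuous_on_id continuous_on_const derivative_eq_intros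
        simp flip: has_real_derivative_iff_has_vector_derivative)
  then have G: "has_bochner_integral lborel g ((r + 1) powr \<beta> - r powr \<beta>)"
    unfolding g_def using \<beta> by (intro has_bochner_integral_of_has_integral) auto
  have g: "AE s in lborel. has_bochner_integral lborel (f s) (g s)"
    using AE_lborel_singleton[of 0]
  proof eventually_elim
    case (elim s)
    show ?case
    proof (cases "s \<in> {r..r+1}")
      case True
      then have "0 < s" using elim r by auto
      then have "has_bochner_integral lborel (\<lambda>u. c * (indicator {0..} u * (u powr (1 - \<beta> - 1) * exp (- s * u)))) (c * (Gamma (1 - \<beta>) * s powr (- (1 - \<beta>))))"
        using \<beta> by (intro has_bochner_integral_mult_right Gamma_scaled_integral) auto
      moreover have "c * (Gamma (1 - \<beta>) * s powr (- (1 - \<beta>))) = g s"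
        using True G0 by (simp add: c_def g_def)
      ultimately show ?thesis using True by (simp add: f_def[abs_def])
    qed (auto simp: f_def[abs_def] g_def has_bochner_integral_zero)
  qed
  have h: "AE u in lborel. has_bochner_integral lborel (\<lambda>s. f s u) (h u)"
    using AE_lborel_singleton[of 0]
  proof eventually_elim
    case (elim u)
    show ?case
    proof (cases "0 < u")
      case True
      have "((\<lambda>s. exp (- s * u)) has_integral (- exp (- (r + 1) * u) / u - (- exp (- r * u) / u))) {r..r + 1}"
        using True by (intro fundamental_theorem_of_calculus)
          (auto intro!: derivative_eq_intros simp flip: has_real_derivative_iff_has_vector_derivative)
      then have "has_bochner_integral lborel (\<lambda>s. indicator {r..r+1} s * exp (- s * u)) (- exp (- (r + 1) * u) / u - (- exp (- r * u) / u))"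
        by (intro has_bochner_integral_of_has_integral) auto
      then have "has_bochner_integral lborel (\<lambda>s. (c * u powr (- \<beta>)) * (indicator {r..r+1} s * exp (- s * u)))
          ((c * u powr (- \<beta>)) * (- exp (- (r + 1) * u) / u - (- exp (- r * u) / u)))"
        by (rule has_bochner_integral_mult_right)
      moreover have "(c * u powr (- \<beta>)) * (- exp (- (r + 1) * u) / u - (- exp (- r * u) / u)) = h u"
        using True by (simp add: h_def levy_density_def c_def powr_diff field_simps)
      ultimately show ?thesis
        using True by (simp add: f_def mult_ac)
    next
      case False
      with elim show ?thesis by (simp add: f_def h_def levy_density_def has_bochner_integral_zero)
    qed
  qed
  have meas [measurable]: "case_prod f \<in> borel_measurable (lborel \<Otimes>\<^sub>M lborel)" "g \<in> borel_measurable lborel" "h \<in> borel_measurable lborel"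
    unfolding f_def g_def h_def by measurable
  have nn: "0 \<le> f s u" for s u
    using c by (simp add: f_def)
  show ?thesis
    using lborel_pair.integral_swap_nonneg[OF meas nn g h] G unfolding h_def has_bochner_integral_iff by simp
qed

section \<open>Damped laws and their convergence to the Levy measure\<close>

context stable_law
begin

lemma laplace': "0 \<le> r \<Longrightarrow> (LINT x|D. exp (- r * x)) = exp (- (r powr \<beta>))"
  using laplace[of r] prob_space by (cases "r = 0") auto

text \<open>The factor 1 - exp (- s / x) vanishes linearly at the origin, where the Levy measure is
  infinite, so that the rescaled laws and their limit can all be probability measures. The
  normalisation is the expectation of this factor, read off the Laplace transform at 1 / x.\<close>

definition damped :: "real \<Rightarrow> real measure" where
  "damped x = density D (\<lambda>s. ennreal ((1 - exp (- s / x)) / (1 - exp (- (x powr (- \<beta>))))))"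

definition levy_damped :: "real measure" where
  "levy_damped = density lborel (\<lambda>u. ennreal (levy_density \<beta> u * (1 - exp (- u))))"

lemma damped_norm_pos: "0 < x \<Longrightarrow> 0 < 1 - exp (- (x powr (- \<beta>)))"
  by simp

lemma damped_density_nonneg: "0 < x \<Longrightarrow> AE s in D. 0 \<le> (1 - exp (- s / x)) / (1 - exp (- (x powr (- \<beta>))))"
  using pos by eventually_elim simp

lemma levy_damped_density_nonneg: "0 \<le> levy_density \<beta> u * (1 - exp (- u))"
proof (cases "0 < u")
  case True
  then show ?thesis by (intro mult_nonneg_nonneg levy_density_nonneg \<beta>) simp
qed (simp add: levy_density_def)

lemma integral_damped:
  fixes f :: "real \<Rightarrow> real"
  assumes "0 < x" and [measurable]: "f \<in> borel_measurable borel"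
  shows "(LINT y|distr (damped x) borel (\<lambda>s. exp (- s / x)). f y) =
    (LINT s|D. (1 - exp (- s / x)) * f (exp (- s / x))) / (1 - exp (- (x powr (- \<beta>))))"
  using damped_density_nonneg[OF assms(1)]
  by (subst integral_distr, simp_all add: damped_def) (subst integral_density, auto)

lemma integral_levy_damped:
  fixes f :: "real \<Rightarrow> real"
  assumes [measurable]: "f \<in> borel_measurable borel"
  shows "(LINT y|distr levy_damped borel (\<lambda>u. exp (- u)). f y) =
    (LINT u|lborel. levy_density \<beta> u * (1 - exp (- u)) * f (exp (- u)))"
  using levy_damped_density_nonneg
  by (subst integral_distr, simp_all add: levy_damped_def) (subst integral_density, auto)

lemma integral_damped_power:
  assumes x: "0 < x"
  shows "(LINT s|D. (1 - exp (- s / x)) * exp (- s / x) ^ j) =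
    exp (- ((real j / x) powr \<beta>)) - exp (- ((real (j + 1) / x) powr \<beta>))"
proof -
  have "(1 - exp (- s / x)) * exp (- s / x) ^ j = exp (- (real j / x) * s) - exp (- (real (j + 1) / x) * s)" for s
  proof -
    have "exp (- s / x) ^ j = exp (- (real j / x) * s)"
      by (simp flip: exp_of_nat_mult)
    moreover have "exp (- s / x) * exp (- (real j / x) * s) = exp (- (real (j + 1) / x) * s)"
      by (simp add: field_simps add_divide_distrib flip: exp_add)
    ultimately show ?thesis by (simp add: left_diff_distrib)
  qed
  then show ?thesis
    using x integrable_laplace[of "real j / x"] integrable_laplace[of "real (j + 1) / x"]
      laplace'[of "real j / x"] laplace'[of "real (j + 1) / x"] by simp
qed

lemma real_distribution_damped:
  assumes x: "0 < x"
  shows "real_distribution (distr (damped x) borel (\<lambda>s. exp (- s / x)))"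
proof -
  have int: "integrable D (\<lambda>s. (1 - exp (- s / x)) / (1 - exp (- (x powr (- \<beta>)))))"
    using integrable_laplace[of "1 / x"] x by simp
  have "(\<integral>\<^sup>+s. ennreal ((1 - exp (- s / x)) / (1 - exp (- (x powr (- \<beta>))))) \<partial>D) =
      ennreal (LINT s|D. (1 - exp (- s / x)) / (1 - exp (- (x powr (- \<beta>)))))"
    by (rule nn_integral_eq_integral[OF int damped_density_nonneg[OF x]])
  also have "(LINT s|D. (1 - exp (- s / x)) / (1 - exp (- (x powr (- \<beta>))))) = 1"
    using integral_damped_power[OF x, of 0] x by (simp add: powr_divide powr_minus field_simps)
  finally have "emeasure (damped x) (space (damped x)) = 1"
    by (simp add: damped_def emeasure_density)
  then interpret T: prob_space "damped x"
    by (rule prob_spaceI)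
  show ?thesis
    by (rule T.real_distribution_distr) (simp add: damped_def)
qed

lemma levy_damped_integral:
  "has_bochner_integral lborel (\<lambda>u. levy_density \<beta> u * (1 - exp (- u)) * exp (- u) ^ j) (real (j + 1) powr \<beta> - real j powr \<beta>)"
proof -
  have "levy_density \<beta> u * (1 - exp (- u)) * exp (- u) ^ j = levy_density \<beta> u * (exp (- real j * u) - exp (- (real j + 1) * u))" for u
  proof -
    have "exp (- u) ^ j = exp (- real j * u)"
      by (simp flip: exp_of_nat_mult)
    moreover have "exp (- u) * exp (- real j * u) = exp (- (real j + 1) * u)"
      by (simp add: field_simps flip: exp_add)
    ultimately show ?thesis by (simp add: algebra_simps)
  qed
  then show ?thesis
    using levy_density_exp_integral[OF \<beta> of_nat_0_le_iff[of j]] by (simp only: of_nat_add of_nat_1)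
qed

text \<open>The mass is the case j = 0 of \<open>levy_damped_integral\<close>, namely 1^\<beta> -
  0^\<beta> = 1; hence \<open>levy_damped\<close> carries no normalising constant.\<close>

lemma real_distribution_levy_damped: "real_distribution (distr levy_damped borel (\<lambda>u. exp (- u)))"
proof -
  have "(\<integral>\<^sup>+u. ennreal (levy_density \<beta> u * (1 - exp (- u))) \<partial>lborel) = ennreal 1"
    using levy_damped_integral[of 0] levy_damped_density_nonneg
    by (subst nn_integral_eq_integral) (auto simp: has_bochner_integral_iff)
  then have "emeasure levy_damped (space levy_damped) = 1"
    by (simp add: levy_damped_def emeasure_density)
  then interpret T: prob_space levy_damped
    by (rule prob_spaceI)
  show ?thesis
    by (rule T.real_distribution_distr) (simp add: levy_damped_def)
qed

text \<open>The substitution \<open>y = exp (- u)\<close> moves everything to the unit interval, where values of the Laplace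
  transform at integers become moments.\<close>

lemma weak_conv_damped:
  assumes X: "filterlim X at_top sequentially" "\<And>n. 0 < X n"
  shows "weak_conv_m (\<lambda>n. distr (damped (X n)) borel (\<lambda>s. exp (- s / X n))) (distr levy_damped borel (\<lambda>u. exp (- u)))"
proof (rule weak_conv_m_of_moments)
  show "real_distribution (distr (damped (X n)) borel (\<lambda>s. exp (- s / X n)))" for n
    by (rule real_distribution_damped[OF X(2)])
  show "real_distribution (distr levy_damped borel (\<lambda>u. exp (- u)))"
    by (rule real_distribution_levy_damped)
  show "AE y in distr (damped (X n)) borel (\<lambda>s. exp (- s / X n)). y \<in> {0..1}" for n
  proof -
    have "AE s in damped (X n). exp (- s / X n) \<in> {0..1}"
      unfolding damped_def using pos X(2)[of n] by (subst AE_density) (auto elim!: eventually_mono)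
    then show ?thesis by (subst AE_distr_iff) (auto simp: damped_def)
  qed
  show "AE y in distr levy_damped borel (\<lambda>u. exp (- u)). y \<in> {0..1}"
  proof -
    have "AE u in levy_damped. exp (- u) \<in> {0..1}"
      unfolding levy_damped_def by (subst AE_density) (auto intro!: AE_I2 simp: levy_density_def split: split_indicator_asm)
    then show ?thesis by (subst AE_distr_iff) (auto simp: levy_damped_def)
  qed
  show "(\<lambda>n. LINT y|distr (damped (X n)) borel (\<lambda>s. exp (- s / X n)). y ^ j)
      \<longlonglongrightarrow> (LINT y|distr levy_damped borel (\<lambda>u. exp (- u)). y ^ j)" for j :: nat
  proof -
    define c d where "c = real j powr \<beta>" and "d = real (j + 1) powr \<beta>"
    \<comment> \<open>With h = x^(- \<beta>) the Laplace transform at j / x is exp (- j^\<beta> h),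
      so the j-th moment is a quotient of differences at h near 0. Its limit is the j-th moment of
      the limit law.\<close>
    have "((\<lambda>h::real. (exp (- (c * h)) - exp (- (d * h))) / (1 - exp (- h))) \<longlongrightarrow> d - c) (at_right 0)"
      by real_asymp
    moreover have "filterlim (\<lambda>n. X n powr (- \<beta>)) (at_right 0) sequentially"
      by (rule filterlim_compose[OF _ X(1)]) (use \<beta> in real_asymp)
    ultimately have "(\<lambda>n. (exp (- (c * X n powr (- \<beta>))) - exp (- (d * X n powr (- \<beta>)))) / (1 - exp (- (X n powr (- \<beta>))))) \<longlonglongrightarrow> d - c"
      by (rule filterlim_compose)
    moreover have "(LINT y|distr (damped (X n)) borel (\<lambda>s. exp (- s / X n)). y ^ j) =
        (exp (- (c * X n powr (- \<beta>))) - exp (- (d * X n powr (- \<beta>)))) / (1 - exp (- (X n powr (- \<beta>))))" for n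
      using X(2)[of n]
      by (subst integral_damped, simp, simp)
         (simp only: integral_damped_power, simp add: c_def d_def powr_divide powr_minus_divide)
    moreover have "(LINT y|distr levy_damped borel (\<lambda>u. exp (- u)). y ^ j) = d - c"
      using levy_damped_integral[of j] by (simp add: integral_levy_damped has_bochner_integral_iff c_def d_def)
    ultimately show ?thesis by simp
  qed
qed

end

section \<open>Tails of the stable law and the moment limits away from the critical order\<close>

context stable_law
begin

text \<open>Away from the origin the damping can be divided out again: beyond a > 0 the factor 1 -
  exp (- u) is bounded below. The normalising factor 1 - exp (- x^(- \<beta>)) is asymptotic to x^(-
  \<beta>), which accounts for the power x^\<beta>.\<close>

lemma tail_functional:
  fixes f :: "real \<Rightarrow> real"
  assumes a: "0 < a" and f_meas [measurable]: "f \<in> borel_measurable borel"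
    and cont: "\<And>u. a < u \<Longrightarrow> isCont f u" and bdd: "\<And>u. a < u \<Longrightarrow> \<bar>f u\<bar> \<le> B"
  shows "((\<lambda>x. x powr \<beta> * (LINT s|D. indicator {a<..} (s / x) * f (s / x)))
    \<longlongrightarrow> (LINT u|lborel. levy_density \<beta> u * (indicator {a<..} u * f u))) at_top"
proof (rule tendsto_at_topI_sequentially_ge_1)
  fix X :: "nat \<Rightarrow> real"
  assume X: "filterlim X at_top sequentially" and X1: "\<And>n. 1 \<le> X n"
  have Xpos: "0 < X n" for n
    using X1[of n] by simp
  \<comment> \<open>In the variable y = exp (- u) this is f u divided by the damping factor 1 - y,
    cut off at u = a.\<close>
  define h where "h y = (if 0 < y \<and> y < exp (- a) then f (- ln y) / (1 - y) else 0)" for y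
  have h_meas [measurable]: "h \<in> borel_measurable borel"
    unfolding h_def by measurable
  have h_exp: "(1 - exp (- u)) * h (exp (- u)) = indicator {a<..} u * f u" for u
    using a by (auto simp: h_def split: split_indicator)
  let ?M = "distr levy_damped borel (\<lambda>u. exp (- u))"
  \<comment> \<open>The exceptional points are y = 0, which is u at infinity where f need not
    converge, and the cut-off y = exp (- a). The limit law charges neither of them.\<close>
  have cont_h: "isCont h y" if y: "y \<notin> {0, exp (- a)}" for y
  proof -
    consider "y < 0" | "exp (- a) < y" | "0 < y" "y < exp (- a)"
      using y by force
    then show ?thesis
    proof cases
      case 1
      have "eventually (\<lambda>y. h y = 0) (nhds y)"
        using eventually_nhds_in_open[of "{..<0}" y] 1 by (auto simp: h_def elim!: eventually_mono)
      then show ?thesis by (subst isCont_cong) auto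
    next
      case 2
      have "eventually (\<lambda>y. h y = 0) (nhds y)"
        using eventually_nhds_in_open[of "{exp (- a)<..}" y] 2 by (auto simp: h_def elim!: eventually_mono)
      then show ?thesis by (subst isCont_cong) auto
    next
      case 3
      have "eventually (\<lambda>y. h y = f (- ln y) / (1 - y)) (nhds y)"
        using eventually_nhds_in_open[of "{0<..<exp (- a)}" y] 3 by (auto simp: h_def elim!: eventually_mono)
      then have h_iff: "isCont h y \<longleftrightarrow> isCont (\<lambda>y. f (- ln y) / (1 - y)) y"
        by (rule isCont_cong)
      have "ln y < ln (exp (- a))"
        using 3 by (subst ln_less_cancel_iff) auto
      then have "isCont f (- ln y)"
        by (intro cont) auto
      moreover have "isCont (\<lambda>y. - ln y) y"
        using 3 by (intro continuous_intros) auto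
      ultimately have "isCont (\<lambda>y. f (- ln y)) y"
        by (rule isCont_o2[rotated])
      moreover have "y \<noteq> 1"
        using 3 a by (smt (verit) exp_le_one_iff)
      ultimately show ?thesis
        unfolding h_iff by (intro isCont_divide isCont_diff continuous_const continuous_ident) auto
    qed
  qed
  have "AE u in levy_damped. exp (- u) \<notin> {0, exp (- a)}"
    unfolding levy_damped_def using AE_lborel_singleton[of a]
    by (subst AE_density) (auto elim!: eventually_mono)
  then have null: "AE y in ?M. y \<notin> {0, exp (- a)}"
    by (subst AE_distr_iff) (auto simp: levy_damped_def)
  have sets: "{x. \<not> isCont h x} \<in> sets borel"
    using isCont_borel[of h] h_meas by (simp add: pred_def) 
  have "emeasure ?M {x. \<not> isCont h x} = 0"
  proof (rule AE_iff_measurable[THEN iffD1])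
    show "AE y in ?M. isCont h y"
      using null by eventually_elim (rule cont_h)
  qed (use sets in auto)
  moreover have "norm (h y) \<le> \<bar>B\<bar> / (1 - exp (- a))" for y
  proof (cases "0 < y \<and> y < exp (- a)")
    case True
    then have "ln y < ln (exp (- a))"
      by (subst ln_less_cancel_iff) auto
    then have "\<bar>f (- ln y)\<bar> \<le> \<bar>B\<bar>"
      using bdd[of "- ln y"] by simp
    moreover have "exp (- a) < 1" using a by simp
    ultimately show ?thesis
      using True by (auto simp: h_def abs_divide intro!: frac_le)
  qed (use a in \<open>auto simp: h_def\<close>)
  ultimately have "(\<lambda>n. LINT y|distr (damped (X n)) borel (\<lambda>s. exp (- s / X n)). h y) \<longlonglongrightarrow> (LINT y|?M. h y)"
    using weak_conv_imp_bdd_ae_continuous_conv[OF real_distribution_damped[OF Xpos] real_distribution_levy_damped weak_conv_damped[OF X Xpos] _ _ h_meas]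
    by blast
  moreover have "((\<lambda>x. x powr \<beta> * (1 - exp (- (x powr (- \<beta>))))) \<longlongrightarrow> 1) at_top"
    using \<beta> by real_asymp
  then have "(\<lambda>n. X n powr \<beta> * (1 - exp (- (X n powr (- \<beta>))))) \<longlonglongrightarrow> 1"
    using X by (rule filterlim_compose)
  ultimately have "(\<lambda>n. X n powr \<beta> * (1 - exp (- (X n powr (- \<beta>)))) * (LINT y|distr (damped (X n)) borel (\<lambda>s. exp (- s / X n)). h y)) \<longlonglongrightarrow> 1 * (LINT y|?M. h y)"
    by (intro tendsto_mult)
  also have "(LINT y|?M. h y) = (LINT u|lborel. levy_density \<beta> u * (indicator {a<..} u * f u))"
    by (simp add: integral_levy_damped mult.assoc h_exp)
  also have "(\<lambda>n. X n powr \<beta> * (1 - exp (- (X n powr (- \<beta>)))) * (LINT y|distr (damped (X n)) borel (\<lambda>s. exp (- s / X n)). h y))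
    = (\<lambda>n. X n powr \<beta> * (LINT s|D. indicator {a<..} (s / X n) * f (s / X n)))"
  proof
    fix n
    have "(LINT s|D. (1 - exp (- s / X n)) * h (exp (- s / X n))) = (LINT s|D. indicator {a<..} (s / X n) * f (s / X n))"
      using h_exp[of "s / X n" for s] by simp
    then show "X n powr \<beta> * (1 - exp (- (X n powr (- \<beta>)))) * (LINT y|distr (damped (X n)) borel (\<lambda>s. exp (- s / X n)). h y)
      = X n powr \<beta> * (LINT s|D. indicator {a<..} (s / X n) * f (s / X n))"
      using damped_norm_pos[OF Xpos[of n]] by (subst integral_damped[OF Xpos h_meas]) simp
  qed
  finally show "(\<lambda>n. X n powr \<beta> * (LINT s|D. indicator {a<..} (s / X n) * f (s / X n))) \<longlonglongrightarrow>
     (LINT u|lborel. levy_density \<beta> u * (indicator {a<..} u * f u))"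
    by simp
qed

text \<open>For s > y the quantity 1 - exp (- s / y) exceeds 1 - exp (- 1), so Markov's inequality
  reduces the tail to the Laplace transform at 1 / y. The bound holds for all y and serves for
  domination, unlike the asymptotics.\<close>

lemma tail_bound:
  assumes "0 < y"
  shows "prob {y<..} \<le> y powr (- \<beta>) / (1 - exp (- 1))"
proof -
  have "prob {y<..} * (1 - exp (- 1)) = (LINT s|D. indicator {y<..} s * (1 - exp (- 1)))"
    by simp
  also have "\<dots> \<le> (LINT s|D. 1 - exp (- (1 / y) * s))"
  proof (rule integral_mono_AE)
    show "integrable D (\<lambda>s. 1 - exp (- (1 / y) * s))"
      using integrable_laplace[of "1 / y"] assms by simp
    show "AE s in D. indicator {y<..} s * (1 - exp (- 1)) \<le> 1 - exp (- (1 / y) * s)"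
      using pos by eventually_elim (use assms in \<open>auto simp: field_simps split: split_indicator\<close>)
  qed (auto intro!: integrable_real_indicator simp: less_top[symmetric])
  also have "\<dots> = 1 - exp (- (y powr (- \<beta>)))"
    using laplace'[of "1 / y"] integrable_laplace[of "1 / y"] assms prob_space
    by (simp add: powr_divide powr_minus_divide)
  also have "\<dots> \<le> y powr (- \<beta>)"
    using exp_ge_add_one_self[of "- (y powr (- \<beta>))"] by linarith
  finally show ?thesis by (simp add: field_simps)
qed

lemma tail_asymp: "((\<lambda>y. y powr \<beta> * prob {y<..}) \<longlongrightarrow> 1 / Gamma (1 - \<beta>)) at_top"
proof -
  have "((\<lambda>x. x powr \<beta> * (LINT s|D. indicator {1<..} (s / x) * 1))
    \<longlongrightarrow> (LINT u|lborel. levy_density \<beta> u * (indicator {1<..} u * 1))) at_top"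
    by (rule tail_functional[where B = 1]) auto
  moreover have "(LINT u|lborel. levy_density \<beta> u * (indicator {1<..} u * 1)) = 1 / Gamma (1 - \<beta>)"
  proof -
    have "((\<lambda>x. x powr (- \<beta> - 1)) has_integral - (1 powr (- \<beta> - 1 + 1)) / (- \<beta> - 1 + 1)) {1..}"
      using \<beta> by (intro has_integral_powr_to_inf) auto
    then have "has_bochner_integral lborel (\<lambda>x. indicator {1..} x * x powr (- \<beta> - 1)) (1 / \<beta>)"
      using \<beta> by (intro has_bochner_integral_of_has_integral) auto
    then have "has_bochner_integral lborel (\<lambda>x. \<beta> / Gamma (1 - \<beta>) * (indicator {1..} x * x powr (- \<beta> - 1))) (\<beta> / Gamma (1 - \<beta>) * (1 / \<beta>))"
      by (rule has_bochner_integral_mult_right)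
    moreover have "(LINT u|lborel. levy_density \<beta> u * (indicator {1<..} u * 1)) = (LINT x|lborel. \<beta> / Gamma (1 - \<beta>) * (indicator {1..} x * x powr (- \<beta> - 1)))"
    proof (rule integral_cong_AE)
      show "AE u in lborel. levy_density \<beta> u * (indicator {1<..} u * 1) = \<beta> / Gamma (1 - \<beta>) * (indicator {1..} u * u powr (- \<beta> - 1))"
        using AE_lborel_singleton[of 1] by eventually_elim (auto simp: levy_density_def split: split_indicator)
    qed simp_all
    ultimately show ?thesis using \<beta> by (simp add: has_bochner_integral_iff)
  qed
  moreover have "eventually (\<lambda>x. x powr \<beta> * (LINT s|D. indicator {1<..} (s / x) * 1) = x powr \<beta> * prob {x<..}) at_top"
    using eventually_gt_at_top[of 0]
  proof eventually_elim
    case (elim x)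
    then have "(\<lambda>s. indicator {1<..} (s / x) * 1 :: real) = indicator {x<..}"
      by (auto simp: fun_eq_iff field_simps split: split_indicator)
    then show ?case by simp
  qed
  ultimately show ?thesis by (simp add: Lim_transform_eventually)
qed

lemma moment_asymp_at_infinity:
  assumes p: "p < \<beta>" and [measurable]: "G \<in> borel_measurable borel"
    and G: "\<And>u. 0 < u \<Longrightarrow> 0 \<le> G u" "\<And>u. 0 < u \<Longrightarrow> G u \<le> 1" "(G \<longlongrightarrow> 1) (at_right 0)"
  shows "((\<lambda>x. LINT s|D. s powr p * G (s / x)) \<longlongrightarrow> Gamma (1 - p / \<beta>) / Gamma (1 - p)) at_top"
proof -
  have mom: "integrable D (\<lambda>s. s powr p)" "(LINT s|D. s powr p) = Gamma (1 - p / \<beta>) / Gamma (1 - p)"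
    using moment[of "- p"] p by simp_all
  have "((\<lambda>x. LINT s|D. s powr p * G (s / x)) \<longlongrightarrow> (LINT s|D. s powr p)) at_top"
  proof (rule integral_dominated_convergence_at_top[where w = "\<lambda>s. s powr p"])
    show "AE s in D. ((\<lambda>x. s powr p * G (s / x)) \<longlongrightarrow> s powr p) at_top"
      using pos
    proof eventually_elim
      case (elim s)
      then have "filterlim (\<lambda>x. s / x) (at_right 0) at_top"
        by real_asymp
      then have "((\<lambda>x. s powr p * G (s / x)) \<longlongrightarrow> s powr p * 1) at_top"
        by (intro tendsto_intros filterlim_compose[OF G(3)])
      then show ?case by simp
    qed
    show "eventually (\<lambda>x. AE s in D. norm (s powr p * G (s / x)) \<le> s powr p) at_top"
      using eventually_gt_at_top[of 0]
    proof eventually_elim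
      case (elim x)
      show ?case using pos
        by eventually_elim (use elim G(1,2) in \<open>auto simp: abs_mult intro!: mult_left_le\<close>)
    qed
  qed (use mom in auto)
  then show ?thesis by (simp add: mom)
qed

lemma moment_asymp_at_zero:
  assumes q: "q = p + \<beta>" and [measurable]: "G \<in> borel_measurable borel"
    and G: "\<And>u. 0 < u \<Longrightarrow> 0 \<le> G u" "\<And>u. 0 < u \<Longrightarrow> G u * u powr q \<le> 1" "((\<lambda>u. G u * u powr q) \<longlongrightarrow> 1) at_top"
  shows "((\<lambda>x. x powr (- q) * (LINT s|D. s powr p * G (s / x))) \<longlongrightarrow> 1 / Gamma (1 + \<beta>)) (at_right 0)"
  unfolding filterlim_at_right_to_top
proof -
  have mom: "integrable D (\<lambda>s. s powr (- \<beta>))" "(LINT s|D. s powr (- \<beta>)) = 1 / Gamma (1 + \<beta>)"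
    using moment[of \<beta>] \<beta> Gamma_numeral[of "num.Bit0 num.One", where 'a = real] by simp_all
  \<comment> \<open>Because p - q = - \<beta>, the powers of s combine to the negative moment of
    order \<beta>. What is left of the profile is bounded by 1 and tends to 1.\<close>
  have eq: "x powr q * (s powr p * G (s * x)) = s powr (- \<beta>) * (G (s * x) * (s * x) powr q)" if "0 < x" "0 < s" for x s
    using that by (simp add: q powr_mult powr_add powr_minus field_simps)
  have "((\<lambda>x. LINT s|D. x powr q * (s powr p * G (s * x))) \<longlongrightarrow> (LINT s|D. s powr (- \<beta>))) at_top"
  proof (rule integral_dominated_convergence_at_top[where w = "\<lambda>s. s powr (- \<beta>)"])
    show "AE s in D. ((\<lambda>x. x powr q * (s powr p * G (s * x))) \<longlongrightarrow> s powr (- \<beta>)) at_top"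
      using pos
    proof eventually_elim
      case (elim s)
      then have "filterlim (\<lambda>x. s * x) at_top at_top"
        by real_asymp
      then have "((\<lambda>x. s powr (- \<beta>) * (G (s * x) * (s * x) powr q)) \<longlongrightarrow> s powr (- \<beta>) * 1) at_top"
        by (intro tendsto_mult tendsto_const filterlim_compose[OF G(3)])
      then show ?case
        unfolding mult_1_right by (rule Lim_transform_eventually)
          (use eventually_gt_at_top[of 0] in eventually_elim, rule eq[OF _ elim, symmetric])
    qed
    show "eventually (\<lambda>x. AE s in D. norm (x powr q * (s powr p * G (s * x))) \<le> s powr (- \<beta>)) at_top"
      using eventually_gt_at_top[of 0]
    proof eventually_elim
      case (elim x)
      show ?case using pos
      proof eventually_elim
        case (elim s)
        then show ?case
          using \<open>0 < x\<close> G(1,2)[of "s * x"] by (simp only: eq[OF \<open>0 < x\<close> elim]) (auto simp: abs_mult intro!: mult_left_le)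
      qed
    qed
  qed (use mom in auto)
  moreover have "eventually (\<lambda>x. (LINT s|D. x powr q * (s powr p * G (s * x))) =
      inverse x powr - q * (LINT s|D. s powr p * G (s / inverse x))) at_top"
    using eventually_gt_at_top[of 0]
    by eventually_elim (simp add: powr_minus inverse_powr divide_inverse)
  ultimately show "((\<lambda>x. inverse x powr - q * (LINT s|D. s powr p * G (s / inverse x))) \<longlongrightarrow> 1 / Gamma (1 + \<beta>)) at_top"
    by (simp add: mom Lim_transform_eventually)
qed

end

section \<open>Moments with a damping factor\<close>

lemma powr_layer_cake:
  fixes p u :: real
  assumes p: "0 < p" and u: "0 < u"
  shows "has_bochner_integral lborel (\<lambda>v. indicator {0<..} v * (p * v powr (p - 1)) * (if v < u then 1 else 0)) (u powr p)"
proof -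
  have "((\<lambda>v. v powr (p - 1)) has_integral (u powr (p - 1 + 1) / (p - 1 + 1))) {0..u}"
    using assms by (intro has_integral_powr_from_0) auto
  then have "has_bochner_integral lborel (\<lambda>v. indicator {0..u} v * v powr (p - 1)) (u powr p / p)"
    by (intro has_bochner_integral_of_has_integral) auto
  then have *: "has_bochner_integral lborel (\<lambda>v. p * (indicator {0..u} v * v powr (p - 1))) (p * (u powr p / p))"
    by (rule has_bochner_integral_mult_right)
  have val: "p * (u powr p / p) = u powr p"
    using p by simp
  show ?thesis
  proof (rule has_bochner_integral_cong_AE[THEN iffD1, OF _ _ _ *[unfolded val]])
    show "AE v in lborel. p * (indicator {0..u} v * v powr (p - 1)) = indicator {0<..} v * (p * v powr (p - 1)) * (if v < u then 1 else 0)"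
      using AE_lborel_singleton[of 0] AE_lborel_singleton[of u]
      by eventually_elim (auto split: split_indicator)
  qed (use p in simp_all)
qed

text \<open>This is the layer cake formula for s^b after the substitution v = exp (- l \<theta>).
  The Jacobian factor l is left out of the weight and shows up as the division by l; with l = ln x
  it becomes the logarithm of the critical case.\<close>

lemma exp_layer_cake:
  fixes b l s :: real
  assumes b: "0 < b" and l: "0 < l" and s: "0 < s"
  shows "has_bochner_integral lborel (\<lambda>\<theta>. b * exp (- b * l * \<theta>) * (if exp (- l * \<theta>) < s then 1 else 0)) (s powr b / l)"
proof -
  define c where "c = - ln s / l"
  have bl: "0 < b * l" using b l by simp
  have "((\<lambda>\<theta>. exp (- (b * l) * \<theta>)) has_integral exp (- (b * l) * c) / (b * l)) {c..}"
    by (rule has_integral_exp_minus_to_infinity[OF bl])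
  then have "has_bochner_integral lborel (\<lambda>\<theta>. indicator {c..} \<theta> * exp (- (b * l) * \<theta>)) (exp (- (b * l) * c) / (b * l))"
    by (intro has_bochner_integral_of_has_integral) auto
  then have *: "has_bochner_integral lborel (\<lambda>\<theta>. b * (indicator {c..} \<theta> * exp (- (b * l) * \<theta>))) (b * (exp (- (b * l) * c) / (b * l)))"
    by (rule has_bochner_integral_mult_right)
  have "- (b * l) * c = b * ln s"
    using l by (simp add: c_def)
  then have val: "b * (exp (- (b * l) * c) / (b * l)) = s powr b / l"
    using b s by (simp add: powr_def)
  show ?thesis
  proof (rule has_bochner_integral_cong_AE[THEN iffD1, OF _ _ _ *[unfolded val]])
    show "AE \<theta> in lborel. b * (indicator {c..} \<theta> * exp (- (b * l) * \<theta>)) = b * exp (- b * l * \<theta>) * (if exp (- l * \<theta>) < s then 1 else 0)"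
      using AE_lborel_singleton[of c]
    proof eventually_elim
      case (elim \<theta>)
      have "exp (- l * \<theta>) < s \<longleftrightarrow> exp (- l * \<theta>) < exp (ln s)"
        using s by simp
      also have "\<dots> \<longleftrightarrow> c < \<theta>"
        using l by (subst exp_less_cancel_iff) (auto simp: c_def field_simps)
      finally show ?case using elim by (auto split: split_indicator)
    qed
  qed simp_all
qed

context stable_law
begin

abbreviation tail_const :: real where
  "tail_const \<equiv> 1 / (1 - exp (- 1))"

lemma truncated_expectation_le:
  assumes [measurable]: "G \<in> borel_measurable borel"
    and G: "\<And>u. 0 < u \<Longrightarrow> 0 \<le> G u" "\<And>u. 0 < u \<Longrightarrow> G u \<le> 1" "\<And>u v. 0 < u \<Longrightarrow> u \<le> v \<Longrightarrow> G v \<le> G u"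
    and x: "0 < x" and y: "0 < y"
  shows "integrable D (\<lambda>s. if y < s then G (s / x) else 0)"
    and "0 \<le> (LINT s|D. (if y < s then G (s / x) else 0))"
    and "(LINT s|D. (if y < s then G (s / x) else 0)) \<le> G (y / x) * prob {y<..}"
proof -
  show int: "integrable D (\<lambda>s. if y < s then G (s / x) else 0)"
    using G(1,2) x y by (intro integrable_const_bound[where B = 1]) auto
  show "0 \<le> (LINT s|D. (if y < s then G (s / x) else 0))"
    using G(1) x y by (intro Bochner_Integration.integral_nonneg) auto
  have "(LINT s|D. (if y < s then G (s / x) else 0)) \<le> (LINT s|D. G (y / x) * indicator {y<..} s)"
    using int G(3) x y
    by (intro integral_mono integrable_mult_right integrable_real_indicator)
      (auto simp: less_top[symmetric] divide_right_mono split: split_indicator)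
  then show "(LINT s|D. (if y < s then G (s / x) else 0)) \<le> G (y / x) * prob {y<..}"
    by simp
qed

text \<open>Beyond v the damping factor is at least 1 - exp (- v), so the finite damped Levy measure
  dominates.\<close>

lemma levy_tail_integrable:
  assumes [measurable]: "G \<in> borel_measurable borel" and v: "0 < v"
    and G: "\<And>u. 0 < u \<Longrightarrow> 0 \<le> G u" "\<And>u. 0 < u \<Longrightarrow> G u \<le> 1"
  shows "integrable lborel (\<lambda>u. levy_density \<beta> u * (if v < u then G u else 0))"
proof (rule Bochner_Integration.integrable_bound)
  show "integrable lborel (\<lambda>u. levy_density \<beta> u * (1 - exp (- u)) * exp (- u) ^ 0 * (1 / (1 - exp (- v))))"
    by (rule integrable_mult_left) (use levy_damped_integral[of 0] in \<open>simp only: has_bochner_integral_iff\<close>)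
  show "AE u in lborel. norm (levy_density \<beta> u * (if v < u then G u else 0)) \<le> norm (levy_density \<beta> u * (1 - exp (- u)) * exp (- u) ^ 0 * (1 / (1 - exp (- v))))"
  proof (intro AE_I2)
    fix u
    show "norm (levy_density \<beta> u * (if v < u then G u else 0)) \<le> norm (levy_density \<beta> u * (1 - exp (- u)) * exp (- u) ^ 0 * (1 / (1 - exp (- v))))"
    proof (cases "v < u")
      case True
      have "1 \<le> (1 - exp (- u)) * (1 / (1 - exp (- v)))"
        using True v by simp
      then have "G u \<le> (1 - exp (- u)) * (1 / (1 - exp (- v)))"
        using G(2)[of u] True v by linarith
      then have "levy_density \<beta> u * G u \<le> levy_density \<beta> u * ((1 - exp (- u)) * (1 / (1 - exp (- v))))"
        by (intro mult_left_mono levy_density_nonneg \<beta>)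
      then show ?thesis
        using True v G(1)[of u] levy_density_nonneg[OF \<beta>, of u] by (simp add: abs_mult mult.assoc)
    qed simp
  qed
qed measurable

text \<open>The function u^p G u need not be bounded and is not cut off from the origin, so
  \<open>tail_functional\<close> does not apply to it directly. The layer cake formula writes it as
  a superposition of bounded functions cut off at thresholds v > 0, and each of these is covered. By
  \<open>tail_bound\<close> and the monotonicity of G, \<open>K x v\<close> is at most a constant
  times v^(- \<beta>) G v, whatever x; with the weight v^(p - 1) this is the integrand of
  \<open>int\<close>. Tonelli then undoes the layer cake on the Levy side.\<close>

lemma moment_asymp_heavy:
  assumes p: "\<beta> < p" and G_meas [measurable]: "G \<in> borel_measurable borel"
    and G: "\<And>u. 0 < u \<Longrightarrow> 0 \<le> G u" "\<And>u. 0 < u \<Longrightarrow> G u \<le> 1" "\<And>u v. 0 < u \<Longrightarrow> u \<le> v \<Longrightarrow> G v \<le> G u"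
    and cont: "\<And>u. 0 < u \<Longrightarrow> isCont G u"
    and int: "integrable lborel (\<lambda>u. indicator {0<..} u * (u powr (p - \<beta> - 1) * G u))"
  shows "((\<lambda>x. x powr (\<beta> - p) * (LINT s|D. s powr p * G (s / x)))
    \<longlongrightarrow> \<beta> / Gamma (1 - \<beta>) * (LINT u|lborel. indicator {0<..} u * (u powr (p - \<beta> - 1) * G u))) at_top"
proof -
  interpret P: pair_sigma_finite lborel D ..
  have p0: "0 < p" using p \<beta> by simp
  define K where "K x v = x powr \<beta> * (LINT s|D. (if v < s / x then G (s / x) else 0))" for x v
  define J where "J v = (LINT u|lborel. levy_density \<beta> u * (if v < u then G u else 0))" for v
  have [measurable]: "K x \<in> borel_measurable borel" for x
    unfolding K_def by measurable
  have [measurable]: "J \<in> borel_measurable borel"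
    unfolding J_def by measurable
  have ind: "(if v < u then G u else 0) = indicator {v<..} u * G u" for u v
    by (simp add: indicator_def)
  have scale: "(\<lambda>s. if v < s / x then G (s / x) else 0) = (\<lambda>s. if x * v < s then G (s / x) else 0)" if "0 < x" for x v
    using that by (auto simp: fun_eq_iff field_simps)
  have K_le: "K x v \<le> tail_const * (v powr (- \<beta>) * G v)" and K_nonneg: "0 \<le> K x v" if "0 < x" "0 < v" for x v
  proof -
    have "K x v \<le> x powr \<beta> * (G (x * v / x) * prob {x * v<..})"
      unfolding K_def scale[OF that(1)] using that
      by (intro mult_left_mono truncated_expectation_le(3)[OF G_meas G]) auto
    also have "\<dots> \<le> x powr \<beta> * (G v * ((x * v) powr (- \<beta>) * tail_const))"
      using that G(1)[of v] tail_bound[of "x * v"] by (intro mult_left_mono mult_mono) auto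
    also have "\<dots> = (x powr \<beta> * x powr (- \<beta>)) * (tail_const * (v powr (- \<beta>) * G v))"
      using that by (simp add: powr_mult)
    also have "x powr \<beta> * x powr (- \<beta>) = 1"
      using that by (simp flip: powr_add)
    finally show "K x v \<le> tail_const * (v powr (- \<beta>) * G v)" by simp
    show "0 \<le> K x v"
      unfolding K_def scale[OF that(1)] using that
      by (intro mult_nonneg_nonneg truncated_expectation_le(2)[OF G_meas G]) auto
  qed
  define w where "w v = indicator {0<..} v * (p * v powr (p - 1))" for v
  have w_nonneg: "0 \<le> w v" for v using p0 by (simp add: w_def)
  have [measurable]: "w \<in> borel_measurable borel" unfolding w_def by measurable
  have w_layer: "has_bochner_integral lborel (\<lambda>v. w v * (if v < u then 1 else 0)) (u powr p)" if "0 < u" for u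
    using powr_layer_cake[OF p0 that] by (simp add: w_def)
  have "((\<lambda>x. LINT v|lborel. w v * K x v) \<longlongrightarrow> (LINT v|lborel. w v * J v)) at_top"
  proof (rule integral_dominated_convergence_at_top)
    show "integrable lborel (\<lambda>v. tail_const * p * (indicator {0<..} v * (v powr (p - \<beta> - 1) * G v)))"
      using int by (rule integrable_mult_right)
    show "eventually (\<lambda>x. AE v in lborel. norm (w v * K x v) \<le> tail_const * p * (indicator {0<..} v * (v powr (p - \<beta> - 1) * G v))) at_top"
      using eventually_gt_at_top[of 0]
    proof (eventually_elim, intro AE_I2)
      fix x v :: real assume x: "0 < x"
      show "norm (w v * K x v) \<le> tail_const * p * (indicator {0<..} v * (v powr (p - \<beta> - 1) * G v))"
      proof (cases "0 < v")
        case True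
        have "norm (w v * K x v) = w v * K x v"
          using K_nonneg[OF x True] w_nonneg[of v] by simp
        also have "\<dots> \<le> w v * (tail_const * (v powr (- \<beta>) * G v))"
          using K_le[OF x True] w_nonneg[of v] by (rule mult_left_mono)
        also have "\<dots> = tail_const * p * ((v powr (p - 1) * v powr (- \<beta>)) * G v)"
          using True by (simp add: w_def mult_ac)
        also have "v powr (p - 1) * v powr (- \<beta>) = v powr (p - \<beta> - 1)"
          by (simp add: algebra_simps flip: powr_add)
        finally show ?thesis using True by simp
      qed (simp add: w_def)
    qed
    show "AE v in lborel. ((\<lambda>x. w v * K x v) \<longlongrightarrow> w v * J v) at_top"
    proof (intro AE_I2)
      fix v
      show "((\<lambda>x. w v * K x v) \<longlongrightarrow> w v * J v) at_top"
      proof (cases "0 < v")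
        case True
        have "((\<lambda>x. K x v) \<longlongrightarrow> J v) at_top"
          unfolding K_def J_def ind
          by (rule tail_functional[OF True G_meas, where B = 1]) (use cont G True in \<open>auto simp: abs_le_iff intro: order_trans[of _ 0]\<close>)
        then show ?thesis by (intro tendsto_intros)
      qed (simp add: w_def)
    qed
  qed measurable
  moreover have "eventually (\<lambda>x. (LINT v|lborel. w v * K x v) = x powr (\<beta> - p) * (LINT s|D. s powr p * G (s / x))) at_top"
    using eventually_gt_at_top[of 0]
  proof eventually_elim
    case (elim x)
    define f where "f v s = w v * (x powr \<beta> * (if v < s / x then G (s / x) else 0))" for v s
    have "integral\<^sup>L D (\<lambda>s. x powr (\<beta> - p) * (s powr p * G (s / x))) = integral\<^sup>L lborel (\<lambda>v. w v * K x v)"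
    proof (rule P.integral_swap_nonneg(2)[of f])
      show "case_prod f \<in> borel_measurable (lborel \<Otimes>\<^sub>M D)"
        unfolding f_def by measurable
      show "0 \<le> f v s" for v s
        using G(1)[of "s / x"] p0 by (auto simp: f_def w_def split: split_indicator)
      show "AE v in lborel. has_bochner_integral D (f v) (w v * K x v)"
      proof (intro AE_I2)
        fix v
        show "has_bochner_integral D (f v) (w v * K x v)"
        proof (cases "0 < v")
          case True
          have "integrable D (\<lambda>s. if v < s / x then G (s / x) else 0)"
            unfolding scale[OF elim] using True elim by (intro truncated_expectation_le(1)[OF G_meas G]) auto
          then show ?thesis
            unfolding f_def K_def by (intro has_bochner_integral_mult_right) (auto simp: has_bochner_integral_iff)
        qed (simp add: f_def[abs_def] w_def has_bochner_integral_zero)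
      qed
      show "AE s in D. has_bochner_integral lborel (\<lambda>v. f v s) (x powr (\<beta> - p) * (s powr p * G (s / x)))"
        using pos
      proof eventually_elim
        case s: (elim s)
        have "has_bochner_integral lborel (\<lambda>v. (x powr \<beta> * G (s / x)) * (w v * (if v < s / x then 1 else 0))) ((x powr \<beta> * G (s / x)) * (s / x) powr p)"
          using elim s by (intro has_bochner_integral_mult_right w_layer) auto
        moreover have "(x powr \<beta> * G (s / x)) * (s / x) powr p = x powr (\<beta> - p) * (s powr p * G (s / x))"
          using elim s by (simp add: powr_divide powr_diff)
        moreover have "(\<lambda>v. (x powr \<beta> * G (s / x)) * (w v * (if v < s / x then 1 else 0))) = (\<lambda>v. f v s)"
          by (auto simp: f_def)
        ultimately show ?case by simp
      qed
    qed measurable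
    then show ?case by simp
  qed
  moreover have "(LINT v|lborel. w v * J v) = \<beta> / Gamma (1 - \<beta>) * (LINT u|lborel. indicator {0<..} u * (u powr (p - \<beta> - 1) * G u))"
  proof -
    define f where "f u v = levy_density \<beta> u * (if v < u then G u else 0) * w v" for u v
    have "(LINT v|lborel. w v * J v) = (LINT u|lborel. \<beta> / Gamma (1 - \<beta>) * (indicator {0<..} u * (u powr (p - \<beta> - 1) * G u)))"
    proof (rule lborel_pair.integral_swap_nonneg(2)[of f])
      show "case_prod f \<in> borel_measurable (lborel \<Otimes>\<^sub>M lborel)"
        unfolding f_def by measurable
      show "0 \<le> f u v" for u v
        using G(1)[of u] levy_density_nonneg[OF \<beta>, of u] p0 by (auto simp: f_def w_def split: split_indicator)
      show "AE u in lborel. has_bochner_integral lborel (f u) (\<beta> / Gamma (1 - \<beta>) * (indicator {0<..} u * (u powr (p - \<beta> - 1) * G u)))"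
      proof (intro AE_I2)
        fix u
        show "has_bochner_integral lborel (f u) (\<beta> / Gamma (1 - \<beta>) * (indicator {0<..} u * (u powr (p - \<beta> - 1) * G u)))"
        proof (cases "0 < u")
          case True
          have "has_bochner_integral lborel (\<lambda>v. (levy_density \<beta> u * G u) * (w v * (if v < u then 1 else 0))) ((levy_density \<beta> u * G u) * u powr p)"
            using True by (intro has_bochner_integral_mult_right w_layer) auto
          moreover have "u powr (- \<beta> - 1) * u powr p = u powr (p - \<beta> - 1)"
            by (simp add: algebra_simps flip: powr_add)
          then have "(levy_density \<beta> u * G u) * u powr p = \<beta> / Gamma (1 - \<beta>) * (indicator {0<..} u * (u powr (p - \<beta> - 1) * G u))"
            using True by (simp add: levy_density_def mult_ac)
          moreover have "(\<lambda>v. (levy_density \<beta> u * G u) * (w v * (if v < u then 1 else 0))) = f u"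
            by (auto simp: f_def)
          ultimately show ?thesis by simp
        qed (simp add: f_def[abs_def] levy_density_def has_bochner_integral_zero)
      qed
      show "AE v in lborel. has_bochner_integral lborel (\<lambda>u. f u v) (w v * J v)"
      proof (intro AE_I2)
        fix v
        show "has_bochner_integral lborel (\<lambda>u. f u v) (w v * J v)"
        proof (cases "0 < v")
          case True
          then have "has_bochner_integral lborel (\<lambda>u. levy_density \<beta> u * (if v < u then G u else 0) * w v) (J v * w v)"
            using levy_tail_integrable[OF G_meas True G(1,2)] unfolding J_def
            by (intro has_bochner_integral_mult_left) (auto simp: has_bochner_integral_iff)
          then show ?thesis by (simp add: f_def mult.commute)
        qed (simp add: f_def w_def has_bochner_integral_zero)
      qed
    qed measurable
    then show ?thesis by simp
  qed
  ultimately show ?thesis by (simp add: Lim_transform_eventually)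
qed

text \<open>The layer cake formula is applied in the logarithmic scale \<open>v = x powr (- \<theta>)\<close>; only the range
  \<open>- 1 < \<theta> < 0\<close> survives in the limit, and there the integrand tends to a constant.\<close>

lemma moment_asymp_critical:
  assumes G_meas [measurable]: "G \<in> borel_measurable borel"
    and G: "\<And>u. 0 < u \<Longrightarrow> 0 \<le> G u" "\<And>u. 0 < u \<Longrightarrow> G u \<le> 1" "\<And>u v. 0 < u \<Longrightarrow> u \<le> v \<Longrightarrow> G v \<le> G u"
    and G0: "(G \<longlongrightarrow> 1) (at_right 0)" and \<eta>: "0 < \<eta>" and decay: "\<And>u. 0 < u \<Longrightarrow> G u \<le> u powr (- \<eta>)"
  shows "((\<lambda>x. (LINT s|D. s powr \<beta> * G (s / x)) / ln x) \<longlongrightarrow> \<beta> / Gamma (1 - \<beta>)) at_top"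
proof -
  interpret P: pair_sigma_finite lborel D ..
  define C where "C = tail_const"
  have C: "1 \<le> C" by (simp add: C_def)
  define E where "E l \<theta> = (LINT s|D. (if exp (- l * \<theta>) < s then G (s / exp l) else 0))" for l \<theta>
  define k where "k l \<theta> = \<beta> * exp (- \<beta> * l * \<theta>) * E l \<theta>" for l \<theta>
  have [measurable]: "k l \<in> borel_measurable borel" for l
    unfolding k_def E_def by measurable
  have E_nonneg: "0 \<le> E l \<theta>" for l \<theta>
    unfolding E_def by (rule truncated_expectation_le(2)[OF G_meas G]) auto
  have k_nonneg: "0 \<le> k l \<theta>" for l \<theta>
    using E_nonneg \<beta> by (simp add: k_def)
  have E_le: "E l \<theta> \<le> G (exp (l * (- \<theta> - 1))) * prob {exp (- l * \<theta>)<..}" for l \<theta>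
  proof -
    have "exp (- l * \<theta>) / exp l = exp (l * (- \<theta> - 1))"
      by (simp add: algebra_simps flip: exp_diff)
    then show ?thesis
      using truncated_expectation_le(3)[OF G_meas G, of "exp l" "exp (- l * \<theta>)"] by (simp add: E_def)
  qed
  have E_le_prob: "E l \<theta> \<le> prob {exp (- l * \<theta>)<..}" for l \<theta>
    using E_le[of l \<theta>] G(1,2)[of "exp (l * (- \<theta> - 1))"] by (smt (verit) exp_gt_zero measure_nonneg mult_left_le_one_le)
  have k_le_exp: "k l \<theta> \<le> \<beta> * exp (- \<beta> * l * \<theta>)" for l \<theta>
    unfolding k_def using order_trans[OF E_le_prob prob_le_1] \<beta> by (intro mult_left_le) auto
  have tail: "exp (- \<beta> * l * \<theta>) * prob {exp (- l * \<theta>)<..} \<le> C" for l \<theta>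
  proof -
    have "exp (- \<beta> * l * \<theta>) * prob {exp (- l * \<theta>)<..} \<le> exp (- \<beta> * l * \<theta>) * (exp (- l * \<theta>) powr (- \<beta>) * C)"
      using tail_bound[of "exp (- l * \<theta>)"] by (intro mult_left_mono) (auto simp: C_def)
    also have "\<dots> = C"
      by (simp add: powr_def mult_ac flip: exp_add)
    finally show ?thesis .
  qed
  have k_le_G: "k l \<theta> \<le> C * G (exp (l * (- \<theta> - 1)))" for l \<theta>
  proof -
    have "k l \<theta> \<le> \<beta> * (exp (- \<beta> * l * \<theta>) * (G (exp (l * (- \<theta> - 1))) * prob {exp (- l * \<theta>)<..}))"
      unfolding k_def mult.assoc using E_le[of l \<theta>] \<beta> by (intro mult_left_mono) auto
    also have "\<dots> = \<beta> * (G (exp (l * (- \<theta> - 1))) * (exp (- \<beta> * l * \<theta>) * prob {exp (- l * \<theta>)<..}))"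
      by (simp add: mult_ac)
    also have "\<dots> \<le> 1 * (G (exp (l * (- \<theta> - 1))) * C)"
      using \<beta> G(1) C tail[of l \<theta>] by (intro mult_mono mult_nonneg_nonneg) auto
    finally show ?thesis by (simp add: mult.commute)
  qed
  have k_le_decay: "k l \<theta> \<le> C * exp (- \<eta> * (l * (- \<theta> - 1)))" for l \<theta>
  proof -
    have "G (exp (l * (- \<theta> - 1))) \<le> exp (- \<eta> * (l * (- \<theta> - 1)))"
      using decay[of "exp (l * (- \<theta> - 1))"] by (simp add: powr_def)
    then show ?thesis
      using k_le_G[of l \<theta>] C by (smt (verit) mult_left_mono)
  qed
  have k_le_C: "k l \<theta> \<le> C" for l \<theta>
    using k_le_G[of l \<theta>] G(2)[of "exp (l * (- \<theta> - 1))"] C by (smt (verit) exp_gt_zero mult_left_le)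
  \<comment> \<open>The function \<open>k l\<close> decays at rate \<beta> l to the right of 0 and
    at rate \<eta> l to the left of - 1, and is at most C in between. For l \<ge> 1 the slower rate
    \<kappa> dominates on both sides, and the factor exp \<kappa> in \<open>W\<close> covers the gap
    of length one.\<close>
  define \<kappa> where "\<kappa> = min \<beta> \<eta>"
  have \<kappa>: "0 < \<kappa>" "\<kappa> \<le> \<beta>" "\<kappa> \<le> \<eta>" using \<beta> \<eta> by (auto simp: \<kappa>_def)
  define h where "h \<theta> = indicator {0..} \<theta> * exp (- \<kappa> * \<theta>)" for \<theta> :: real
  have h_int: "integrable lborel h"
  proof -
    have "has_bochner_integral lborel h (exp (- \<kappa> * 0) / \<kappa>)"
      unfolding h_def using has_integral_exp_minus_to_infinity[OF \<kappa>(1), of 0]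
      by (intro has_bochner_integral_of_has_integral) auto
    then show ?thesis by (simp add: has_bochner_integral_iff)
  qed
  define W where "W \<theta> = C * exp \<kappa> * (h \<theta> + h (0 + (- 1) * \<theta>))" for \<theta>
  have W_int: "integrable lborel W"
    unfolding W_def using h_int lborel_integrable_real_affine[OF h_int, of "-1" 0]
    by (intro integrable_mult_right Bochner_Integration.integrable_add) auto
  have k_le_W: "k l \<theta> \<le> W \<theta>" if l: "1 \<le> l" for l \<theta>
  proof -
    have h_nonneg: "0 \<le> h \<theta>" for \<theta> by (simp add: h_def)
    have k1: "1 \<le> exp \<kappa>" using \<kappa> by simp
    consider "0 \<le> \<theta>" | "- 1 < \<theta>" "\<theta> < 0" | "\<theta> \<le> - 1" by linarith
    then show ?thesis
    proof cases
      case 1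
      have "k l \<theta> \<le> \<beta> * exp (- \<beta> * l * \<theta>)" by (rule k_le_exp)
      also have "\<dots> \<le> 1 * exp (- \<kappa> * \<theta>)"
      proof -
        have "\<kappa> * 1 \<le> \<beta> * l" using \<kappa> l \<beta> by (intro mult_mono) auto
        then have "\<kappa> * \<theta> \<le> \<beta> * l * \<theta>" using 1 by (intro mult_right_mono) auto
        then show ?thesis using \<beta> by (intro mult_mono) auto
      qed
      also have "\<dots> \<le> C * exp \<kappa> * h \<theta>"
        using 1 C k1 mult_mono[OF C k1] by (simp add: h_def)
      also have "\<dots> \<le> W \<theta>"
        unfolding W_def using C h_nonneg by (intro mult_left_mono) auto
      finally show ?thesis .
    next
      case 2
      have "k l \<theta> \<le> C" by (rule k_le_C)
      also have "\<dots> \<le> C * exp (\<kappa> * (1 + \<theta>))"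
        using 2 C \<kappa> by simp
      also have "\<dots> = C * exp \<kappa> * h (0 + (- 1) * \<theta>)"
        using 2 by (simp add: h_def ring_distribs exp_add)
      also have "\<dots> \<le> W \<theta>"
        unfolding W_def using C h_nonneg by (intro mult_left_mono) auto
      finally show ?thesis .
    next
      case 3
      have "k l \<theta> \<le> C * exp (- \<eta> * (l * (- \<theta> - 1)))" by (rule k_le_decay)
      also have "\<dots> \<le> C * exp (- \<kappa> * (1 * (- \<theta> - 1)))"
      proof -
        have "\<kappa> * (1 * (- \<theta> - 1)) \<le> \<eta> * (l * (- \<theta> - 1))"
          using 3 \<kappa> l by (intro mult_mono) auto
        then show ?thesis using C by simp
      qed
      also have "\<dots> = C * exp \<kappa> * h (0 + (- 1) * \<theta>)"
        using 3 by (simp add: h_def algebra_simps flip: exp_add)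
      also have "\<dots> \<le> W \<theta>"
        unfolding W_def using C h_nonneg by (intro mult_left_mono) auto
      finally show ?thesis .
    qed
  qed
  \<comment> \<open>For these \<theta> the threshold x^(- \<theta>) tends to infinity but is
    negligible against x. The profile is then almost 1 on the relevant range, and the truncated
    expectation behaves like the tail alone.\<close>
  have mid: "((\<lambda>l. k l \<theta>) \<longlongrightarrow> \<beta> / Gamma (1 - \<beta>)) at_top" if \<theta>: "- 1 < \<theta>" "\<theta> < 0" for \<theta>
  proof -
    define \<tau> where "\<tau> l = exp (- l * \<theta>) powr \<beta> * prob {exp (- l * \<theta>)<..}" for l
    have \<tau>: "(\<tau> \<longlongrightarrow> 1 / Gamma (1 - \<beta>)) at_top"
      unfolding \<tau>_def by (rule filterlim_compose[OF tail_asymp]) (use \<theta> in real_asymp)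
    have pw: "exp (- \<beta> * l * \<theta>) = exp (- l * \<theta>) powr \<beta>" for l
      by (simp add: powr_def)
    define g where "g l = G (exp (l * (- 1 - \<theta>) / 2))" for l
    have "filterlim (\<lambda>l. exp (l * (- 1 - \<theta>) / 2)) (at_right 0) at_top"
      using \<theta> by real_asymp
    then have g: "(g \<longlongrightarrow> 1) at_top"
      unfolding g_def by (rule filterlim_compose[OF G0])
    have e: "((\<lambda>l. C * exp (- \<beta> * l * (1 + \<theta>) / 2)) \<longlongrightarrow> 0) at_top"
      using \<theta> \<beta> by real_asymp
    show ?thesis
    proof (rule tendsto_sandwich)
      show "eventually (\<lambda>l. k l \<theta> \<le> \<beta> * \<tau> l) at_top"
        unfolding k_def pw \<tau>_def mult.assoc[of \<beta>] using \<beta>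
        by (intro always_eventually allI mult_left_mono E_le_prob) auto
      show "eventually (\<lambda>l. \<beta> * (g l * (\<tau> l - C * exp (- \<beta> * l * (1 + \<theta>) / 2))) \<le> k l \<theta>) at_top"
        using eventually_gt_at_top[of 0]
      proof eventually_elim
        case (elim l)
        \<comment> \<open>The cut z is the geometric mean of the threshold y and x = exp l. Up to z
          the profile is at least \<open>g l\<close>, which tends to 1, while the tail beyond z is
          negligible against the tail beyond y.\<close>
        define y z where "y = exp (- l * \<theta>)" and "z = exp (l * (1 - \<theta>) / 2)"
        have "- l * \<theta> \<le> l * (1 - \<theta>) / 2"
          using elim \<theta> mult_nonneg_nonneg[of l "1 + \<theta>"] by (simp add: algebra_simps)
        then have yz: "0 < y" "y \<le> z" "0 < z" by (auto simp: y_def z_def)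
        have gz: "g l = G (z / exp l)"
          unfolding g_def z_def by (simp add: field_simps flip: exp_diff)
        have g01: "0 \<le> g l" unfolding g_def by (rule G) simp
        have "g l * (prob {y<..} - prob {z<..}) = g l * prob ({y<..} - {z<..})"
          using yz by (subst finite_measure_Diff) auto
        also have "\<dots> = (LINT s|D. g l * indicator ({y<..} - {z<..}) s)"
          by simp
        also have "\<dots> \<le> E l \<theta>"
          unfolding E_def y_def[symmetric]
        proof (rule integral_mono)
          show "integrable D (\<lambda>s. g l * indicator ({y<..} - {z<..}) s)"
            by (intro integrable_mult_right integrable_real_indicator) (auto simp: less_top[symmetric])
          show "integrable D (\<lambda>s. if y < s then G (s / exp l) else 0)"
            by (rule truncated_expectation_le(1)[OF G_meas G]) (use yz in auto)
          show "g l * indicator ({y<..} - {z<..}) s \<le> (if y < s then G (s / exp l) else 0)" for s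
          proof (cases "y < s \<and> s \<le> z")
            case True
            then have "G (z / exp l) \<le> G (s / exp l)"
              using yz by (intro G(3) divide_right_mono) auto
            then show ?thesis using True by (simp add: gz)
          next
            case False
            then show ?thesis
              using G(1)[of "s / exp l"] yz by (auto split: split_indicator)
          qed
        qed
        finally have "\<beta> * (y powr \<beta> * (g l * (prob {y<..} - prob {z<..}))) \<le> k l \<theta>"
          unfolding k_def pw y_def[symmetric] mult.assoc[of \<beta>] using \<beta> by (intro mult_left_mono) auto
        moreover have "y powr \<beta> * prob {z<..} \<le> C * exp (- \<beta> * l * (1 + \<theta>) / 2)"
        proof -
          have "y powr \<beta> * prob {z<..} \<le> y powr \<beta> * (z powr (- \<beta>) * C)"
            using tail_bound[of z] yz by (intro mult_left_mono) (auto simp: C_def)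
          also have "y powr \<beta> * (z powr (- \<beta>) * C) = C * (exp (\<beta> * (- l * \<theta>)) * exp (- \<beta> * (l * (1 - \<theta>) / 2)))"
            by (simp add: y_def z_def powr_def)
          also have "exp (\<beta> * (- l * \<theta>)) * exp (- \<beta> * (l * (1 - \<theta>) / 2)) = exp (- \<beta> * l * (1 + \<theta>) / 2)"
            unfolding exp_add[symmetric] by (intro arg_cong[where f = exp]) (simp add: field_simps)
          finally show ?thesis .
        qed
        then have "g l * (\<tau> l - C * exp (- \<beta> * l * (1 + \<theta>) / 2)) \<le> g l * (\<tau> l - y powr \<beta> * prob {z<..})"
          using g01 by (intro mult_left_mono) auto
        then have "\<beta> * (g l * (\<tau> l - C * exp (- \<beta> * l * (1 + \<theta>) / 2))) \<le> \<beta> * (y powr \<beta> * (g l * (prob {y<..} - prob {z<..})))"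
          using \<beta> by (intro mult_left_mono) (auto simp: \<tau>_def y_def algebra_simps)
        ultimately show ?case by linarith
      qed
      show "((\<lambda>l. \<beta> * (g l * (\<tau> l - C * exp (- \<beta> * l * (1 + \<theta>) / 2)))) \<longlongrightarrow> \<beta> / Gamma (1 - \<beta>)) at_top"
        using tendsto_mult[OF tendsto_const[of \<beta>] tendsto_mult[OF g tendsto_diff[OF \<tau> e]]] by simp
      show "((\<lambda>l. \<beta> * \<tau> l) \<longlongrightarrow> \<beta> / Gamma (1 - \<beta>)) at_top"
        using tendsto_mult[OF tendsto_const[of \<beta>] \<tau>] by simp
    qed
  qed
  define f where "f \<theta> = \<beta> / Gamma (1 - \<beta>) * indicator {-1..0} \<theta>" for \<theta> :: real
  have "((\<lambda>l. integral\<^sup>L lborel (k l)) \<longlongrightarrow> integral\<^sup>L lborel f) at_top"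
  proof (rule integral_dominated_convergence_at_top[OF _ _ W_int])
    show "AE \<theta> in lborel. ((\<lambda>l. k l \<theta>) \<longlongrightarrow> f \<theta>) at_top"
      using AE_lborel_singleton[of "-1"] AE_lborel_singleton[of 0]
    proof eventually_elim
      case (elim \<theta>)
      then consider "0 < \<theta>" | "- 1 < \<theta>" "\<theta> < 0" | "\<theta> < - 1" by linarith
      then show ?case
      proof cases
        case 1
        have "((\<lambda>l. k l \<theta>) \<longlongrightarrow> 0) at_top"
        proof (rule tendsto_sandwich[OF _ _ tendsto_const])
          show "eventually (\<lambda>l. k l \<theta> \<le> \<beta> * exp (- \<beta> * l * \<theta>)) at_top" using k_le_exp by simp
          show "((\<lambda>l. \<beta> * exp (- \<beta> * l * \<theta>)) \<longlongrightarrow> 0) at_top" using 1 \<beta> by real_asymp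
        qed (use k_nonneg in simp)
        then show ?thesis using 1 by (simp add: f_def)
      next
        case 2
        then show ?thesis using mid[OF 2] by (simp add: f_def)
      next
        case 3
        have "((\<lambda>l. k l \<theta>) \<longlongrightarrow> 0) at_top"
        proof (rule tendsto_sandwich[OF _ _ tendsto_const])
          show "eventually (\<lambda>l. k l \<theta> \<le> C * exp (- \<eta> * (l * (- \<theta> - 1)))) at_top" using k_le_decay by simp
          show "((\<lambda>l. C * exp (- \<eta> * (l * (- \<theta> - 1)))) \<longlongrightarrow> 0) at_top" using 3 \<eta> by real_asymp
        qed (use k_nonneg in simp)
        then show ?thesis using 3 by (simp add: f_def)
      qed
    qed
    show "eventually (\<lambda>l. AE \<theta> in lborel. norm (k l \<theta>) \<le> W \<theta>) at_top"
      using eventually_ge_at_top[of 1]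
      by eventually_elim (use k_nonneg k_le_W in simp)
  qed (simp_all add: f_def[abs_def])
  also have "integral\<^sup>L lborel f = \<beta> / Gamma (1 - \<beta>)"
    by (simp add: f_def[abs_def])
  finally have "((\<lambda>x. integral\<^sup>L lborel (k (ln x))) \<longlongrightarrow> \<beta> / Gamma (1 - \<beta>)) at_top"
    by (rule filterlim_compose) (rule ln_at_top)
  moreover have "eventually (\<lambda>x. integral\<^sup>L lborel (k (ln x)) = (LINT s|D. s powr \<beta> * G (s / x)) / ln x) at_top"
    using eventually_gt_at_top[of 1]
  proof eventually_elim
    case (elim x)
    define l where "l = ln x"
    have l: "0 < l" "exp l = x" using elim by (auto simp: l_def)
    define f where "f \<theta> s = \<beta> * exp (- \<beta> * l * \<theta>) * (if exp (- l * \<theta>) < s then G (s / exp l) else 0)" for \<theta> s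
    have "integral\<^sup>L D (\<lambda>s. s powr \<beta> * G (s / x) / l) = integral\<^sup>L lborel (k l)"
    proof (rule P.integral_swap_nonneg(2)[of f])
      show "case_prod f \<in> borel_measurable (lborel \<Otimes>\<^sub>M D)"
        unfolding f_def by measurable
      show "0 \<le> f \<theta> s" for \<theta> s
      proof (cases "exp (- l * \<theta>) < s")
        case True
        then have "0 < s" using exp_gt_zero[of "- l * \<theta>"] by linarith
        then show ?thesis using G(1)[of "s / exp l"] \<beta> by (simp add: f_def)
      qed (simp add: f_def)
      show "AE \<theta> in lborel. has_bochner_integral D (f \<theta>) (k l \<theta>)"
        unfolding f_def k_def E_def
        using truncated_expectation_le(1)[OF G_meas G, of "exp l"]
        by (intro AE_I2 has_bochner_integral_mult_right) (auto simp: has_bochner_integral_iff)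
      show "AE s in D. has_bochner_integral lborel (\<lambda>\<theta>. f \<theta> s) (s powr \<beta> * G (s / x) / l)"
        using pos
      proof eventually_elim
        case s: (elim s)
        have "has_bochner_integral lborel (\<lambda>\<theta>. G (s / x) * (\<beta> * exp (- \<beta> * l * \<theta>) * (if exp (- l * \<theta>) < s then 1 else 0))) (G (s / x) * (s powr \<beta> / l))"
          by (intro has_bochner_integral_mult_right exp_layer_cake \<beta> l s)
        moreover have "(\<lambda>\<theta>. G (s / x) * (\<beta> * exp (- \<beta> * l * \<theta>) * (if exp (- l * \<theta>) < s then 1 else 0))) = (\<lambda>\<theta>. f \<theta> s)"
          by (auto simp: f_def l)
        ultimately show ?case by (simp add: mult.commute)
      qed
    qed measurable
    then show ?case by (simp add: l_def)
  qed
  ultimately show ?thesis by (rule Lim_transform_eventually)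
qed

end

section \<open>The law of the inverse subordinator\<close>

text \<open>Under the map exp (- x) the Laplace transform at the integers becomes the moment
  sequence of a law on the unit interval, and such a law is determined by its moments.\<close>

lemma Laplace_transform_unique:
  fixes M N :: "real measure"
  assumes M: "real_distribution M" "AE x in M. 0 \<le> x" and N: "real_distribution N" "AE x in N. 0 \<le> x"
    and eq: "\<And>r. 0 < r \<Longrightarrow> (LINT x|M. exp (- r * x)) = (LINT x|N. exp (- r * x))"
  shows "M = N"
proof -
  interpret M: real_distribution M by fact
  interpret N: real_distribution N by fact
  let ?e = "\<lambda>M. distr M borel (\<lambda>x. exp (- x))"
  have e: "real_distribution (?e M)" "real_distribution (?e N)"
    by (auto intro: M.real_distribution_distr N.real_distribution_distr)
  have power: "exp (- x) ^ j = exp (- real j * x)" for x :: real and j :: nat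
    by (simp flip: exp_of_nat_mult)
  have moments: "(LINT y|?e M. y ^ j) = (LINT y|?e N. y ^ j)" for j :: nat
  proof -
    have "(LINT x|M. exp (- real j * x)) = (LINT x|N. exp (- real j * x))"
      using eq[of "real j"] M.prob_space N.prob_space by (cases "j = 0") auto
    then show ?thesis by (simp add: integral_distr power)
  qed
  have supp: "AE y in ?e K. y \<in> {0..1}" if "sets K = sets borel" "AE x in K. 0 \<le> x" for K :: "real measure"
    using that measurable_cong_sets[OF that(1) refl, of borel]
    by (subst AE_distr_iff) (auto elim!: eventually_mono)
  \<comment> \<open>A constant sequence with the right moments converges weakly, so its
    characteristic function is already that of the limit.\<close>
  have "weak_conv_m (\<lambda>_. ?e M) (?e N)"
    by (rule weak_conv_m_of_moments) (use e moments M N supp in auto)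
  then have "char (?e M) t = char (?e N) t" for t
    using levy_continuity1[OF e, of t] by (simp add: LIMSEQ_const_iff)
  then have "?e M = ?e N"
    by (intro Levy_uniqueness e) auto
  then have "distr (?e M) borel (\<lambda>y. - ln y) = distr (?e N) borel (\<lambda>y. - ln y)"
    by simp
  then show ?thesis
    by (simp add: distr_distr o_def distr_id2)
qed

text \<open>Strict tails are right-continuous in the threshold. This lets thresholds q > a decrease
  to a in the comparison of interlaced tails.\<close>

lemma (in real_distribution) prob_greaterThan_le:
  assumes "\<And>q. a < q \<Longrightarrow> prob {q<..} \<le> c"
  shows "prob {a<..} \<le> c"
proof -
  have "(\<lambda>k. prob {a + 1 / real (Suc k)<..}) \<longlonglongrightarrow> prob (\<Union>k. {a + 1 / real (Suc k)<..})"
    by (intro finite_Lim_measure_incseq) (auto simp: incseq_def field_simps intro: order.strict_trans1[rotated])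
  moreover have "(\<Union>k. {a + 1 / real (Suc k)<..}) = {a<..}"
  proof (intro equalityI subsetI)
    fix x assume "x \<in> {a<..}"
    then obtain k where "1 / real (Suc k) < x - a"
      using nat_approx_posE[of "x - a"] by auto
    then show "x \<in> (\<Union>k. {a + 1 / real (Suc k)<..})"
      by (auto intro!: exI[of _ k])
  next
    fix x assume "x \<in> (\<Union>k. {a + 1 / real (Suc k)<..})"
    then obtain k where "a + 1 / real (Suc k) < x" by auto
    moreover have "0 < 1 / real (Suc k)" by simp
    ultimately have "a < x" by linarith
    then show "x \<in> {a<..}" by simp
  qed
  ultimately have "(\<lambda>k. prob {a + 1 / real (Suc k)<..}) \<longlonglongrightarrow> prob {a<..}" by simp
  then show ?thesis
    by (rule LIMSEQ_le_const2) (use assms in auto)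
qed

section \<open>Scaling of the subordinator and its inverse at a fixed time\<close>

locale subordinator =
  fixes \<Omega> :: "'w measure" and \<beta> :: real and S :: "real \<Rightarrow> 'w \<Rightarrow> real"
  assumes \<beta>: "0 < \<beta>" "\<beta> < 1" and S: "stable_subordinator \<Omega> \<beta> S"
begin

sublocale prob_space \<Omega>
  using S by (simp add: stable_subordinator_def levy_process_def)

lemma S_measurable: "0 \<le> q \<Longrightarrow> S q \<in> borel_measurable \<Omega>"
  using S by (simp add: stable_subordinator_def levy_process_def)

lemma S_paths: "AE \<omega> in \<Omega>. mono_on {0..} (\<lambda>t. S t \<omega>) \<and> (\<forall>t\<ge>0. 0 \<le> S t \<omega>)"
  using S by (simp add: stable_subordinator_def)

lemma S_nonneg: "0 \<le> q \<Longrightarrow> AE \<omega> in \<Omega>. 0 \<le> S q \<omega>"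
  using S_paths by eventually_elim auto

lemma S_laplace: "0 < r \<Longrightarrow> 0 \<le> q \<Longrightarrow> (LINT \<omega>|\<Omega>. exp (- r * S q \<omega>)) = exp (- q * r powr \<beta>)"
  using S by (simp add: stable_subordinator_def)

definition law :: "real measure" where
  "law = distr \<Omega> borel (S 1)"

lemma stable_law_law: "stable_law law \<beta>"
proof -
  note [measurable] = S_measurable[of 1]
  interpret L: real_distribution law
    unfolding law_def by (rule real_distribution_distr) simp
  show ?thesis
  proof unfold_locales
    show "AE x in law. 0 \<le> x"
      unfolding law_def using S_nonneg[of 1] by (subst AE_distr_iff) auto
    show "(LINT x|law. exp (- r * x)) = exp (- (r powr \<beta>))" if "0 < r" for r
      unfolding law_def using S_laplace[OF that, of 1] by (subst integral_distr) auto
  qed (use \<beta> in auto)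
qed

sublocale L: stable_law law \<beta>
  by (rule stable_law_law)

text \<open>Self-similarity of the marginals is visible in the transform: q r^\<beta> is the
  \<beta>-th power of r q^(1 / \<beta>).\<close>

lemma law_scaling:
  assumes q: "0 < q"
  shows "distr \<Omega> borel (S q) = distr law borel (\<lambda>s. q powr (1 / \<beta>) * s)"
proof (rule Laplace_transform_unique)
  note [measurable] = S_measurable[of q]
  note q0 = less_imp_le[OF q]
  show "real_distribution (distr \<Omega> borel (S q))"
    by (rule real_distribution_distr) (simp add: S_measurable q0)
  show "real_distribution (distr law borel (\<lambda>s. q powr (1 / \<beta>) * s))"
    by (rule L.real_distribution_distr) simp
  show "AE x in distr \<Omega> borel (S q). 0 \<le> x"
    using S_nonneg[OF q0] S_measurable[OF q0] by (subst AE_distr_iff) auto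
  show "AE x in distr law borel (\<lambda>s. q powr (1 / \<beta>) * s). 0 \<le> x"
    using L.nonneg by (subst AE_distr_iff) (auto elim!: eventually_mono)
  show "(LINT x|distr \<Omega> borel (S q). exp (- r * x)) = (LINT x|distr law borel (\<lambda>s. q powr (1 / \<beta>) * s). exp (- r * x))"
    if r: "0 < r" for r
  proof -
    have "(LINT x|distr law borel (\<lambda>s. q powr (1 / \<beta>) * s). exp (- r * x)) = (LINT s|law. exp (- (r * q powr (1 / \<beta>)) * s))"
      by (subst integral_distr) (auto simp: mult_ac)
    also have "\<dots> = exp (- ((r * q powr (1 / \<beta>)) powr \<beta>))"
      using r q by (intro L.laplace) simp
    also have "(r * q powr (1 / \<beta>)) powr \<beta> = q * r powr \<beta>"
      using r q \<beta> by (simp add: powr_mult powr_powr)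
    finally show ?thesis
      using S_laplace[OF r q0] S_measurable[OF q0] by (subst integral_distr) auto
  qed
qed

text \<open>By Markov's inequality the event that S stays below t up to time k has probability at
  most exp (t - k). Integer times suffice and keep the event measurable.\<close>

lemma S_unbounded: "AE \<omega> in \<Omega>. \<exists>k::nat. t < S (real k) \<omega>"
proof -
  note [measurable] = S_measurable
  define Z where "Z = {\<omega> \<in> space \<Omega>. \<forall>k::nat. S (real k) \<omega> \<le> t}"
  have [measurable]: "Z \<in> sets \<Omega>"
    unfolding Z_def by measurable
  have "prob Z \<le> exp (t - real k)" for k :: nat
  proof -
    have int: "integrable \<Omega> (\<lambda>\<omega>. exp (- 1 * S (real k) \<omega>))"
      using S_nonneg[of "real k"] by (intro integrable_const_bound[where B = 1]) (auto elim!: eventually_mono)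
    have "prob Z = (LINT \<omega>|\<Omega>. indicator Z \<omega>)"
      by simp
    also have "\<dots> \<le> (LINT \<omega>|\<Omega>. exp t * exp (- 1 * S (real k) \<omega>))"
    proof (rule integral_mono)
      show "integrable \<Omega> (indicator Z :: 'w \<Rightarrow> real)"
        by (intro integrable_real_indicator) (auto simp: less_top[symmetric])
      show "integrable \<Omega> (\<lambda>\<omega>. exp t * exp (- 1 * S (real k) \<omega>))"
        using int by (rule integrable_mult_right)
      show "indicator Z \<omega> \<le> exp t * exp (- 1 * S (real k) \<omega>)" for \<omega>
        by (auto simp: Z_def exp_add[symmetric] split: split_indicator)
    qed
    also have "\<dots> = exp t * exp (- real k)"
      using S_laplace[of 1 "real k"] by (subst integral_mult_right_zero) simp
    also have "\<dots> = exp (t - real k)"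
      by (simp flip: exp_add)
    finally show ?thesis .
  qed
  moreover have "(\<lambda>k. exp (t - real k)) \<longlonglongrightarrow> 0"
    by real_asymp
  ultimately have "prob Z \<le> 0"
    by (intro LIMSEQ_le_const) auto
  then have "prob Z = 0" by (simp add: measure_le_0_iff)
  then have "AE \<omega> in \<Omega>. \<omega> \<notin> Z"
    by (subst AE_iff_measurable[OF _ refl]) (auto simp: emeasure_eq_measure Z_def)
  then show ?thesis
    using AE_space by eventually_elim (auto simp: Z_def not_le)
qed

text \<open>On the paths described here the infimum defining the inverse is over a non-empty set.\<close>

lemma right_inverse_less_iff:
  "AE \<omega> in \<Omega>. 0 \<le> right_inverse S t \<omega> \<and> (\<forall>a. right_inverse S t \<omega> < a \<longleftrightarrow> (\<exists>q\<ge>0. q < a \<and> t < S q \<omega>)) \<and>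
    mono_on {0..} (\<lambda>t. S t \<omega>)"
  using S_paths S_unbounded[of t]
proof eventually_elim
  case (elim \<omega>)
  then obtain k :: nat where k: "t < S (real k) \<omega>" by blast
  let ?A = "{s. 0 \<le> s \<and> t < S s \<omega>}"
  have ne: "?A \<noteq> {}" using k by (auto intro!: exI[of _ "real k"])
  have bdd: "bdd_below ?A" by (auto intro!: bdd_belowI[of _ 0])
  have "0 \<le> right_inverse S t \<omega>"
    unfolding right_inverse_def using ne by (intro cInf_greatest) auto
  then show ?case
    using elim cInf_less_iff[OF ne bdd] by (auto simp: right_inverse_def)
qed

text \<open>Almost surely paths are monotone, so a time q < a with t < S q may be moved up to a
  rational one. The event thus differs from a countable union of measurable events only within a
  null set, whence the completion.\<close>

lemma right_inverse_measurable: "right_inverse S t \<in> borel_measurable (completion \<Omega>)"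
proof (rule borel_measurable_iff_less[THEN iffD2], intro allI)
  fix a
  let ?Q = "\<Union>q\<in>{q \<in> \<rat>. 0 \<le> q \<and> q < a}. {\<omega> \<in> space \<Omega>. t < S q \<omega>}"
  have Q: "?Q \<in> sets (completion \<Omega>)"
  proof (intro sets.countable_UN'')
    show "countable {q \<in> \<rat>. 0 \<le> q \<and> q < a}"
      by (rule countable_subset[OF _ countable_rat]) auto
    show "{\<omega> \<in> space \<Omega>. t < S q \<omega>} \<in> sets (completion \<Omega>)" if "q \<in> {q \<in> \<rat>. 0 \<le> q \<and> q < a}" for q
      using that S_measurable[of q] by (intro sets_completionI_sets) simp
  qed
  have "AE \<omega> in \<Omega>. \<omega> \<in> ?Q \<longleftrightarrow> \<omega> \<in> {\<omega> \<in> space (completion \<Omega>). right_inverse S t \<omega> < a}"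
    using right_inverse_less_iff[of t] AE_space
  proof eventually_elim
    case (elim \<omega>)
    have "\<exists>q\<in>\<rat>. 0 \<le> q \<and> q < a \<and> t < S q \<omega>" if q: "0 \<le> q" "q < a" "t < S q \<omega>" for q
    proof -
      obtain r where r: "r \<in> \<rat>" "q < r" "r < a"
        using Rats_dense_in_real[OF q(2)] by blast
      moreover have "S q \<omega> \<le> S r \<omega>"
        using elim r q by (auto intro: mono_onD)
      ultimately show ?thesis using q by force
    qed
    then show ?case using elim by auto
  qed
  then have "AE \<omega> in completion \<Omega>. \<omega> \<in> ?Q \<longleftrightarrow> \<omega> \<in> {\<omega> \<in> space (completion \<Omega>). right_inverse S t \<omega> < a}"
    by (rule AE_completion)
  then show "{\<omega> \<in> space (completion \<Omega>). right_inverse S t \<omega> < a} \<in> sets (completion \<Omega>)"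
    by (rule completion.in_sets_AE) (use Q in auto)
qed

text \<open>Almost surely the inverse exceeds q only if S at time q is at most t, and the latter
  forces the inverse to be at least q. By scaling, the event in the middle has the probability that
  t^\<beta> S_1^(- \<beta>) is at least q. The tails of the two laws are thus interlaced, and
  letting q decrease to a makes the strict tails equal.\<close>

lemma inverse_law_eq:
  assumes t: "0 < t"
  shows "inverse_law \<Omega> S t = distr law borel (\<lambda>s. t powr \<beta> * s powr (- \<beta>))"
proof -
  note [measurable] = right_inverse_measurable[of t]
  interpret C: prob_space "completion \<Omega>" by (rule prob_space_completion)
  let ?N = "inverse_law \<Omega> S t" and ?N' = "distr law borel (\<lambda>s. t powr \<beta> * s powr (- \<beta>))"
  interpret N: real_distribution ?N
    unfolding inverse_law_def by (rule C.real_distribution_distr) measurable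
  interpret N': real_distribution ?N'
    by (rule L.real_distribution_distr) measurable
  have N_eq: "N.prob A = C.prob {\<omega> \<in> space \<Omega>. right_inverse S t \<omega> \<in> A}" if "A \<in> sets borel" for A
    using that by (auto simp: inverse_law_def measure_distr vimage_def Int_def conj_commute)
  have N'_eq: "N'.prob A = L.prob {s. t powr \<beta> * s powr (- \<beta>) \<in> A}" if "A \<in> sets borel" for A
    using that by (auto simp: measure_distr vimage_def)
  have AE_inv: "AE \<omega> in completion \<Omega>. 0 \<le> right_inverse S t \<omega> \<and> (\<forall>a. right_inverse S t \<omega> < a \<longleftrightarrow> (\<exists>q\<ge>0. q < a \<and> t < S q \<omega>)) \<and> mono_on {0..} (\<lambda>t. S t \<omega>)"
    by (rule AE_completion[OF right_inverse_less_iff])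
  have meas_S: "{\<omega> \<in> space \<Omega>. S q \<omega> \<le> t} \<in> sets \<Omega>" if "0 \<le> q" for q
    using S_measurable[OF that] by simp
  have mid: "N'.prob {q..} = C.prob {\<omega> \<in> space \<Omega>. S q \<omega> \<le> t}" if q: "0 < q" for q
  proof -
    note q0 = less_imp_le[OF q]
    have "C.prob {\<omega> \<in> space \<Omega>. S q \<omega> \<le> t} = prob {\<omega> \<in> space \<Omega>. S q \<omega> \<le> t}"
      by (rule measure_completion[OF meas_S[OF q0]])
    also have "\<dots> = measure (distr \<Omega> borel (S q)) {..t}"
      using S_measurable[OF q0] by (subst measure_distr) (auto simp: vimage_def Int_def conj_commute)
    also have "\<dots> = L.prob {s. q powr (1 / \<beta>) * s \<le> t}"
      unfolding law_scaling[OF q] by (subst measure_distr) (auto simp: vimage_def)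
    also have "\<dots> = L.prob {s. t powr \<beta> * s powr (- \<beta>) \<in> {q..}}"
    proof (rule L.finite_measure_eq_AE)
      show "AE s in law. s \<in> {s. q powr (1 / \<beta>) * s \<le> t} \<longleftrightarrow> s \<in> {s. t powr \<beta> * s powr (- \<beta>) \<in> {q..}}"
        using L.pos
      proof eventually_elim
        case (elim s)
        have "q powr (1 / \<beta>) * s \<le> t \<longleftrightarrow> (q powr (1 / \<beta>) * s) powr \<beta> \<le> t powr \<beta>"
          using \<beta> t elim powr_mono2[of \<beta> "q powr (1 / \<beta>) * s" t] powr_less_mono2[of \<beta> t "q powr (1 / \<beta>) * s"]
          by (meson less_imp_le mult_nonneg_nonneg not_le powr_ge_zero)
        also have "(q powr (1 / \<beta>) * s) powr \<beta> = q * s powr \<beta>"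
          using q elim \<beta> by (simp add: powr_mult powr_powr)
        finally show ?case
          using elim by (simp add: powr_minus field_simps)
      qed
    qed auto
    finally show ?thesis by (simp add: N'_eq)
  qed
  have upper: "N.prob {q<..} \<le> N'.prob {q..}" if q: "0 < q" for q
    unfolding mid[OF q] N_eq[OF borel_open[OF open_greaterThan]]
  proof (rule C.finite_measure_mono_AE)
    show "AE \<omega> in completion \<Omega>. \<omega> \<in> {\<omega> \<in> space \<Omega>. right_inverse S t \<omega> \<in> {q<..}} \<longrightarrow> \<omega> \<in> {\<omega> \<in> space \<Omega>. S q \<omega> \<le> t}"
      using AE_inv
    proof eventually_elim
      case (elim \<omega>)
      have "right_inverse S t \<omega> \<le> q" if "t < S q \<omega>"
        by (rule field_le_epsilon, rule less_imp_le) (use elim that q in \<open>auto intro!: exI[of _ q]\<close>)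
      then show ?case by force
    qed
  qed (use meas_S q in \<open>auto intro!: sets_completionI_sets\<close>)
  have lower: "N'.prob {q..} \<le> N.prob {q..}" if q: "0 < q" for q
    unfolding mid[OF q] N_eq[OF borel_closed[OF closed_atLeast]]
  proof (rule C.finite_measure_mono_AE)
    show "AE \<omega> in completion \<Omega>. \<omega> \<in> {\<omega> \<in> space \<Omega>. S q \<omega> \<le> t} \<longrightarrow> \<omega> \<in> {\<omega> \<in> space \<Omega>. right_inverse S t \<omega> \<in> {q..}}"
      using AE_inv
    proof eventually_elim
      case (elim \<omega>)
      have "t < S q \<omega>" if "right_inverse S t \<omega> < q"
      proof -
        obtain r where "0 \<le> r" "r < q" "t < S r \<omega>"
          using elim \<open>right_inverse S t \<omega> < q\<close> by blast
        moreover have "S r \<omega> \<le> S q \<omega>"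
          using elim \<open>0 \<le> r\<close> \<open>r < q\<close> by (auto intro: mono_onD)
        ultimately show ?thesis by simp
      qed
      then show ?case by force
    qed
    show "{\<omega> \<in> space \<Omega>. right_inverse S t \<omega> \<in> {q..}} \<in> sets (completion \<Omega>)"
      using measurable_sets[OF right_inverse_measurable[of t], of "{q..}"]
      by (simp add: vimage_def Int_def conj_commute)
  qed
  have eq: "N.prob {a<..} = N'.prob {a<..}" if a: "0 \<le> a" for a
  proof (rule antisym)
    show "N.prob {a<..} \<le> N'.prob {a<..}"
    proof (rule N.prob_greaterThan_le)
      fix q assume "a < q"
      then have "N'.prob {q..} \<le> N'.prob {a<..}"
        by (intro N'.finite_measure_mono) auto
      with upper[of q] \<open>a < q\<close> a show "N.prob {q<..} \<le> N'.prob {a<..}" by simp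
    qed
    show "N'.prob {a<..} \<le> N.prob {a<..}"
    proof (rule N'.prob_greaterThan_le)
      fix q assume "a < q"
      then have "N.prob {q..} \<le> N.prob {a<..}" "N'.prob {q<..} \<le> N'.prob {q..}"
        by (auto intro!: N.finite_measure_mono N'.finite_measure_mono)
      with lower[of q] \<open>a < q\<close> a show "N'.prob {q<..} \<le> N.prob {a<..}" by simp
    qed
  qed
  have neg: "N.prob {a<..} = 1" "N'.prob {a<..} = 1" if "a < 0" for a
  proof -
    have "AE x in ?N. x \<in> {a<..}"
      unfolding inverse_law_def using AE_inv that by (subst AE_distr_iff) (auto elim!: eventually_mono)
    then show "N.prob {a<..} = 1"
      by (subst N.prob_eq_1) auto
    have "AE x in ?N'. x \<in> {a<..}"
      using that by (subst AE_distr_iff) (auto intro!: AE_I2 less_le_trans[OF that])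
    then show "N'.prob {a<..} = 1"
      by (subst N'.prob_eq_1) auto
  qed
  show ?thesis
  proof (rule measure_eqI_lessThan)
    show "emeasure ?N {x<..} = emeasure ?N' {x<..}" for x
      using eq[of x] neg[of x] by (cases "0 \<le> x") (auto simp: N.emeasure_eq_measure N'.emeasure_eq_measure)
  qed (auto simp: less_top[symmetric])
qed

end

section \<open>Asymptotics of the time-changed density\<close>

text \<open>If the quotient depends on the points through A only, a one-variable limit carries over
  to the filter generated by A. The predicate P discards values of A at which the identity may fail,
  such as zeros of a logarithm.\<close>

lemma asymptotically_equalI:
  assumes h: "(h \<longlongrightarrow> 1) L"
    and eq: "\<And>t x y. 0 < t \<Longrightarrow> x \<noteq> y \<Longrightarrow> P (A t x y) \<Longrightarrow> f t x y / g t x y = h (A t x y)"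
    and P: "eventually P L"
  shows "asymptotically_equal A L f g"
  unfolding asymptotically_equal_def
proof (rule Lim_transform_eventually)
  let ?F = "inf (filtercomap (\<lambda>(t, x, y). A t x y) L) (principal {(t, x, y). 0 < t \<and> x \<noteq> y})"
  have A: "filterlim (\<lambda>(t, x, y). A t x y) L ?F"
    by (rule filterlim_mono[OF filterlim_filtercomap order_refl inf_le1])
  show "((\<lambda>(t, x, y). h (A t x y)) \<longlongrightarrow> 1) ?F"
    using filterlim_compose[OF h A] by (simp add: case_prod_unfold)
  have "eventually (\<lambda>(t, x, y). P (A t x y)) ?F"
    using filterlim_iff[THEN iffD1, OF A, rule_format, OF P] by (simp add: case_prod_unfold)
  moreover have "eventually (\<lambda>(t, x, y). 0 < t \<and> x \<noteq> y) ?F"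
    by (rule filter_leD[OF inf_le2]) (simp add: eventually_principal)
  ultimately show "eventually (\<lambda>z. (case z of (t, x, y) \<Rightarrow> h (A t x y)) = (case z of (t, x, y) \<Rightarrow> f t x y / g t x y)) ?F"
    by eventually_elim (use eq P in auto)
qed

text \<open>At time r = t^\<beta> s^(- \<beta>) the argument of F is C2 \<rho> r^(- 1 / \<alpha>),
  which is (s / \<xi>)^(\<beta> / \<alpha>) for \<xi> = (C2 \<rho>)^(- \<alpha> / \<beta>) t. This
  identity is the origin of both G and the scaling variable; the prefactor r^(- n / \<alpha>)
  supplies the powers of t and s.\<close>

lemma (in subordinator) time_changed_density_eq:
  fixes F G :: "real \<Rightarrow> real" and x y :: "'m::metric_space"
  assumes t: "0 < t" and xy: "x \<noteq> y" and pos: "0 < \<alpha>" "0 < C2"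
    and p: "\<And>s. 0 < s \<Longrightarrow> p s x y = C1 / s powr (n / \<alpha>) * F (C2 * (dist x y / s powr (1 / \<alpha>)))"
    and G_meas [measurable]: "G \<in> borel_measurable borel" and G: "\<And>u. 0 < u \<Longrightarrow> G u = F (u powr (\<beta> / \<alpha>))"
  shows "time_changed_density \<Omega> S p t x y = C1 * t powr (- (\<beta> * n / \<alpha>)) *
    (LINT s|law. s powr (\<beta> * n / \<alpha>) * G (s / (C2 powr (- \<alpha> / \<beta>) * (dist x y powr (- \<alpha> / \<beta>) * t))))"
proof -
  define \<xi> where "\<xi> = C2 powr (- \<alpha> / \<beta>) * (dist x y powr (- \<alpha> / \<beta>) * t)"
  have \<xi>: "0 < \<xi>" using t xy pos by (simp add: \<xi>_def)
  define k where "k r = indicator {0<..} r * (C1 * r powr (- (n / \<alpha>)) * G (t * r powr (- 1 / \<beta>) / \<xi>))" for r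
  have [measurable]: "k \<in> borel_measurable borel"
    unfolding k_def by measurable
  have k: "indicator {0<..} r *\<^sub>R p r x y = k r" for r
  proof (cases "0 < r")
    case True
    have "(t * r powr (- 1 / \<beta>) / \<xi>) powr (\<beta> / \<alpha>) = t powr (\<beta> / \<alpha>) * r powr (- 1 / \<alpha>) * \<xi> powr (- (\<beta> / \<alpha>))"
      using t True \<xi> \<beta> pos by (simp add: powr_divide powr_mult powr_powr powr_minus_divide)
    also have "\<xi> powr (- (\<beta> / \<alpha>)) = C2 * (dist x y * t powr (- (\<beta> / \<alpha>)))"
      unfolding \<xi>_def using t xy pos \<beta> by (simp add: powr_mult powr_powr)
    also have "t powr (\<beta> / \<alpha>) * r powr (- 1 / \<alpha>) * (C2 * (dist x y * t powr (- (\<beta> / \<alpha>)))) = (t powr (\<beta> / \<alpha>) * t powr (- (\<beta> / \<alpha>))) * (C2 * (dist x y * r powr (- 1 / \<alpha>)))"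
      by (simp add: mult_ac)
    also have "t powr (\<beta> / \<alpha>) * t powr (- (\<beta> / \<alpha>)) = 1"
      using t by (simp flip: powr_add)
    finally have "(t * r powr (- 1 / \<beta>) / \<xi>) powr (\<beta> / \<alpha>) = C2 * (dist x y / r powr (1 / \<alpha>))"
      using True by (simp add: powr_minus_divide)
    moreover have "0 < t * r powr (- 1 / \<beta>) / \<xi>"
      using t True \<xi> by simp
    ultimately show ?thesis
      using True by (simp add: k_def G p powr_minus_divide)
  qed (simp add: k_def)
  have "time_changed_density \<Omega> S p t x y = (LINT r|distr law borel (\<lambda>s. t powr \<beta> * s powr (- \<beta>)). k r)"
    by (simp only: time_changed_density_def set_lebesgue_integral_def inverse_law_eq[OF t] k)
  also have "\<dots> = (LINT s|law. k (t powr \<beta> * s powr (- \<beta>)))"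
    by (subst integral_distr) auto
  also have "\<dots> = (LINT s|law. C1 * t powr (- (\<beta> * n / \<alpha>)) * (s powr (\<beta> * n / \<alpha>) * G (s / \<xi>)))"
  proof (rule integral_cong_AE)
    show "AE s in law. k (t powr \<beta> * s powr (- \<beta>)) = C1 * t powr (- (\<beta> * n / \<alpha>)) * (s powr (\<beta> * n / \<alpha>) * G (s / \<xi>))"
      using L.pos
    proof eventually_elim
      case (elim s)
      have "(t powr \<beta> * s powr (- \<beta>)) powr (- 1 / \<beta>) = t powr (- 1) * s"
        using t elim \<beta> by (simp add: powr_mult powr_powr del: powr_neg_one)
      then have "t * (t powr \<beta> * s powr (- \<beta>)) powr (- 1 / \<beta>) = s"
        using t by (simp add: powr_minus_divide)
      moreover have "(t powr \<beta> * s powr (- \<beta>)) powr (- (n / \<alpha>)) = t powr (- (\<beta> * n / \<alpha>)) * s powr (\<beta> * n / \<alpha>)"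
        using t elim by (simp add: powr_mult powr_powr)
      ultimately show ?case
        using t elim by (simp add: k_def)
    qed
  qed measurable
  finally show ?thesis by (simp add: \<xi>_def)
qed

text \<open>Under u = r^(\<alpha> / \<beta>) the measure u^(\<beta> n / \<alpha> - \<beta> - 1) du
  becomes (\<alpha> / \<beta>) r^(n - \<alpha> - 1) dr. This carries the Levy integral of G to the
  integral of F in the final constant.\<close>

lemma substitution_powr_integral:
  fixes F G :: "real \<Rightarrow> real"
  assumes \<alpha>: "0 < \<alpha>" and \<beta>: "0 < \<beta>"
    and F: "\<And>r. 0 < r \<Longrightarrow> 0 \<le> F r" and G: "\<And>r. 0 < r \<Longrightarrow> G (r powr (\<alpha> / \<beta>)) = F r"
    and cont: "\<And>u. 0 < u \<Longrightarrow> isCont G u"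
    and int: "set_integrable lborel {0<..} (\<lambda>r. r powr (n - \<alpha> - 1) * F r)"
  shows "integrable lborel (\<lambda>u. indicator {0<..} u * (u powr (\<beta> * n / \<alpha> - \<beta> - 1) * G u))"
    and "\<beta> * (LINT u|lborel. indicator {0<..} u * (u powr (\<beta> * n / \<alpha> - \<beta> - 1) * G u)) = \<alpha> * (LBINT r:{0<..}. r powr (n - \<alpha> - 1) * F r)"
proof -
  define g where "g r = r powr (\<alpha> / \<beta>)" for r :: real
  define g' where "g' r = \<alpha> / \<beta> * r powr (\<alpha> / \<beta> - 1)" for r :: real
  define f where "f u = u powr (\<beta> * n / \<alpha> - \<beta> - 1) * G u" for u :: real
  have fg: "f (g r) * g' r = \<alpha> / \<beta> * (r powr (n - \<alpha> - 1) * F r)" if "0 < r" for r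
  proof -
    have "(r powr (\<alpha> / \<beta>)) powr (\<beta> * n / \<alpha> - \<beta> - 1) * r powr (\<alpha> / \<beta> - 1) = r powr (n - \<alpha> - 1)"
    proof -
      have "\<alpha> / \<beta> * (\<beta> * n / \<alpha> - \<beta> - 1) + (\<alpha> / \<beta> - 1) = n - \<alpha> - 1"
        using \<alpha> \<beta> by (simp add: field_simps)
      then show ?thesis
        by (simp only: powr_powr powr_add[symmetric])
    qed
    then show ?thesis
      using G[OF that] by (simp add: f_def g_def g'_def mult_ac)
  qed
  have eint: "set_integrable lborel (einterval 0 \<infinity>) (\<lambda>r. f (g r) * g' r)"
  proof -
    have "set_integrable lborel {0<..} (\<lambda>r. \<alpha> / \<beta> * (r powr (n - \<alpha> - 1) * F r))"
      using int by (rule set_integrable_mult_right)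
    then show ?thesis
      unfolding zero_ereal_def einterval_eq
      by (rule set_integrable_cong[THEN iffD1, OF refl refl, rotated]) (use fg in auto)
  qed
  have deriv: "DERIV g r :> g' r" if "0 < ereal r" "ereal r < \<infinity>" for r
    using that unfolding g_def[abs_def] g'_def by (auto intro!: derivative_eq_intros)
  have g_pos: "0 < g r" if "0 < r" for r using that by (simp add: g_def)
  have A: "((ereal \<circ> g \<circ> real_of_ereal) \<longlongrightarrow> 0) (at_right 0)"
  proof -
    have "(g \<longlongrightarrow> 0) (at_right 0)"
      unfolding g_def using \<alpha> \<beta> by real_asymp
    then show ?thesis
      unfolding zero_ereal_def by (simp add: ereal_tendsto_simps)
  qed
  have B: "((ereal \<circ> g \<circ> real_of_ereal) \<longlongrightarrow> \<infinity>) (at_left \<infinity>)"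
  proof -
    have "filterlim g at_top at_top"
      unfolding g_def using \<alpha> \<beta> by real_asymp
    then show ?thesis
      by (simp add: ereal_tendsto_simps)
  qed
  have *: "set_integrable lborel (einterval 0 \<infinity>) f" "(LBINT x=0..\<infinity>. f x) = (LBINT x=0..\<infinity>. f (g x) * g' x)"
  proof -
    have contf: "isCont f (g r)" if "0 < ereal r" "ereal r < \<infinity>" for r
      unfolding f_def[abs_def] using that g_pos[of r] by (intro continuous_intros cont) auto
    have contg': "isCont g' r" if "0 < ereal r" "ereal r < \<infinity>" for r
      unfolding g'_def[abs_def] using that by (intro continuous_intros) auto
    have f_nonneg: "0 \<le> f (g r)" if "0 < ereal r" "ereal r < \<infinity>" for r
      using that F[of r] G[of r] by (simp add: f_def g_def)
    have g'_nonneg: "0 \<le> g' r" if "0 \<le> ereal r" "ereal r \<le> \<infinity>" for r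
      using \<alpha> \<beta> by (simp add: g'_def)
    have "(0::ereal) < \<infinity>" by simp
    note subst = interval_integral_substitution_nonneg[OF this deriv contf contg' f_nonneg g'_nonneg A B eint]
    show "set_integrable lborel (einterval 0 \<infinity>) f" "(LBINT x=0..\<infinity>. f x) = (LBINT x=0..\<infinity>. f (g x) * g' x)"
      by (rule subst; assumption)+
  qed
  show "integrable lborel (\<lambda>u. indicator {0<..} u * (u powr (\<beta> * n / \<alpha> - \<beta> - 1) * G u))"
    using *(1) unfolding zero_ereal_def einterval_eq set_integrable_def f_def by simp
  have "(LINT u|lborel. indicator {0<..} u * (u powr (\<beta> * n / \<alpha> - \<beta> - 1) * G u)) = (LBINT u:{0<..}. f u)"
    by (simp add: set_lebesgue_integral_def f_def)
  also have "\<dots> = (LBINT r:{0<..}. f (g r) * g' r)"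
    using *(2) by (simp add: interval_lebesgue_integral_0_infty)
  also have "\<dots> = (LBINT r:{0<..}. \<alpha> / \<beta> * (r powr (n - \<alpha> - 1) * F r))"
    using fg by (intro set_lebesgue_integral_cong) auto
  also have "\<dots> = \<alpha> / \<beta> * (LBINT r:{0<..}. r powr (n - \<alpha> - 1) * F r)"
    by simp
  finally show "\<beta> * (LINT u|lborel. indicator {0<..} u * (u powr (\<beta> * n / \<alpha> - \<beta> - 1) * G u)) = \<alpha> * (LBINT r:{0<..}. r powr (n - \<alpha> - 1) * F r)"
    using \<beta> by simp
qed

text \<open>This multiplies \<open>Laplace_asymp\<close> by the Stirling asymptotics of
  \<open>neg_moment\<close>. The terms z \<open>log_center z\<close> cancel, and exp (a
  \<open>log_center z\<close>) is the remaining power of z and \<beta>.\<close>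

lemma (in stable_law) Laplace_asymp_explicit:
  fixes a b :: real
  assumes a: "0 \<le> a" and b: "0 < b"
  shows "((\<lambda>z. (LINT s|D. s powr (\<beta> * a) * exp (- (z / b * exp (b * log_center z)) * s powr (\<beta> * b)))
      * exp ((1 - \<beta> + 1 / b) * z) * (z powr (a * (1 - \<beta>)) * \<beta> powr (- a * \<beta>)))
    \<longlongrightarrow> 1 / sqrt (1 + b * (1 - \<beta>)) * (1 / sqrt \<beta>)) at_top"
proof (rule Lim_transform_eventually)
  let ?I = "\<lambda>z. LINT s|D. s powr (\<beta> * a) * exp (- (z / b * exp (b * log_center z)) * s powr (\<beta> * b))"
  show "((\<lambda>z. ?I z / neg_moment z * exp ((a + z) * log_center z + z / b) *
      (neg_moment z * exp ((1 - \<beta>) * z - z * log_center z))) \<longlongrightarrow> 1 / sqrt (1 + b * (1 - \<beta>)) * (1 / sqrt \<beta>)) at_top"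
    unfolding neg_moment_def log_center_def
    by (intro tendsto_mult Laplace_asymp[OF a b, unfolded neg_moment_def log_center_def] Gamma_quotient_asymp \<beta>)
  show "eventually (\<lambda>z. ?I z / neg_moment z * exp ((a + z) * log_center z + z / b) *
      (neg_moment z * exp ((1 - \<beta>) * z - z * log_center z)) =
      ?I z * exp ((1 - \<beta> + 1 / b) * z) * (z powr (a * (1 - \<beta>)) * \<beta> powr (- a * \<beta>))) at_top"
    using eventually_gt_at_top[of 0]
  proof eventually_elim
    case (elim z)
    have "exp ((a + z) * log_center z + z / b) * exp ((1 - \<beta>) * z - z * log_center z)
        = exp ((1 - \<beta> + 1 / b) * z) * exp (a * log_center z)"
      unfolding exp_add[symmetric] by (intro arg_cong[where f = exp]) (simp add: algebra_simps)
    also have "exp (a * log_center z) = z powr (a * (1 - \<beta>)) * \<beta> powr (- a * \<beta>)"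
      using elim \<beta> by (simp add: powr_def log_center_def algebra_simps flip: exp_add)
    finally show ?case
      using neg_moment_pos[OF elim] by (simp add: field_simps)
  qed
qed

text \<open>F is prescribed on the nonnegative half-line only, so measurability is stated for an
  explicit G on the whole line. The decay follows from w \<le> exp w.\<close>

lemma exponential_type_profile:
  fixes \<alpha> \<beta> :: real
  assumes "exponential_type \<alpha> F" and \<beta>: "0 < \<beta>"
  defines "G \<equiv> \<lambda>u. exp (- (u powr (\<beta> / (\<alpha> - 1))))"
  shows "G \<in> borel_measurable borel" and "\<And>u. 0 < u \<Longrightarrow> G u = F (u powr (\<beta> / \<alpha>))" and "\<And>u. 0 < u \<Longrightarrow> isCont G u"
    and "(G \<longlongrightarrow> 1) (at_right 0)" and "\<And>u. 0 < u \<Longrightarrow> G u \<le> u powr (- (\<beta> / (\<alpha> - 1)))"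
proof -
  have \<alpha>: "2 \<le> \<alpha>" and F: "\<And>r. 0 \<le> r \<Longrightarrow> F r = exp (- (r powr (\<alpha> / (\<alpha> - 1))))"
    using assms(1) by (auto simp: exponential_type_def)
  have e: "0 < \<beta> / (\<alpha> - 1)" using \<alpha> \<beta> by simp
  show "G \<in> borel_measurable borel"
    unfolding G_def by measurable
  show "G u = F (u powr (\<beta> / \<alpha>))" if "0 < u" for u
    using \<alpha> by (simp add: G_def F powr_powr)
  show "isCont G u" if "0 < u" for u
    unfolding G_def using that by (intro continuous_intros) auto
  show "(G \<longlongrightarrow> 1) (at_right 0)"
    unfolding G_def using e by real_asymp
  show "G u \<le> u powr (- (\<beta> / (\<alpha> - 1)))" if "0 < u" for u
  proof -
    define w where "w = u powr (\<beta> / (\<alpha> - 1))"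
    have w: "0 < w" using that by (simp add: w_def)
    have "w \<le> exp w" using exp_ge_add_one_self[of w] by linarith
    then have "exp (- w) \<le> 1 / w"
      using w by (simp add: exp_minus field_simps)
    then show ?thesis by (simp add: G_def w_def powr_minus_divide)
  qed
qed

text \<open>With w = u^(2 \<beta> / \<alpha>) and d = (n + \<alpha>) / 2 the power u^(\<beta> n /
  \<alpha> + \<beta>) is w^d. The product with G is therefore (w / (1 + w))^d, which is below 1 and
  tends to 1.\<close>

lemma polynomial_type_profile:
  fixes n \<alpha> \<beta> :: real
  assumes "polynomial_type n \<alpha> F" and \<beta>: "0 < \<beta>" and n: "0 < n"
  defines "G \<equiv> \<lambda>u. (1 + (u powr (\<beta> / \<alpha>))\<^sup>2) powr (- (n + \<alpha>) / 2)"
  shows "G \<in> borel_measurable borel" and "\<And>u. 0 < u \<Longrightarrow> G u = F (u powr (\<beta> / \<alpha>))" and "\<And>u. 0 < u \<Longrightarrow> isCont G u"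
    and "(G \<longlongrightarrow> 1) (at_right 0)" and "\<And>u. 0 < u \<Longrightarrow> G u * u powr (\<beta> * n / \<alpha> + \<beta>) \<le> 1"
    and "((\<lambda>u. G u * u powr (\<beta> * n / \<alpha> + \<beta>)) \<longlongrightarrow> 1) at_top"
proof -
  have \<alpha>: "0 < \<alpha>" and F: "\<And>r. 0 \<le> r \<Longrightarrow> F r = (1 + r\<^sup>2) powr (- (n + \<alpha>) / 2)"
    using assms(1) by (auto simp: polynomial_type_def)
  have e: "0 < \<beta> / \<alpha>" using \<alpha> \<beta> by simp
  have pos1: "0 < 1 + w\<^sup>2" for w :: real
    using zero_le_power2[of w] by linarith
  show "G \<in> borel_measurable borel"
    unfolding G_def by measurable
  show "G u = F (u powr (\<beta> / \<alpha>))" if "0 < u" for u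
    by (simp add: G_def F)
  show "isCont G u" if "0 < u" for u
    unfolding G_def using that pos1[of "u powr (\<beta> / \<alpha>)"] by (intro continuous_intros) auto
  have "((\<lambda>u. u powr (\<beta> / \<alpha>)) \<longlongrightarrow> 0) (at_right 0)"
    using e by real_asymp
  then have "(G \<longlongrightarrow> (1 + 0\<^sup>2) powr (- (n + \<alpha>) / 2)) (at_right 0)"
    unfolding G_def by (intro tendsto_intros) auto
  then show "(G \<longlongrightarrow> 1) (at_right 0)" by simp
  define c where "c = \<beta> / \<alpha>"
  define d where "d = (n + \<alpha>) / 2"
  have cd: "0 < c" "0 < d" using \<alpha> \<beta> n by (auto simp: c_def d_def)
  have G: "G u * u powr (\<beta> * n / \<alpha> + \<beta>) = ((u powr c)\<^sup>2 / (1 + (u powr c)\<^sup>2)) powr d" if "0 < u" for u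
  proof -
    have "u powr (\<beta> * n / \<alpha> + \<beta>) = ((u powr c)\<^sup>2) powr d"
    proof -
      have "\<beta> * n / \<alpha> + \<beta> = c * 2 * d" using \<alpha> by (simp add: c_def d_def field_simps)
      moreover have "(u powr c)\<^sup>2 = u powr (c * 2)"
        using that by (simp add: powr_power mult.commute)
      ultimately show ?thesis by (simp add: powr_powr)
    qed
    moreover have "G u = (1 + (u powr c)\<^sup>2) powr (- d)"
    proof -
      have "- (n + \<alpha>) / 2 = - d" by (simp add: d_def field_simps)
      then show ?thesis by (simp only: G_def c_def)
    qed
    ultimately show ?thesis
      using pos1[of "u powr c"] by (simp add: powr_divide powr_minus_divide)
  qed
  show "G u * u powr (\<beta> * n / \<alpha> + \<beta>) \<le> 1" if "0 < u" for u
    unfolding G[OF that] using cd pos1[of "u powr c"] by (intro powr_le1) (auto simp: divide_le_eq_1)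
  have "((\<lambda>u. ((u powr c)\<^sup>2 / (1 + (u powr c)\<^sup>2)) powr d) \<longlongrightarrow> 1) at_top"
    using cd by real_asymp
  then show "((\<lambda>u. G u * u powr (\<beta> * n / \<alpha> + \<beta>)) \<longlongrightarrow> 1) at_top"
    by (rule Lim_transform_eventually) (use eventually_gt_at_top[of 0] in eventually_elim, simp add: G)
qed

section \<open>The saddle point and its constants in closed form\<close>

lemma scale_powr:
  fixes C \<rho> t \<alpha> \<beta> e :: real
  assumes "0 < C" "0 < \<rho>" "0 < t"
  shows "(C powr (- \<alpha> / \<beta>) * (\<rho> powr (- \<alpha> / \<beta>) * t)) powr e = C powr (- (\<alpha> * e / \<beta>)) * \<rho> powr (- (\<alpha> * e / \<beta>)) * t powr e"
  using assms by (simp add: powr_mult powr_powr mult.assoc)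

text \<open>\<open>z\<close> is chosen so that the coefficient of the power of s in
  \<open>Laplace_asymp\<close>, for b = 1 / (\<alpha> - 1), is the one the exponential profile
  produces. In logarithms this equation is linear in ln z with coefficient 1 + b (1 - \<beta>) =
  (\<alpha> - \<beta>) / (\<alpha> - 1), which explains the explicit solution.\<close>

lemma saddle_point_eq:
  fixes \<alpha> \<beta> C \<rho> t :: real
  assumes \<alpha>: "2 \<le> \<alpha>" and \<beta>: "0 < \<beta>" "\<beta> < 1" and pos: "0 < C" "0 < \<rho>" "0 < t"
  defines "\<xi> \<equiv> C powr (- \<alpha> / \<beta>) * (\<rho> powr (- \<alpha> / \<beta>) * t)"
  defines "z \<equiv> (1 / (\<alpha> - 1) * \<beta> powr (\<beta> / (\<alpha> - 1)) * \<xi> powr (- (\<beta> / (\<alpha> - 1)))) powr ((\<alpha> - 1) / (\<alpha> - \<beta>))"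
  shows "ln z = \<alpha> / (\<alpha> - \<beta>) * ln C + \<alpha> / (\<alpha> - \<beta>) * ln \<rho> - \<beta> / (\<alpha> - \<beta>) * ln t
      - (\<alpha> - 1) / (\<alpha> - \<beta>) * ln (\<alpha> - 1) + \<beta> / (\<alpha> - \<beta>) * ln \<beta>"
    and "0 < z"
    and "z / (1 / (\<alpha> - 1)) * exp (1 / (\<alpha> - 1) * ((1 - \<beta>) * ln z - \<beta> * ln \<beta>)) = \<xi> powr (- (\<beta> / (\<alpha> - 1)))"
proof -
  have nz: "\<alpha> - 1 \<noteq> 0" "\<alpha> - \<beta> \<noteq> 0" "0 < \<alpha> - 1" "0 < \<alpha> - \<beta>" using \<alpha> \<beta> by auto
  have \<xi>: "0 < \<xi>" using pos by (simp add: \<xi>_def)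
  have ln_\<xi>: "ln \<xi> = - \<alpha> / \<beta> * ln C - \<alpha> / \<beta> * ln \<rho> + ln t"
    using pos by (simp add: \<xi>_def ln_mult ln_powr)
  show z: "0 < z" using nz \<beta> \<xi> by (simp add: z_def)
  have ln_z: "ln z = (\<alpha> - 1) / (\<alpha> - \<beta>) * (- ln (\<alpha> - 1) + \<beta> / (\<alpha> - 1) * ln \<beta> - \<beta> / (\<alpha> - 1) * ln \<xi>)"
    using nz \<beta> \<xi> by (simp add: z_def ln_mult ln_powr ln_div)
  also have "\<dots> = - ((\<alpha> - 1) / (\<alpha> - \<beta>) * ln (\<alpha> - 1)) + \<beta> / (\<alpha> - \<beta>) * ln \<beta> - \<beta> / (\<alpha> - \<beta>) * ln \<xi>"
  proof -
    have "(\<alpha> - 1) / (\<alpha> - \<beta>) * (\<beta> / (\<alpha> - 1)) = \<beta> / (\<alpha> - \<beta>)"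
      using nz by simp
    then show ?thesis
      by (simp only: right_diff_distrib distrib_left mult.assoc[symmetric] mult_minus_right)
  qed
  also have "\<beta> / (\<alpha> - \<beta>) * ln \<xi> = - \<alpha> / (\<alpha> - \<beta>) * ln C - \<alpha> / (\<alpha> - \<beta>) * ln \<rho> + \<beta> / (\<alpha> - \<beta>) * ln t"
    unfolding ln_\<xi> using \<beta> by (simp add: right_diff_distrib distrib_left)
  finally show "ln z = \<alpha> / (\<alpha> - \<beta>) * ln C + \<alpha> / (\<alpha> - \<beta>) * ln \<rho> - \<beta> / (\<alpha> - \<beta>) * ln t
      - (\<alpha> - 1) / (\<alpha> - \<beta>) * ln (\<alpha> - 1) + \<beta> / (\<alpha> - \<beta>) * ln \<beta>"
    by simp
  have "(\<alpha> - \<beta>) / (\<alpha> - 1) * ln z = - ln (\<alpha> - 1) + \<beta> / (\<alpha> - 1) * ln \<beta> - \<beta> / (\<alpha> - 1) * ln \<xi>"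
    unfolding ln_z using nz by simp
  moreover have "(\<alpha> - \<beta>) / (\<alpha> - 1) * ln z = ln z + 1 / (\<alpha> - 1) * ((1 - \<beta>) * ln z)"
    using nz by (simp add: field_simps)
  ultimately have key: "ln z + ln (\<alpha> - 1) + 1 / (\<alpha> - 1) * ((1 - \<beta>) * ln z - \<beta> * ln \<beta>) = - (\<beta> / (\<alpha> - 1)) * ln \<xi>"
    by (simp add: right_diff_distrib)
  have "z / (1 / (\<alpha> - 1)) * exp (1 / (\<alpha> - 1) * ((1 - \<beta>) * ln z - \<beta> * ln \<beta>)) = exp (ln z) * exp (ln (\<alpha> - 1)) * exp (1 / (\<alpha> - 1) * ((1 - \<beta>) * ln z - \<beta> * ln \<beta>))"
    using z nz by simp
  also have "\<dots> = \<xi> powr (- (\<beta> / (\<alpha> - 1)))"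
    unfolding exp_add[symmetric] key using \<xi> by (simp add: powr_def)
  finally show "z / (1 / (\<alpha> - 1)) * exp (1 / (\<alpha> - 1) * ((1 - \<beta>) * ln z - \<beta> * ln \<beta>)) = \<xi> powr (- (\<beta> / (\<alpha> - 1)))" .
qed

text \<open>Here the constants of the exponential case are traced to the saddle point: the exponent
  is (\<alpha> - \<beta>) z, and the power prefactor undoes the power of z from the Laplace
  asymptotics. Both follow by comparing coefficients of ln C2, ln \<rho>, ln t, ln (\<alpha> - 1)
  and ln \<beta>.\<close>

lemma saddle_point_constants:
  fixes \<alpha> \<beta> C1 C2 \<rho> t n z :: real
  assumes \<alpha>: "2 \<le> \<alpha>" and \<beta>: "0 < \<beta>" "\<beta> < 1" and pos: "0 < C1" "0 < C2" "0 < \<rho>" "0 < t" "0 < z"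
  assumes ln_z: "ln z = \<alpha> / (\<alpha> - \<beta>) * ln C2 + \<alpha> / (\<alpha> - \<beta>) * ln \<rho> - \<beta> / (\<alpha> - \<beta>) * ln t
      - (\<alpha> - 1) / (\<alpha> - \<beta>) * ln (\<alpha> - 1) + \<beta> / (\<alpha> - \<beta>) * ln \<beta>"
  shows "C2 powr (\<alpha> / (\<alpha> - \<beta>)) * (\<alpha> - \<beta>) * (\<alpha> - 1) powr (- ((\<alpha> - 1) / (\<alpha> - \<beta>))) * \<beta> powr (\<beta> / (\<alpha> - \<beta>))
      * \<rho> powr (\<alpha> / (\<alpha> - \<beta>)) * t powr (- (\<beta> / (\<alpha> - \<beta>))) = (\<alpha> - \<beta>) * z" (is ?K2)
    and "C1 * C2 powr (- (n * (1 - \<beta>) / (\<alpha> - \<beta>))) * sqrt ((\<alpha> - 1) / ((\<alpha> - \<beta>) * \<beta>))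
      * (\<alpha> - 1) powr (n * (\<alpha> - 1) * (1 - \<beta>) / (\<alpha> * (\<alpha> - \<beta>))) * \<beta> powr (n * (\<alpha> - 1) * \<beta> / (\<alpha> * (\<alpha> - \<beta>)))
      * \<rho> powr (- (n * (1 - \<beta>) / (\<alpha> - \<beta>))) * t powr (- (n * (\<alpha> - 1) * \<beta> / (\<alpha> * (\<alpha> - \<beta>))))
      * (z powr (n / \<alpha> * (1 - \<beta>)) * \<beta> powr (- (n / \<alpha>) * \<beta>))
      = sqrt ((\<alpha> - 1) / ((\<alpha> - \<beta>) * \<beta>)) * (C1 * t powr (- (\<beta> * n / \<alpha>)))" (is ?K1)
proof -
  have nz: "\<alpha> - 1 \<noteq> 0" "\<alpha> - \<beta> \<noteq> 0" "\<alpha> \<noteq> 0" "0 < \<alpha> - 1" "0 < \<alpha> - \<beta>" using \<alpha> \<beta> by auto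
  have "C2 powr (\<alpha> / (\<alpha> - \<beta>)) * (\<alpha> - 1) powr (- ((\<alpha> - 1) / (\<alpha> - \<beta>))) * \<beta> powr (\<beta> / (\<alpha> - \<beta>))
      * \<rho> powr (\<alpha> / (\<alpha> - \<beta>)) * t powr (- (\<beta> / (\<alpha> - \<beta>))) = exp (ln z)"
    unfolding ln_z using pos nz \<beta> by (simp add: powr_def flip: exp_add) 
  then show ?K2 using pos by (simp add: mult_ac)
  have "C2 powr (- (n * (1 - \<beta>) / (\<alpha> - \<beta>)))
      * (\<alpha> - 1) powr (n * (\<alpha> - 1) * (1 - \<beta>) / (\<alpha> * (\<alpha> - \<beta>))) * \<beta> powr (n * (\<alpha> - 1) * \<beta> / (\<alpha> * (\<alpha> - \<beta>)))
      * \<rho> powr (- (n * (1 - \<beta>) / (\<alpha> - \<beta>))) * t powr (- (n * (\<alpha> - 1) * \<beta> / (\<alpha> * (\<alpha> - \<beta>))))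
      * (z powr (n / \<alpha> * (1 - \<beta>)) * \<beta> powr (- (n / \<alpha>) * \<beta>)) =
      exp (- (n * (1 - \<beta>) / (\<alpha> - \<beta>)) * ln C2 + n * (\<alpha> - 1) * (1 - \<beta>) / (\<alpha> * (\<alpha> - \<beta>)) * ln (\<alpha> - 1)
        + n * (\<alpha> - 1) * \<beta> / (\<alpha> * (\<alpha> - \<beta>)) * ln \<beta> + - (n * (1 - \<beta>) / (\<alpha> - \<beta>)) * ln \<rho>
        + - (n * (\<alpha> - 1) * \<beta> / (\<alpha> * (\<alpha> - \<beta>))) * ln t + (n / \<alpha> * (1 - \<beta>) * ln z + - (n / \<alpha>) * \<beta> * ln \<beta>))"
    using pos nz \<beta> by (simp only: exp_add) (simp add: powr_def)
  also have "\<dots> = exp (- (\<beta> * n / \<alpha>) * ln t)"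
  proof (rule arg_cong[where f = exp])
    have c1: "n / \<alpha> * (1 - \<beta>) * (\<alpha> / (\<alpha> - \<beta>)) = n * (1 - \<beta>) / (\<alpha> - \<beta>)"
      using nz by simp
    \<comment> \<open>This coefficient occurs twice. For ln t it leaves the exponent - \<beta> n /
      \<alpha>; for ln \<beta> it makes all terms cancel.\<close>
    have c2: "n / \<alpha> * (1 - \<beta>) * (\<beta> / (\<alpha> - \<beta>)) = n / \<alpha> * \<beta> - n * (\<alpha> - 1) * \<beta> / (\<alpha> * (\<alpha> - \<beta>))"
      using nz by (simp add: divide_simps) (simp add: algebra_simps)
    have c3: "n / \<alpha> * (1 - \<beta>) * ((\<alpha> - 1) / (\<alpha> - \<beta>)) = n * (\<alpha> - 1) * (1 - \<beta>) / (\<alpha> * (\<alpha> - \<beta>))"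
      by simp
    have "n / \<alpha> * (1 - \<beta>) * ln z = n / \<alpha> * (1 - \<beta>) * (\<alpha> / (\<alpha> - \<beta>)) * ln C2 + n / \<alpha> * (1 - \<beta>) * (\<alpha> / (\<alpha> - \<beta>)) * ln \<rho>
        - n / \<alpha> * (1 - \<beta>) * (\<beta> / (\<alpha> - \<beta>)) * ln t - n / \<alpha> * (1 - \<beta>) * ((\<alpha> - 1) / (\<alpha> - \<beta>)) * ln (\<alpha> - 1)
        + n / \<alpha> * (1 - \<beta>) * (\<beta> / (\<alpha> - \<beta>)) * ln \<beta>"
      unfolding ln_z by (simp only: distrib_left right_diff_distrib mult.assoc)
    then show "- (n * (1 - \<beta>) / (\<alpha> - \<beta>)) * ln C2 + n * (\<alpha> - 1) * (1 - \<beta>) / (\<alpha> * (\<alpha> - \<beta>)) * ln (\<alpha> - 1)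
        + n * (\<alpha> - 1) * \<beta> / (\<alpha> * (\<alpha> - \<beta>)) * ln \<beta> + - (n * (1 - \<beta>) / (\<alpha> - \<beta>)) * ln \<rho>
        + - (n * (\<alpha> - 1) * \<beta> / (\<alpha> * (\<alpha> - \<beta>))) * ln t + (n / \<alpha> * (1 - \<beta>) * ln z + - (n / \<alpha>) * \<beta> * ln \<beta>)
        = - (\<beta> * n / \<alpha>) * ln t"
      unfolding c1 c2 c3 by (simp add: left_diff_distrib)
  qed
  also have "\<dots> = t powr (- (\<beta> * n / \<alpha>))"
    using pos by (simp add: powr_def)
  finally have "C1 * sqrt ((\<alpha> - 1) / ((\<alpha> - \<beta>) * \<beta>)) * (C2 powr (- (n * (1 - \<beta>) / (\<alpha> - \<beta>)))
      * (\<alpha> - 1) powr (n * (\<alpha> - 1) * (1 - \<beta>) / (\<alpha> * (\<alpha> - \<beta>))) * \<beta> powr (n * (\<alpha> - 1) * \<beta> / (\<alpha> * (\<alpha> - \<beta>)))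
      * \<rho> powr (- (n * (1 - \<beta>) / (\<alpha> - \<beta>))) * t powr (- (n * (\<alpha> - 1) * \<beta> / (\<alpha> * (\<alpha> - \<beta>))))
      * (z powr (n / \<alpha> * (1 - \<beta>)) * \<beta> powr (- (n / \<alpha>) * \<beta>))) = C1 * sqrt ((\<alpha> - 1) / ((\<alpha> - \<beta>) * \<beta>)) * t powr (- (\<beta> * n / \<alpha>))"
    by (rule arg_cong)
  then show ?K1 by (simp only: mult_ac)
qed

text \<open>The limit constant of the heavy case must be nonzero before the quotient can be
  normalised to 1.\<close>

lemma integral_powr_profile_pos:
  fixes G :: "real \<Rightarrow> real"
  assumes G: "\<And>u. 0 < u \<Longrightarrow> 0 < G u"
    and int: "integrable lborel (\<lambda>u. indicator {0<..} u * (u powr e * G u))"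
  shows "0 < (LINT u|lborel. indicator {0<..} u * (u powr e * G u))"
proof (rule ccontr)
  let ?f = "\<lambda>u. indicator {0<..} u * (u powr e * G u)"
  have nonneg: "0 \<le> ?f u" for u
    using G[of u] by (auto split: split_indicator)
  have "0 \<le> integral\<^sup>L lborel ?f"
    using nonneg by (intro Bochner_Integration.integral_nonneg)
  moreover assume "\<not> 0 < integral\<^sup>L lborel ?f"
  ultimately have "integral\<^sup>L lborel ?f = 0" by linarith
  then have "AE u in lborel. ?f u = 0"
    using integral_nonneg_eq_0_iff_AE[OF int] nonneg by auto
  then have "AE u in lborel. u \<notin> {0<..<1::real}"
    by eventually_elim (use G in \<open>force split: split_indicator_asm\<close>)
  then have "emeasure lborel {0<..<1::real} = 0"
    by (subst (asm) AE_iff_measurable[of "{0<..<1}"]) auto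
  then show False by simp
qed

lemma filterlim_mult_at_top_const: "0 < (c::real) \<Longrightarrow> filterlim (\<lambda>x. c * x) at_top at_top"
  by real_asymp

lemma filterlim_mult_at_right_0_const: "0 < (c::real) \<Longrightarrow> filterlim (\<lambda>x. c * x) (at_right 0) (at_right 0)"
  by real_asymp

text \<open>The integrability hypothesis of the large-argument case starts at 1. Near 0 the profile
  is at most 1 and the power is integrable, as e = n - \<alpha> - 1 > - 1 when n > \<alpha>.\<close>

lemma set_integrable_powr_profile:
  fixes F :: "real \<Rightarrow> real"
  assumes e: "- 1 < e" and [measurable]: "F' \<in> borel_measurable borel" and F': "\<And>r. 0 < r \<Longrightarrow> F' r = F r"
    and F: "\<And>r. 0 < r \<Longrightarrow> 0 \<le> F r" "\<And>r. 0 < r \<Longrightarrow> F r \<le> 1"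
    and int: "set_integrable lborel {1..} (\<lambda>r. r powr e * F r)"
  shows "set_integrable lborel {0<..} (\<lambda>r. r powr e * F r)"
proof -
  have "((\<lambda>r. r powr e) has_integral (1 powr (e + 1) / (e + 1))) {0..1::real}"
    using e by (intro has_integral_powr_from_0) auto
  then have "has_bochner_integral lborel (\<lambda>r. indicator {0..1} r * r powr e) (1 powr (e + 1) / (e + 1))"
    by (intro has_bochner_integral_of_has_integral) auto
  then have 1: "integrable lborel (\<lambda>r::real. indicator {0..1} r * r powr e)"
    by (simp add: has_bochner_integral_iff)
  have "integrable lborel (\<lambda>r. indicator {0<..1} r * (r powr e * F' r))"
  proof (rule Bochner_Integration.integrable_bound[OF 1])
    show "AE r in lborel. norm (indicator {0<..1} r * (r powr e * F' r)) \<le> norm (indicator {0..1} r * r powr e)"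
      using F F' by (intro AE_I2) (auto simp: abs_mult intro!: mult_left_le split: split_indicator)
  qed measurable
  then have "set_integrable lborel {0<..1} (\<lambda>r. r powr e * F r)"
    unfolding set_integrable_def
    by (rule Bochner_Integration.integrable_cong[THEN iffD1, OF refl, rotated]) (use F' in \<open>auto split: split_indicator\<close>)
  then have "set_integrable lborel ({0<..1} \<union> {1..}) (\<lambda>r. r powr e * F r)"
    using int by (rule set_integrable_Un) auto
  also have "{0<..1} \<union> {1..} = {0::real<..}" by auto
  finally show ?thesis .
qed

text \<open>The common properties of both profile types after the change of variable from r to u.
  The power decay at rate \<eta> serves the critical case, where it suppresses thresholds beyond
  x.\<close>

locale damping_profile =
  fixes G :: "real \<Rightarrow> real" and \<eta> :: real
  assumes meas: "G \<in> borel_measurable borel" and cont: "\<And>u. 0 < u \<Longrightarrow> isCont G u"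
    and lim_0: "(G \<longlongrightarrow> 1) (at_right 0)"
    and \<eta>: "0 < \<eta>" and decay: "\<And>u. 0 < u \<Longrightarrow> G u \<le> u powr (- \<eta>)"
    and pos: "\<And>u. 0 < u \<Longrightarrow> 0 < G u" and le_1: "\<And>u. 0 < u \<Longrightarrow> G u \<le> 1"
    and anti: "\<And>u v. 0 < u \<Longrightarrow> u \<le> v \<Longrightarrow> G v \<le> G u"

lemma density_profile:
  fixes n \<alpha> \<beta> :: real and F :: "real \<Rightarrow> real"
  assumes n: "0 < n" and \<alpha>: "0 < \<alpha>" and \<beta>: "0 < \<beta>"
    and pos: "\<And>r. 0 \<le> r \<Longrightarrow> 0 < F r" and anti: "antimono_on {0..} F"
    and type: "exponential_type \<alpha> F \<or> polynomial_type n \<alpha> F"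
  shows "\<exists>G \<eta>. damping_profile G \<eta> \<and> (\<forall>u>0. G u = F (u powr (\<beta> / \<alpha>)))"
proof -
  have "\<exists>G \<eta>. G \<in> borel_measurable borel \<and> (\<forall>u>0. G u = F (u powr (\<beta> / \<alpha>))) \<and> (\<forall>u>0. isCont G u) \<and>
      (G \<longlongrightarrow> 1) (at_right 0) \<and> 0 < \<eta> \<and> (\<forall>u>0. G u \<le> u powr (- \<eta>))"
    using type
  proof
    assume F: "exponential_type \<alpha> F"
    then have "0 < \<beta> / (\<alpha> - 1)" using \<beta> by (simp add: exponential_type_def)
    then show ?thesis
      using exponential_type_profile[OF F \<beta>] by blast
  next
    assume F: "polynomial_type n \<alpha> F"
    note G = polynomial_type_profile[OF F \<beta> n]
    have "0 < \<beta> * n / \<alpha> + \<beta>" using n \<alpha> \<beta> by (simp add: add_pos_pos)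
    moreover have "(1 + (u powr (\<beta> / \<alpha>))\<^sup>2) powr (- (n + \<alpha>) / 2) \<le> u powr (- (\<beta> * n / \<alpha> + \<beta>))" if "0 < u" for u
      unfolding powr_minus_divide using G(5)[OF that] that by (subst pos_le_divide_eq) auto
    ultimately show ?thesis
      using G(1-4) by blast
  qed
  then obtain G \<eta> where G: "G \<in> borel_measurable borel" "\<And>u. 0 < u \<Longrightarrow> G u = F (u powr (\<beta> / \<alpha>))" "\<And>u. 0 < u \<Longrightarrow> isCont G u"
    "(G \<longlongrightarrow> 1) (at_right 0)" "0 < \<eta>" "\<And>u. 0 < u \<Longrightarrow> G u \<le> u powr (- \<eta>)"
    by blast
  have mono: "G v \<le> G u" if "0 < u" "u \<le> v" for u v
    using that \<alpha> \<beta> monotone_onD[OF anti, of "u powr (\<beta> / \<alpha>)" "v powr (\<beta> / \<alpha>)"] by (simp add: G powr_mono2)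
  have "damping_profile G \<eta>"
  proof
    show "0 < G u" if "0 < u" for u
      using that pos by (simp add: G)
    \<comment> \<open>G is antitone and tends to 1 at the origin, so this limit bounds it.\<close>
    show "G u \<le> 1" if "0 < u" for u
    proof (rule tendsto_lowerbound[OF G(4)])
      show "eventually (\<lambda>v. G u \<le> G v) (at_right 0)"
        unfolding eventually_at_right_field using that by (intro exI[of _ u]) (auto intro: mono)
    qed simp
  qed (fact G(1) G(3-6) mono)+
  then show ?thesis
    using G(2) by blast
qed

section \<open>The three asymptotic regimes for the time-changed density\<close>

context subordinator
begin

lemma large_argument_asymp:
  fixes n \<alpha> C1 C2 :: real and F :: "real \<Rightarrow> real" and p :: "real \<Rightarrow> 'm::metric_space \<Rightarrow> 'm \<Rightarrow> real"
  assumes n: "0 < n" and \<alpha>: "0 < \<alpha>" and C: "0 < C1" "0 < C2"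
    and pos: "\<And>r. 0 \<le> r \<Longrightarrow> 0 < F r" and anti: "antimono_on {0..} F"
    and type: "exponential_type \<alpha> F \<or> polynomial_type n \<alpha> F"
    and p: "\<And>t x y. 0 < t \<Longrightarrow> p t x y = C1 / t powr (n / \<alpha>) * F (C2 * (dist x y / t powr (1 / \<alpha>)))"
    and int: "set_integrable lborel {1..} (\<lambda>s. s powr (n - \<alpha> - 1) * F s)"
  shows "asymptotically_equal (\<lambda>t x y. dist x y powr (- \<alpha> / \<beta>) * t) at_top
          (time_changed_density \<Omega> S p)
          (\<lambda>t x y.
             if n < \<alpha> then
               C1 * Lim (at_right 0) F * (Gamma (1 - n / \<alpha>) / Gamma (1 - \<beta> * n / \<alpha>))
                 * t powr (- \<beta> * n / \<alpha>)
             else if n = \<alpha> then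
               C1 * (\<beta> / Gamma (1 - \<beta>)) * Lim (at_right 0) F
                 * t powr (- \<beta>) * ln (dist x y powr (- \<alpha> / \<beta>) * t)
             else
               C1 * (C2 powr (\<alpha> - n) * \<alpha> / Gamma (1 - \<beta>))
                 * (LBINT s:{0<..}. s powr (n - \<alpha> - 1) * F s)
                 * dist x y powr (\<alpha> - n) * t powr (- \<beta>))"
    (is "asymptotically_equal _ _ _ ?g")
proof -
  have "\<exists>G \<eta>. damping_profile G \<eta> \<and> (\<forall>u>0. G u = F (u powr (\<beta> / \<alpha>)))"
    by (rule density_profile[OF n \<alpha> \<beta>(1) _ anti type]) (rule pos)
  then obtain G \<eta> where "damping_profile G \<eta>" and G: "\<And>u. 0 < u \<Longrightarrow> G u = F (u powr (\<beta> / \<alpha>))"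
    by blast
  then interpret G: damping_profile G \<eta> by simp
  note G_meas = G.meas and G_cont = G.cont and G0 = G.lim_0 and decay = G.decay
    and G_pos = G.pos and G_le = G.le_1 and G_anti = G.anti
  note G_nonneg = less_imp_le[OF G_pos]
  have GF: "G (r powr (\<alpha> / \<beta>)) = F r" if "0 < r" for r
    using that \<alpha> \<beta> by (simp add: G powr_powr)
  have F_lim: "(F \<longlongrightarrow> 1) (at_right 0)"
  proof -
    have "filterlim (\<lambda>r::real. r powr (\<alpha> / \<beta>)) (at_right 0) (at_right 0)"
      using \<alpha> \<beta> by real_asymp
    then have "((\<lambda>r. G (r powr (\<alpha> / \<beta>))) \<longlongrightarrow> 1) (at_right 0)"
      by (rule filterlim_compose[OF G0])
    then show ?thesis
      by (rule Lim_transform_eventually) (use eventually_at_right_less[of 0] in eventually_elim, simp add: GF)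
  qed
  then have Lim: "Lim (at_right 0) F = 1"
    by (intro tendsto_Lim) auto
  define c where "c = C2 powr (- \<alpha> / \<beta>)"
  have c: "0 < c" using C by (simp add: c_def)
  define q where "q = \<beta> * n / \<alpha>"
  define Q where "Q x = (LINT s|law. s powr q * G (s / x))" for x
  have density: "time_changed_density \<Omega> S p t x y = C1 * t powr (- q) * Q (c * (dist x y powr (- \<alpha> / \<beta>) * t))"
    if "0 < t" "x \<noteq> y" for t x y
    unfolding Q_def q_def c_def using that \<alpha> C p G_meas G by (intro time_changed_density_eq) auto
  have c_top: "filterlim (\<lambda>x. c * x) at_top at_top"
    by (rule filterlim_mult_at_top_const[OF c])
  \<comment> \<open>Since q = \<beta> n / \<alpha>, comparing n with \<alpha> is comparing the power
    q with \<beta>, the order from which on the moments of S_1 are infinite.\<close>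
  consider (lt) "n < \<alpha>" | (eq) "n = \<alpha>" | (gt) "\<alpha> < n" by linarith
  then show ?thesis
  proof cases
    case lt
    have "n / \<alpha> < 1" using lt \<alpha> by simp
    then have "\<beta> * (n / \<alpha>) < \<beta> * 1" using \<beta> by (intro mult_strict_left_mono) auto
    then have q: "q < \<beta>" "q < 1" using \<beta> by (auto simp: q_def)
    define K where "K = Gamma (1 - n / \<alpha>) / Gamma (1 - q)"
    have "0 < 1 - n / \<alpha>" using lt \<alpha> by simp
    then have K: "0 < K" using q by (simp add: K_def)
    have "(Q \<longlongrightarrow> Gamma (1 - q / \<beta>) / Gamma (1 - q)) at_top"
      unfolding Q_def by (rule L.moment_asymp_at_infinity[OF q(1) G_meas G_nonneg G_le G0])
    moreover have "q / \<beta> = n / \<alpha>" using \<beta> by (simp add: q_def)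
    ultimately have "(Q \<longlongrightarrow> K) at_top" by (simp add: K_def)
    then have "((\<lambda>A. Q (c * A) / K) \<longlongrightarrow> K / K) at_top"
      by (intro tendsto_divide tendsto_const filterlim_compose[OF _ c_top]) (use K in auto)
    then have h: "((\<lambda>A. Q (c * A) / K) \<longlongrightarrow> 1) at_top" using K by simp
    show ?thesis
    proof (rule asymptotically_equalI[OF h, where P = "\<lambda>_. True"])
      fix t :: real and x y :: 'm assume "0 < t" "x \<noteq> y"
      then show "time_changed_density \<Omega> S p t x y / ?g t x y = Q (c * (dist x y powr (- \<alpha> / \<beta>) * t)) / K"
        using lt C by (simp add: density Lim K_def q_def)
    qed simp
  next
    case eq
    have q: "q = \<beta>" using eq \<alpha> by (simp add: q_def)
    define K where "K = \<beta> / Gamma (1 - \<beta>)"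
    have K: "0 < K" using \<beta> by (simp add: K_def)
    have "((\<lambda>x. Q x / ln x) \<longlongrightarrow> K) at_top"
      unfolding Q_def q K_def
      by (rule L.moment_asymp_critical[OF G_meas G_nonneg G_le G_anti G0 G.\<eta> decay])
    then have "((\<lambda>A. Q (c * A) / ln (c * A)) \<longlongrightarrow> K) at_top"
      by (rule filterlim_compose[OF _ c_top])
    \<comment> \<open>The constant \<open>c\<close>, and with it C2, is absorbed by the logarithm;
      this is why C2 is absent from the critical case.\<close>
    moreover have "((\<lambda>A. ln (c * A) / ln A) \<longlongrightarrow> 1) at_top"
      using c by real_asymp
    ultimately have "((\<lambda>A. Q (c * A) / ln (c * A) * (ln (c * A) / ln A) / K) \<longlongrightarrow> K * 1 / K) at_top"
      by (intro tendsto_divide tendsto_mult tendsto_const) (use K in auto)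
    then have h: "((\<lambda>A. Q (c * A) / ln (c * A) * (ln (c * A) / ln A) / K) \<longlongrightarrow> 1) at_top" using K by simp
    \<comment> \<open>Both logarithms must be nonzero for the quotient identity to hold.\<close>
    have P: "eventually (\<lambda>A. 1 < A \<and> 1 < c * A) at_top"
      using eventually_gt_at_top[of 1] eventually_gt_at_top[of "1 / c"]
      by eventually_elim (use c in \<open>simp add: field_simps\<close>)
    show ?thesis
    proof (rule asymptotically_equalI[OF h _ P])
      fix t :: real and x y :: 'm
      assume t: "0 < t" and xy: "x \<noteq> y" and gt: "1 < dist x y powr (- \<alpha> / \<beta>) * t \<and> 1 < c * (dist x y powr (- \<alpha> / \<beta>) * t)"
      define A where "A = dist x y powr (- \<alpha> / \<beta>) * t"
      have ln: "ln (c * A) \<noteq> 0" "ln A \<noteq> 0" using gt unfolding A_def[symmetric] by auto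
      have D: "time_changed_density \<Omega> S p t x y = C1 * t powr (- \<beta>) * Q (c * A)"
        using density[OF t xy] by (simp add: A_def q)
      show "time_changed_density \<Omega> S p t x y / ?g t x y =
          Q (c * (dist x y powr (- \<alpha> / \<beta>) * t)) / ln (c * (dist x y powr (- \<alpha> / \<beta>) * t)) *
            (ln (c * (dist x y powr (- \<alpha> / \<beta>) * t)) / ln (dist x y powr (- \<alpha> / \<beta>) * t)) / K"
        unfolding D Lim A_def[symmetric] K_def[symmetric] using eq C K ln t by simp
    qed
  next
    case gt
    have q: "\<beta> < q" using gt \<alpha> \<beta> by (simp add: q_def field_simps)
    have F01: "0 \<le> F r" "F r \<le> 1" if "0 < r" for r
      using that GF[OF that] G_pos[of "r powr (\<alpha> / \<beta>)"] G_le[of "r powr (\<alpha> / \<beta>)"] by auto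
    have intF: "set_integrable lborel {0<..} (\<lambda>r. r powr (n - \<alpha> - 1) * F r)"
      by (rule set_integrable_powr_profile[where F' = "\<lambda>r. G (r powr (\<alpha> / \<beta>))", OF _ _ GF F01 int]) (use gt G_meas in auto)
    note subst = substitution_powr_integral[OF \<alpha> \<beta>(1) F01(1) GF G_cont intF]
    define J where "J = (LINT u|lborel. indicator {0<..} u * (u powr (q - \<beta> - 1) * G u))"
    have intG: "integrable lborel (\<lambda>u. indicator {0<..} u * (u powr (q - \<beta> - 1) * G u))"
      unfolding q_def by (rule subst)
    have J: "0 < J"
      unfolding J_def by (rule integral_powr_profile_pos[OF G_pos intG])
    have J_eq: "\<beta> * J = \<alpha> * (LBINT r:{0<..}. r powr (n - \<alpha> - 1) * F r)"
      unfolding J_def q_def by (rule subst)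
    define K where "K = \<beta> / Gamma (1 - \<beta>) * J"
    have K: "0 < K" using \<beta> J by (simp add: K_def)
    have "((\<lambda>x. x powr (\<beta> - q) * Q x) \<longlongrightarrow> K) at_top"
      unfolding Q_def K_def J_def by (rule L.moment_asymp_heavy[OF q G_meas G_nonneg G_le G_anti G_cont intG])
    then have "((\<lambda>A. (c * A) powr (\<beta> - q) * Q (c * A) / K) \<longlongrightarrow> K / K) at_top"
      by (intro tendsto_divide tendsto_const filterlim_compose[OF _ c_top]) (use K in auto)
    then have h: "((\<lambda>A. (c * A) powr (\<beta> - q) * Q (c * A) / K) \<longlongrightarrow> 1) at_top" using K by simp
    show ?thesis
    proof (rule asymptotically_equalI[OF h, where P = "\<lambda>_. True"])
      fix t :: real and x y :: 'm assume t: "0 < t" and xy: "x \<noteq> y"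
      have d: "0 < dist x y" using xy by simp
      have e: "- (\<alpha> * (\<beta> - q) / \<beta>) = n - \<alpha>"
        using \<alpha> \<beta> by (simp add: q_def field_simps)
      have "(c * (dist x y powr (- \<alpha> / \<beta>) * t)) powr (\<beta> - q) = C2 powr (n - \<alpha>) * dist x y powr (n - \<alpha>) * t powr (\<beta> - q)"
        unfolding c_def scale_powr[OF C(2) d t] e ..
      moreover have "t powr (\<beta> - q) = t powr (- q) / t powr (- \<beta>)"
        by (simp flip: powr_diff)
      moreover have "C2 powr (n - \<alpha>) = 1 / C2 powr (\<alpha> - n)" "dist x y powr (n - \<alpha>) = 1 / dist x y powr (\<alpha> - n)"
        using powr_minus_divide[of C2 "\<alpha> - n"] powr_minus_divide[of "dist x y" "\<alpha> - n"] by simp_all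
      ultimately have scale: "(c * (dist x y powr (- \<alpha> / \<beta>) * t)) powr (\<beta> - q) = t powr (- q) / (C2 powr (\<alpha> - n) * dist x y powr (\<alpha> - n) * t powr (- \<beta>))"
        by simp
      have K': "K = \<alpha> * (LBINT r:{0<..}. r powr (n - \<alpha> - 1) * F r) / Gamma (1 - \<beta>)"
        unfolding K_def J_eq[symmetric] by simp
      have "C1 * (C2 powr (\<alpha> - n) * \<alpha> / Gamma (1 - \<beta>)) * (LBINT s:{0<..}. s powr (n - \<alpha> - 1) * F s) * dist x y powr (\<alpha> - n) * t powr (- \<beta>)
          = C1 * (C2 powr (\<alpha> - n) * dist x y powr (\<alpha> - n) * t powr (- \<beta>)) * K"
        unfolding K' by simp
      then show "time_changed_density \<Omega> S p t x y / ?g t x y =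
          (c * (dist x y powr (- \<alpha> / \<beta>) * t)) powr (\<beta> - q) * Q (c * (dist x y powr (- \<alpha> / \<beta>) * t)) / K"
        using gt C unfolding scale density[OF t xy] by simp
    qed simp
  qed
qed

lemma small_argument_asymp_polynomial:
  fixes n \<alpha> C1 C2 :: real and F :: "real \<Rightarrow> real" and p :: "real \<Rightarrow> 'm::metric_space \<Rightarrow> 'm \<Rightarrow> real"
  assumes n: "0 < n" and C: "0 < C1" "0 < C2" and F: "polynomial_type n \<alpha> F"
    and p: "\<And>t x y. 0 < t \<Longrightarrow> p t x y = C1 / t powr (n / \<alpha>) * F (C2 * (dist x y / t powr (1 / \<alpha>)))"
  shows "asymptotically_equal (\<lambda>t x y. dist x y powr (- \<alpha> / \<beta>) * t) (at_right 0)
          (time_changed_density \<Omega> S p)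
          (\<lambda>t x y. C1 * (C2 powr (- n - \<alpha>) / (\<beta> * Gamma \<beta>))
                     * dist x y powr (- n - \<alpha>) * t powr \<beta>)"
    (is "asymptotically_equal _ _ _ ?g")
proof -
  have \<alpha>: "0 < \<alpha>" using F by (simp add: polynomial_type_def)
  define G where "G u = (1 + (u powr (\<beta> / \<alpha>))\<^sup>2) powr (- (n + \<alpha>) / 2)" for u :: real
  note profile = polynomial_type_profile[OF F \<beta>(1) n, folded G_def]
  note G = profile(1,2) and G_le = profile(5) and G_lim = profile(6)
  have G_nonneg: "0 \<le> G u" for u
    by (simp add: G_def)
  define c where "c = C2 powr (- \<alpha> / \<beta>)"
  have c: "0 < c" using C by (simp add: c_def)
  define q where "q = \<beta> * n / \<alpha>"
  define Q where "Q x = (LINT s|law. s powr q * G (s / x))" for x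
  have density: "time_changed_density \<Omega> S p t x y = C1 * t powr (- q) * Q (c * (dist x y powr (- \<alpha> / \<beta>) * t))"
    if "0 < t" "x \<noteq> y" for t x y
    unfolding Q_def q_def c_def using that \<alpha> C p G by (intro time_changed_density_eq) auto
  define K where "K = 1 / Gamma (1 + \<beta>)"
  have "Gamma (1 + \<beta>) = \<beta> * Gamma \<beta>"
    unfolding add.commute[of 1] using \<beta> by (intro Gamma_plus1) (auto elim!: nonpos_Ints_cases)
  then have K: "K = 1 / (\<beta> * Gamma \<beta>)" "0 < K" using \<beta> by (auto simp: K_def)
  have "((\<lambda>x. x powr (- (q + \<beta>)) * Q x) \<longlongrightarrow> K) (at_right 0)"
    unfolding Q_def K_def q_def
    by (rule L.moment_asymp_at_zero[OF refl G(1) G_nonneg G_le G_lim])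
  then have "((\<lambda>A. (c * A) powr (- (q + \<beta>)) * Q (c * A) / K) \<longlongrightarrow> K / K) (at_right 0)"
    by (intro tendsto_divide tendsto_const filterlim_compose[OF _ filterlim_mult_at_right_0_const[OF c]]) (use K(2) in auto)
  then have h: "((\<lambda>A. (c * A) powr (- (q + \<beta>)) * Q (c * A) / K) \<longlongrightarrow> 1) (at_right 0)" using K(2) by simp
  show ?thesis
  proof (rule asymptotically_equalI[OF h, where P = "\<lambda>_. True"])
    fix t :: real and x y :: 'm assume t: "0 < t" and xy: "x \<noteq> y"
    have d: "0 < dist x y" using xy by simp
    have e: "- (\<alpha> * (- (q + \<beta>)) / \<beta>) = n + \<alpha>"
      using \<alpha> \<beta> by (simp add: q_def field_simps)
    have "(c * (dist x y powr (- \<alpha> / \<beta>) * t)) powr (- (q + \<beta>)) = C2 powr (n + \<alpha>) * dist x y powr (n + \<alpha>) * t powr (- (q + \<beta>))"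
      unfolding c_def scale_powr[OF C(2) d t] e ..
    moreover have "t powr (- (q + \<beta>)) = t powr (- q) / t powr \<beta>"
      by (simp flip: powr_diff)
    moreover have "C2 powr (n + \<alpha>) = 1 / C2 powr (- n - \<alpha>)" "dist x y powr (n + \<alpha>) = 1 / dist x y powr (- n - \<alpha>)"
      using powr_minus_divide[of C2 "- n - \<alpha>"] powr_minus_divide[of "dist x y" "- n - \<alpha>"] by (simp_all add: add.commute)
    ultimately have scale: "(c * (dist x y powr (- \<alpha> / \<beta>) * t)) powr (- (q + \<beta>)) = t powr (- q) / (C2 powr (- n - \<alpha>) * dist x y powr (- n - \<alpha>) * t powr \<beta>)"
      by simp
    have "C1 * (C2 powr (- n - \<alpha>) / (\<beta> * Gamma \<beta>)) * dist x y powr (- n - \<alpha>) * t powr \<beta>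
        = C1 * (C2 powr (- n - \<alpha>) * dist x y powr (- n - \<alpha>) * t powr \<beta>) * K"
      unfolding K by simp
    then show "time_changed_density \<Omega> S p t x y / ?g t x y =
        (c * (dist x y powr (- \<alpha> / \<beta>) * t)) powr (- (q + \<beta>)) * Q (c * (dist x y powr (- \<alpha> / \<beta>) * t)) / K"
      using C unfolding scale density[OF t xy] by simp
  qed simp
qed

lemma small_argument_asymp_exponential:
  fixes n \<alpha> C1 C2 :: real and F :: "real \<Rightarrow> real" and p :: "real \<Rightarrow> 'm::metric_space \<Rightarrow> 'm \<Rightarrow> real"
  assumes n: "0 < n" and C: "0 < C1" "0 < C2" and F: "exponential_type \<alpha> F"
    and p: "\<And>t x y. 0 < t \<Longrightarrow> p t x y = C1 / t powr (n / \<alpha>) * F (C2 * (dist x y / t powr (1 / \<alpha>)))"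
  defines "K1 \<equiv> C1 * C2 powr (- (n * (1 - \<beta>) / (\<alpha> - \<beta>)))
                    * sqrt ((\<alpha> - 1) / ((\<alpha> - \<beta>) * \<beta>))
                    * (\<alpha> - 1) powr (n * (\<alpha> - 1) * (1 - \<beta>) / (\<alpha> * (\<alpha> - \<beta>)))
                    * \<beta> powr (n * (\<alpha> - 1) * \<beta> / (\<alpha> * (\<alpha> - \<beta>)))"
    and "K2 \<equiv> C2 powr (\<alpha> / (\<alpha> - \<beta>)) * (\<alpha> - \<beta>)
                    * (\<alpha> - 1) powr (- ((\<alpha> - 1) / (\<alpha> - \<beta>)))
                    * \<beta> powr (\<beta> / (\<alpha> - \<beta>))"
  shows "asymptotically_equal (\<lambda>t x y. dist x y powr (- \<alpha> / \<beta>) * t) (at_right 0)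
              (time_changed_density \<Omega> S p)
              (\<lambda>t x y. K1 * dist x y powr (- (n * (1 - \<beta>) / (\<alpha> - \<beta>)))
                          * t powr (- (n * (\<alpha> - 1) * \<beta> / (\<alpha> * (\<alpha> - \<beta>))))
                          * exp (- K2 * dist x y powr (\<alpha> / (\<alpha> - \<beta>))
                                      * t powr (- (\<beta> / (\<alpha> - \<beta>)))))"
    (is "asymptotically_equal _ _ _ ?g")
proof -
  have \<alpha>: "2 \<le> \<alpha>" using F by (simp add: exponential_type_def)
  have nz: "0 < \<alpha> - 1" "0 < \<alpha> - \<beta>" "0 < \<alpha>" using \<alpha> \<beta> by auto
  define G where "G u = exp (- (u powr (\<beta> / (\<alpha> - 1))))" for u :: real
  have G: "G \<in> borel_measurable borel" "\<And>u. 0 < u \<Longrightarrow> G u = F (u powr (\<beta> / \<alpha>))"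
    using exponential_type_profile(1,2)[OF F \<beta>(1)] by (auto simp: G_def[abs_def])
  define c where "c = C2 powr (- \<alpha> / \<beta>)"
  have c: "0 < c" using C by (simp add: c_def)
  define q where "q = \<beta> * n / \<alpha>"
  define Q where "Q x = (LINT s|law. s powr q * G (s / x))" for x
  have density: "time_changed_density \<Omega> S p t x y = C1 * t powr (- q) * Q (c * (dist x y powr (- \<alpha> / \<beta>) * t))"
    if "0 < t" "x \<noteq> y" for t x y
    unfolding Q_def q_def c_def using that nz C p G by (intro time_changed_density_eq) auto
  define a where "a = n / \<alpha>"
  \<comment> \<open>With these values s^(\<beta> a) is the factor s^q, and s^(\<beta> b) is the
    power of s in the exponent of G.\<close>
  define b where "b = 1 / (\<alpha> - 1)"
  have a: "0 \<le> a" and b: "0 < b" using n nz by (auto simp: a_def b_def)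
  define I where "I z = (LINT s|law. s powr (\<beta> * a) * exp (- (z / b * exp (b * L.log_center z)) * s powr (\<beta> * b)))" for z
  \<comment> \<open>\<open>Z \<xi>\<close> is the tilt parameter at which the exponential in
    \<open>I\<close> coincides with the profile at s / \<xi>; it tends to infinity as \<xi> tends to
    0.\<close>
  define Z where "Z \<xi> = (1 / (\<alpha> - 1) * \<beta> powr (\<beta> / (\<alpha> - 1)) * \<xi> powr (- (\<beta> / (\<alpha> - 1)))) powr ((\<alpha> - 1) / (\<alpha> - \<beta>))" for \<xi>
  define k where "k = sqrt ((\<alpha> - 1) / ((\<alpha> - \<beta>) * \<beta>))"
  have k: "0 < k" using nz \<beta> by (simp add: k_def)
  define H where "H z = I z * exp ((\<alpha> - \<beta>) * z) * (z powr (a * (1 - \<beta>)) * \<beta> powr (- a * \<beta>)) / k" for z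
  have H: "(H \<longlongrightarrow> 1) at_top"
  proof -
    have "1 - \<beta> + 1 / b = \<alpha> - \<beta>" by (simp add: b_def)
    \<comment> \<open>The first factor is the Gaussian integral at the saddle point, the second
      comes from Stirling's formula; their product is the square root in \<open>K1\<close>.\<close>
    moreover have "1 / sqrt (1 + b * (1 - \<beta>)) * (1 / sqrt \<beta>) = k"
    proof -
      have "1 + b * (1 - \<beta>) = (\<alpha> - \<beta>) / (\<alpha> - 1)"
        using nz by (simp add: b_def field_simps)
      then show ?thesis
        by (simp add: k_def real_sqrt_divide real_sqrt_mult)
    qed
    ultimately have "((\<lambda>z. I z * exp ((\<alpha> - \<beta>) * z) * (z powr (a * (1 - \<beta>)) * \<beta> powr (- a * \<beta>))) \<longlongrightarrow> k) at_top"
      using L.Laplace_asymp_explicit[OF a b] by (simp only: I_def)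
    then have "(H \<longlongrightarrow> k / k) at_top"
      unfolding H_def by (intro tendsto_divide tendsto_const) (use k in auto)
    then show ?thesis using k by simp
  qed
  have Z_top: "filterlim (\<lambda>A. Z (c * A)) at_top (at_right 0)"
  proof -
    define e1 e2 d where "e1 = \<beta> / (\<alpha> - 1)" and "e2 = (\<alpha> - 1) / (\<alpha> - \<beta>)"
      and "d = 1 / (\<alpha> - 1) * \<beta> powr (\<beta> / (\<alpha> - 1))"
    have "0 < e1" "0 < e2" "0 < d" using nz \<beta> by (auto simp: e1_def e2_def d_def)
    then have "filterlim (\<lambda>\<xi>. (d * \<xi> powr (- e1)) powr e2) at_top (at_right 0)"
      by real_asymp
    then show ?thesis
      unfolding Z_def e1_def e2_def d_def by (rule filterlim_compose[OF _ filterlim_mult_at_right_0_const[OF c]])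
  qed
  have h: "((\<lambda>A. H (Z (c * A))) \<longlongrightarrow> 1) (at_right 0)"
    by (rule filterlim_compose[OF H Z_top])
  show ?thesis
  proof (rule asymptotically_equalI[OF h, where P = "\<lambda>_. True"])
    fix t :: real and x y :: 'm assume t: "0 < t" and xy: "x \<noteq> y"
    have d: "0 < dist x y" using xy by simp
    define \<xi> where "\<xi> = c * (dist x y powr (- \<alpha> / \<beta>) * t)"
    have \<xi>: "0 < \<xi>" using c d t by (simp add: \<xi>_def)
    define z where "z = Z \<xi>"
    note sp = saddle_point_eq[OF \<alpha> \<beta> C(2) d t, folded c_def, folded \<xi>_def, folded Z_def, folded z_def]
    note const = saddle_point_constants[OF \<alpha> \<beta> C d t sp(2) sp(1)]
    have Q_eq: "Q \<xi> = I z"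
      unfolding Q_def I_def
    proof (rule integral_cong_AE)
      have lc: "z / b * exp (b * L.log_center z) = \<xi> powr (- (\<beta> / (\<alpha> - 1)))"
        using sp(3) by (simp add: b_def L.log_center_def)
      show "AE s in law. s powr q * G (s / \<xi>) = s powr (\<beta> * a) * exp (- (z / b * exp (b * L.log_center z)) * s powr (\<beta> * b))"
        using L.pos
      proof eventually_elim
        case (elim s)
        then show ?case
          unfolding lc using \<xi> by (simp add: G_def q_def a_def b_def powr_divide powr_minus_divide)
      qed
    qed (use G(1) in measurable)
    define E where "E = dist x y powr (- (n * (1 - \<beta>) / (\<alpha> - \<beta>))) * t powr (- (n * (\<alpha> - 1) * \<beta> / (\<alpha> * (\<alpha> - \<beta>))))"
    have exp_eq: "- K2 * dist x y powr (\<alpha> / (\<alpha> - \<beta>)) * t powr (- (\<beta> / (\<alpha> - \<beta>))) = - ((\<alpha> - \<beta>) * z)"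
      using const(1) by (simp add: K2_def)
    define w where "w = z powr (a * (1 - \<beta>)) * \<beta> powr (- a * \<beta>)"
    have w: "0 < w" using sp(2) \<beta> by (simp add: w_def)
    have K1_eq: "K1 * E * w = k * (C1 * t powr (- q))"
      using const(2)[of n] by (simp add: K1_def E_def w_def k_def q_def a_def mult.assoc)
    have K1E: "0 < K1 * E" using C nz \<beta> d t by (simp add: K1_def E_def)
    have "C1 * t powr (- q) / (K1 * E) = k * (C1 * t powr (- q)) / (K1 * E) / k"
      using k by simp
    also have "\<dots> = w / k"
      unfolding K1_eq[symmetric] using less_imp_neq[OF K1E] by simp
    finally have "C1 * t powr (- q) / (K1 * E) = w / k" .
    moreover have "time_changed_density \<Omega> S p t x y = C1 * t powr (- q) * I z"
      using density[OF t xy] Q_eq by (simp add: \<xi>_def)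
    then have "time_changed_density \<Omega> S p t x y / (K1 * E * exp (- ((\<alpha> - \<beta>) * z))) =
        C1 * t powr (- q) / (K1 * E) * (I z * exp ((\<alpha> - \<beta>) * z))"
      by (simp add: exp_minus divide_inverse mult_ac)
    ultimately have "time_changed_density \<Omega> S p t x y / (K1 * E * exp (- ((\<alpha> - \<beta>) * z))) = I z * exp ((\<alpha> - \<beta>) * z) * w / k"
      by simp
    then show "time_changed_density \<Omega> S p t x y / ?g t x y =
        H (Z (c * (dist x y powr (- \<alpha> / \<beta>) * t)))"
      unfolding exp_eq \<xi>_def[symmetric] z_def[symmetric] H_def by (simp only: E_def w_def mult.assoc)
  qed simp
qed

end

theorem theorem2p2:
  fixes \<Omega> :: "'w measure"
    and S :: "real \<Rightarrow> 'w \<Rightarrow> real"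
    and X :: "real \<Rightarrow> 'w \<Rightarrow> 'm::metric_space"
    and P :: "real \<Rightarrow> 'm \<Rightarrow> 'm measure"
    and \<mu> :: "'m measure"
    and p :: "real \<Rightarrow> 'm \<Rightarrow> 'm \<Rightarrow> real"
    and F :: "real \<Rightarrow> real"
    and \<alpha> \<beta> n C1 C2 :: real
  assumes "0 < \<beta>" "\<beta> < 1"
    and "stable_subordinator \<Omega> \<beta> S"
    and "locally_compact_space (euclidean :: 'm topology)"
    and "separable_space (euclidean :: 'm topology)"
    and "feller_process \<Omega> P X"
    and "independent_processes \<Omega> X S"
    and "transition_density \<mu> P p"
    and "0 < n" "0 < \<alpha>" "0 < C1" "0 < C2"
    and "\<And>r. 0 \<le> r \<Longrightarrow> 0 < F r"
    and "antimono_on {0..} F"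
    and "exponential_type \<alpha> F \<or> polynomial_type n \<alpha> F"
    and "\<And>t x y. 0 < t \<Longrightarrow>
           p t x y = C1 / t powr (n / \<alpha>) * F (C2 * (dist x y / t powr (1 / \<alpha>)))"
  shows
    "(set_integrable lborel {1..} (\<lambda>s. s powr (n - \<alpha> - 1) * F s) \<longrightarrow>
        asymptotically_equal (\<lambda>t x y. dist x y powr (- \<alpha> / \<beta>) * t) at_top
          (time_changed_density \<Omega> S p)
          (\<lambda>t x y.
             if n < \<alpha> then
               C1 * Lim (at_right 0) F * (Gamma (1 - n / \<alpha>) / Gamma (1 - \<beta> * n / \<alpha>))
                 * t powr (- \<beta> * n / \<alpha>)
             else if n = \<alpha> then
               C1 * (\<beta> / Gamma (1 - \<beta>)) * Lim (at_right 0) F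
                 * t powr (- \<beta>) * ln (dist x y powr (- \<alpha> / \<beta>) * t)
             else
               C1 * (C2 powr (\<alpha> - n) * \<alpha> / Gamma (1 - \<beta>))
                 * (LBINT s:{0<..}. s powr (n - \<alpha> - 1) * F s)
                 * dist x y powr (\<alpha> - n) * t powr (- \<beta>)))
     \<and>
     (polynomial_type n \<alpha> F \<longrightarrow>
        asymptotically_equal (\<lambda>t x y. dist x y powr (- \<alpha> / \<beta>) * t) (at_right 0)
          (time_changed_density \<Omega> S p)
          (\<lambda>t x y. C1 * (C2 powr (- n - \<alpha>) / (\<beta> * Gamma \<beta>))
                     * dist x y powr (- n - \<alpha>) * t powr \<beta>))
     \<and>
     (exponential_type \<alpha> F \<longrightarrow>
        (let K1 = C1 * C2 powr (- (n * (1 - \<beta>) / (\<alpha> - \<beta>)))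
                    * sqrt ((\<alpha> - 1) / ((\<alpha> - \<beta>) * \<beta>))
                    * (\<alpha> - 1) powr (n * (\<alpha> - 1) * (1 - \<beta>) / (\<alpha> * (\<alpha> - \<beta>)))
                    * \<beta> powr (n * (\<alpha> - 1) * \<beta> / (\<alpha> * (\<alpha> - \<beta>)));
             K2 = C2 powr (\<alpha> / (\<alpha> - \<beta>)) * (\<alpha> - \<beta>)
                    * (\<alpha> - 1) powr (- ((\<alpha> - 1) / (\<alpha> - \<beta>)))
                    * \<beta> powr (\<beta> / (\<alpha> - \<beta>))
         in asymptotically_equal (\<lambda>t x y. dist x y powr (- \<alpha> / \<beta>) * t) (at_right 0)
              (time_changed_density \<Omega> S p)
              (\<lambda>t x y. K1 * dist x y powr (- (n * (1 - \<beta>) / (\<alpha> - \<beta>)))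
                          * t powr (- (n * (\<alpha> - 1) * \<beta> / (\<alpha> * (\<alpha> - \<beta>))))
                          * exp (- K2 * dist x y powr (\<alpha> / (\<alpha> - \<beta>))
                                      * t powr (- (\<beta> / (\<alpha> - \<beta>)))))))"
proof -
  interpret subordinator \<Omega> \<beta> S
    by unfold_locales (use assms(1-3) in auto)
  note n = \<open>0 < n\<close> and \<alpha> = \<open>0 < \<alpha>\<close> and C = \<open>0 < C1\<close> \<open>0 < C2\<close>
  show ?thesis
    unfolding Let_def
    by (intro conjI impI large_argument_asymp[OF n \<alpha> C assms(13-16)]
      small_argument_asymp_polynomial[OF n C _ assms(16)] small_argument_asymp_exponential[OF n C _ assms(16)])
qed

end
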